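(* There is a polynomial-time algorithm which, given a planar graph $G$ with $n$ vertices, outputs an edge 2-coloring of $G$ whose largest color group has size $O(n^{2/3})\cdot \mathrm{OPT}_2(G)$, i.e. at most $C n^{2/3}\,\mathrm{OPT}_2(G)$ for an absolute constant $C$.
   Context: An edge 2-coloring of a graph is an assignment of colors to its edges such that each vertex is incident to edges of at most 2 distinct colors. A color group is the set of all edges receiving a given color. $\mathrm{OPT}_2(G)$ denotes the minimum, over all edge 2-colorings of $G$, of the size of the largest color group. *)

theory Defs
  imports "HOL-Analysis.Analysis" "HOL-Computational_Algebra.Polynomial"
begin

section \<open>Edge 2-colorings\<close>

text \<open>
  A graph is given by a vertex set \<open>V\<close> and a set \<open>E\<close> of edges, each edge being the set of
  its two endpoints. Colors are natural numbers; their number is not restricted.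
\<close>

definition edge_2_coloring :: "'a set \<Rightarrow> 'a set set \<Rightarrow> ('a set \<Rightarrow> nat) \<Rightarrow> bool" where
  "edge_2_coloring V E c \<longleftrightarrow> (\<forall>v\<in>V. card (c ` {e \<in> E. v \<in> e}) \<le> 2)"

definition color_group :: "'a set set \<Rightarrow> ('a set \<Rightarrow> nat) \<Rightarrow> nat \<Rightarrow> 'a set set" where
  "color_group E c k = {e \<in> E. c e = k}"

text \<open>The value is \<open>0\<close> for a graph without edges.\<close>

definition largest_group_size :: "'a set set \<Rightarrow> ('a set \<Rightarrow> nat) \<Rightarrow> nat" where
  "largest_group_size E c = Max (insert 0 ((\<lambda>k. card (color_group E c k)) ` c ` E))"

definition OPT2 :: "'a set \<Rightarrow> 'a set set \<Rightarrow> nat" where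
  "OPT2 V E = Inf {largest_group_size E c | c. edge_2_coloring V E c}"

lemma OPT2_attained: "\<exists>c. edge_2_coloring V E c \<and> largest_group_size E c = OPT2 V E"
proof -
  have "card ((\<lambda>_. 0::nat) ` {e \<in> E. v \<in> e}) \<le> 2" for v
    by (rule order_trans[OF card_mono[of "{0}"]]) auto
  then have "edge_2_coloring V E (\<lambda>_. 0)"
    by (simp add: edge_2_coloring_def)
  then have "{largest_group_size E c | c. edge_2_coloring V E c} \<noteq> {}"
    by blast
  from Inf_nat_def1[OF this] show ?thesis
    by (auto simp: OPT2_def)
qed

lemma OPT2_le: "edge_2_coloring V E c \<Longrightarrow> OPT2 V E \<le> largest_group_size E c"
  unfolding OPT2_def by (rule cInf_lower) auto


section \<open>Planar graphs\<close>

text \<open>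
  The plane is \<^typ>\<open>complex\<close>. Vertices are drawn as distinct points and edges as arcs
  joining their endpoints; an arc avoids all other vertices, and two arcs meet only in the
  common endpoints of the edges.
\<close>

definition plane_drawing ::
  "'a set \<Rightarrow> 'a set set \<Rightarrow> ('a \<Rightarrow> complex) \<Rightarrow> ('a set \<Rightarrow> real \<Rightarrow> complex) \<Rightarrow> bool" where
  "plane_drawing V E pt \<gamma> \<longleftrightarrow>
     inj_on pt V \<and>
     (\<forall>e\<in>E. arc (\<gamma> e) \<and> {pathstart (\<gamma> e), pathfinish (\<gamma> e)} = pt ` e \<and>
            path_image (\<gamma> e) \<inter> pt ` V = pt ` e) \<and>
     (\<forall>e\<in>E. \<forall>f\<in>E. e \<noteq> f \<longrightarrow> path_image (\<gamma> e) \<inter> path_image (\<gamma> f) = pt ` (e \<inter> f))"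

definition planar_graph :: "'a set \<Rightarrow> 'a set set \<Rightarrow> bool" where
  "planar_graph V E \<longleftrightarrow> (\<exists>pt \<gamma>. plane_drawing V E pt \<gamma>)"


section \<open>Random access machine programs\<close>

text \<open>
  A program works on finitely many named arrays of natural numbers with indirect addressing;
  a scalar is an array of which only cell \<open>0\<close> is used. Each assignment and each test costs
  one time unit. Since the only arithmetic is addition and truncated subtraction, the bit length
  of the numbers grows by at most a constant per time unit, so that polynomial time in this
  unit-cost model agrees with polynomial time on Turing machines. Multiplication is left out
  because it would break this equivalence.
\<close>

type_synonym store = "string \<Rightarrow> nat \<Rightarrow> nat"

datatype expr =
    Lit nat
  | Read string expr
  | Add expr expr
  | Sub expr expr

datatype prog =
    Skip
  | Assign string expr expr
  | Seq prog prog
  | Cond expr prog prog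
  | While expr prog

fun val :: "expr \<Rightarrow> store \<Rightarrow> nat" where
  "val (Lit k) s = k"
| "val (Read x a) s = s x (val a s)"
| "val (Add a b) s = val a s + val b s"
| "val (Sub a b) s = val a s - val b s"

text \<open>
  \<open>exec P s t s'\<close>: started in \<open>s\<close>, program \<open>P\<close> halts in \<open>s'\<close> after exactly \<open>t\<close> time units.
  Nonzero guards count as true.
\<close>

inductive exec :: "prog \<Rightarrow> store \<Rightarrow> nat \<Rightarrow> store \<Rightarrow> bool" where
  Skip: "exec Skip s 1 s"
| Assign: "exec (Assign x a b) s 1 (s(x := (s x)(val a s := val b s)))"
| Seq: "exec P s t s' \<Longrightarrow> exec Q s' u s'' \<Longrightarrow> exec (Seq P Q) s (t + u) s''"
| CondTrue: "val b s \<noteq> 0 \<Longrightarrow> exec P s t s' \<Longrightarrow> exec (Cond b P Q) s (1 + t) s'"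
| CondFalse: "val b s = 0 \<Longrightarrow> exec Q s t s' \<Longrightarrow> exec (Cond b P Q) s (1 + t) s'"
| WhileFalse: "val b s = 0 \<Longrightarrow> exec (While b P) s 1 s"
| WhileTrue: "val b s \<noteq> 0 \<Longrightarrow> exec P s t s' \<Longrightarrow> exec (While b P) s' u s'' \<Longrightarrow>
    exec (While b P) s (1 + t + u) s''"

inductive_cases SkipE: "exec Skip s t s'"
inductive_cases AssignE: "exec (Assign x a b) s t s'"
inductive_cases SeqE: "exec (Seq P Q) s t s'"
inductive_cases CondE: "exec (Cond b P Q) s t s'"
inductive_cases WhileE: "exec (While b P) s t s'"

lemma exec_deterministic: "exec P s t s' \<Longrightarrow> exec P s u s'' \<Longrightarrow> u = t \<and> s'' = s'"
proof (induction arbitrary: u s'' rule: exec.induct)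
  case Skip
  then show ?case by (rule SkipE) simp
next
  case Assign
  then show ?case by (rule AssignE) simp
next
  case Seq
  from Seq.prems show ?case by (rule SeqE) (metis Seq.IH)
next
  case CondTrue
  from CondTrue.prems show ?case
    by (rule CondE) (metis CondTrue.IH plus_1_eq_Suc, metis CondTrue.hyps(1) less_nat_zero_code)
next
  case CondFalse
  from CondFalse.prems show ?case
    by (rule CondE) (metis CondFalse.hyps(1) less_numeral_extra(3), metis CondFalse.IH plus_1_eq_Suc)
next
  case WhileFalse
  from WhileFalse.prems show ?case
    by (rule WhileE) (simp_all add: WhileFalse.hyps)
next
  case WhileTrue
  from WhileTrue.prems show ?case
    by (rule WhileE) (metis WhileTrue.hyps(1) less_numeral_extra(3), metis WhileTrue.IH plus_1_eq_Suc add_Suc)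
qed


section \<open>Graphs as inputs\<close>

text \<open>
  An input graph has vertex set \<open>{..<n}\<close> and is given by a list of its edges, in any order and
  orientation and without repetitions.
\<close>

definition endpoints :: "nat \<times> nat \<Rightarrow> nat set" where
  "endpoints p = {fst p, snd p}"

definition edges_of :: "(nat \<times> nat) list \<Rightarrow> nat set set" where
  "edges_of es = endpoints ` set es"

definition graph_input :: "nat \<Rightarrow> (nat \<times> nat) list \<Rightarrow> bool" where
  "graph_input n es \<longleftrightarrow>
     (\<forall>(u, v)\<in>set es. u < n \<and> v < n \<and> u \<noteq> v) \<and> distinct (map endpoints es)"

definition input_store :: "nat \<Rightarrow> (nat \<times> nat) list \<Rightarrow> store" where
  "input_store n es = (\<lambda>x i.
     if x = ''n'' \<and> i = 0 then n
     else if x = ''m'' \<and> i = 0 then length es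
     else if x = ''u'' \<and> i < length es then fst (es ! i)
     else if x = ''v'' \<and> i < length es then snd (es ! i)
     else 0)"

text \<open>The output is the array \<open>color\<close>, whose cell \<open>i\<close> holds the color of the \<open>i\<close>-th edge.\<close>

definition outputs_coloring :: "(nat \<times> nat) list \<Rightarrow> store \<Rightarrow> (nat set \<Rightarrow> nat) \<Rightarrow> bool" where
  "outputs_coloring es s c \<longleftrightarrow> (\<forall>i<length es. c (endpoints (es ! i)) = s ''color'' i)"

end

theory Submission
  imports Defs
begin

text \<open>
  Let \<open>\<Delta>\<close> be the maximum degree; as every vertex sees two colors, \<open>\<Delta> \<le> 2 OPT2\<close>. Given a set \<open>S\<close>
  of \<open>O(n powr (2/3))\<close> vertices such that all components of \<open>G - S\<close> have \<open>O(n powr (2/3))\<close> vertices,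
  color the edges that meet \<open>S\<close> with \<open>0\<close> and the edges of each component of \<open>G - S\<close> with a color
  of its own. Every color group then has at most \<open>O(n powr (2/3)) \<Delta>\<close> edges.

  \<open>S\<close> is built by splitting components \<open>K\<close> with more than \<open>n powr (2/3)\<close> vertices by separators of
  \<open>O(sqrt (card K))\<close> vertices. These are found without a planar embedding, by a variant of the method
  of Alon, Seymour and Thomas: one maintains pairwise adjacent connected sets around a large part
  \<open>B\<close> of \<open>K\<close>, with small contact to \<open>B\<close>. Balls grown in \<open>B\<close> from the contacts either have a common
  vertex, so that a small tree touches all sets and is a new one, or their thin boundaries cut
  \<open>B\<close> off from one of the sets, which then grows. A sixth set would give a \<open>K\<^sub>6\<close> minor, which
  planarity excludes: \<open>K\<^sub>3\<^sub>,\<^sub>3\<close> cannot be drawn since two crossing chords on the same side of a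
  Jordan curve must meet.
\<close>

section \<open>The plane does not contain a drawing of \<open>K\<^sub>3\<^sub>,\<^sub>3\<close>\<close>

text \<open>The exponent balances two quantities: splitting all components down to \<open>r\<close>
  vertices costs about \<open>n / sqrt r\<close> separator vertices in total, and
  \<open>r = n powr (2/3)\<close> solves \<open>n / sqrt r = r\<close>. The total is found without a
  recursion tree: a vertex outside \<open>S\<close> weighs one over the root of its component size,
  so a component with \<open>k\<close> vertices weighs \<open>sqrt k\<close>, and halving it gains
  at least \<open>(sqrt 2 - 1) * sqrt k\<close>, a fixed fraction of the cost of the separator. Four
  sets and a tree would give \<open>K\<^sub>5\<close>. A fifth set is spent so that six sets split
  into three and three: the vertices of \<open>K\<^sub>3\<^sub>,\<^sub>3\<close> have degree three,
  so a minor yields drawn paths at once, and one nonplanar graph suffices. The running time is part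
  of the claim. The search is written in a small language whose only loops repeat \<open>N\<close>
  times, so that a polynomial bound is read off the syntax. In return, each loop must be shown to
  idle once its goal is reached, and roots are replaced by comparisons of products.\<close>

lemma theta_curve_inside:
  fixes c1 c2 c3 :: "real \<Rightarrow> complex"
  assumes arcs: "arc c1" "arc c2" "arc c3"
    and s: "pathstart c1 = a" "pathstart c2 = a" "pathstart c3 = a"
    and f: "pathfinish c1 = b" "pathfinish c2 = b" "pathfinish c3 = b"
    and I: "path_image c1 \<inter> path_image c2 = {a,b}" "path_image c1 \<inter> path_image c3 = {a,b}"
      "path_image c2 \<inter> path_image c3 = {a,b}"
    and c3: "path_image c3 - {a,b} \<subseteq> inside (path_image c1 \<union> path_image c2)"
    and W: "connected W" "W \<subseteq> inside (path_image c1 \<union> path_image c2)" "W \<inter> path_image c3 = {}"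
    and p1: "p1 \<in> path_image c1" "p1 \<notin> {a,b}" "p1 \<in> closure W"
    and p2: "p2 \<in> path_image c2" "p2 \<notin> {a,b}" "p2 \<in> closure W"
  shows False
proof -
  have ab: "a \<noteq> b" using arcs(1) s(1) f(1) arc_distinct_ends by metis
  have sp: "simple_path c1" "simple_path c2" "simple_path c3" using arcs by (auto simp: arc_imp_simple_path)
  have ne: "path_image c3 \<inter> inside (path_image c1 \<union> path_image c2) \<noteq> {}"
    using c3 nonempty_simple_path_endless[OF sp(3)] s f by auto
  let ?A = "inside (path_image c1 \<union> path_image c3)"
  let ?B = "inside (path_image c2 \<union> path_image c3)"
  \<comment> \<open>The arc \<open>c3\<close> cuts the interior of the closed curve into two
    regions; the connected set \<open>W\<close> has to stay in one of them.\<close>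
  have dis: "?A \<inter> ?B = {}" and un: "?A \<union> ?B \<union> (path_image c3 - {a,b}) = inside (path_image c1 \<union> path_image c2)"
    using split_inside_simple_closed_curve[OF sp(1) s(1) f(1) sp(2) s(2) f(2) sp(3) s(3) f(3) ab I ne] by blast+
  have loops: "simple_path (c1 +++ reversepath c3)" "simple_path (c2 +++ reversepath c3)"
    using arcs s f I by (auto simp: simple_path_join_loop_eq arc_reversepath)
  have im: "path_image (c1 +++ reversepath c3) = path_image c1 \<union> path_image c3"
     "path_image (c2 +++ reversepath c3) = path_image c2 \<union> path_image c3"
    using s f by (auto simp: path_image_join)
  have opn: "open ?A" "open ?B"
    using Jordan_inside_outside[OF loops(1)] Jordan_inside_outside[OF loops(2)] im s f by auto
  have cl: "closure ?A \<subseteq> ?A \<union> (path_image c1 \<union> path_image c3)"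
           "closure ?B \<subseteq> ?B \<union> (path_image c2 \<union> path_image c3)"
    using Jordan_inside_outside[OF loops(1)] Jordan_inside_outside[OF loops(2)] im s f
    by (auto simp: closure_Un_frontier)
  have "W \<subseteq> ?A \<union> ?B" using W un by blast
  then have "W \<subseteq> ?A \<or> W \<subseteq> ?B"
    using connectedD[OF W(1) opn] dis by blast
  moreover have "inside (path_image c1 \<union> path_image c2) \<inter> (path_image c1 \<union> path_image c2) = {}"
    using inside_no_overlap by blast
  ultimately show False
  proof (elim disjE)
    \<comment> \<open>The closure of \<open>?A\<close> adds only points of \<open>c1\<close> and
      \<open>c3\<close>. The point \<open>p2\<close> is an inner point of \<open>c2\<close>, hence
      on neither of them, and it is not inside the outer curve either.\<close>
    assume "W \<subseteq> ?A"
    then have "p2 \<in> closure ?A" using p2 closure_mono by blast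
    with cl have "p2 \<in> ?A \<or> p2 \<in> path_image c1 \<union> path_image c3" by blast
    then show False using p2 I un \<open>inside (path_image c1 \<union> path_image c2) \<inter> (path_image c1 \<union> path_image c2) = {}\<close> by blast
  next
    assume "W \<subseteq> ?B"
    then have "p1 \<in> closure ?B" using p1 closure_mono by blast
    with cl have "p1 \<in> ?B \<or> p1 \<in> path_image c2 \<union> path_image c3" by blast
    then show False using p1 I un \<open>inside (path_image c1 \<union> path_image c2) \<inter> (path_image c1 \<union> path_image c2) = {}\<close> by blast
  qed
qed

text \<open>Inversion at an inner point \<open>z0\<close> exchanges the sides of the curve, because
  \<open>z0\<close> goes to infinity. If an outer point were sent to the unbounded side of the
  image, pulling that side back would connect it to points near \<open>z0\<close> without crossing
  the curve.\<close>

lemma inversion_outside_subset_inside: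
  fixes J :: "real \<Rightarrow> complex"
  assumes J: "simple_path J" "pathfinish J = pathstart J" and z0: "z0 \<in> inside (path_image J)"
  shows "(\<lambda>z. 1 / (z - z0)) ` outside (path_image J) \<subseteq> inside (path_image ((\<lambda>z. 1 / (z - z0)) \<circ> J))"
proof
  let ?f = "\<lambda>z. 1 / (z - z0)"
  let ?g = "\<lambda>w. z0 + 1 / w"
  let ?I = "inside (path_image J)" and ?O = "outside (path_image J)"
  note JJ = Jordan_inside_outside[OF J]
  have z0J: "z0 \<notin> path_image J" using JJ z0 by blast
  have inj: "inj_on ?f (path_image J)" by (auto simp: inj_on_def)
  have contf: "continuous_on (path_image J) ?f" using z0J by (intro continuous_intros) auto
  have J': "simple_path (?f \<circ> J)" "pathfinish (?f \<circ> J) = pathstart (?f \<circ> J)"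
    using J contf inj by (auto simp: simple_path_continuous_image pathstart_def pathfinish_def)
  note JJ' = Jordan_inside_outside[OF J']
  let ?O' = "outside (path_image (?f \<circ> J))"
  fix y assume "y \<in> ?f ` ?O"
  then obtain x where x: "x \<in> ?O" "y = ?f x" by auto
  have xz: "x \<noteq> z0" using x z0 JJ by blast
  have ynJ: "y \<notin> path_image (?f \<circ> J)"
  proof
    assume "y \<in> path_image (?f \<circ> J)"
    then obtain u where "u \<in> path_image J" "1/(u - z0) = 1/(x - z0)" using x by (auto simp: path_image_def)
    then have "u = x" by (auto simp: field_simps)
    then show False using \<open>u \<in> path_image J\<close> x JJ by blast
  qed
  show "y \<in> inside (path_image (?f \<circ> J))"
  proof (rule ccontr)
    assume "y \<notin> inside (path_image (?f \<circ> J))"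
    then have yO: "y \<in> ?O'" using ynJ JJ' by blast
    obtain e where e: "e > 0" "ball z0 e \<subseteq> ?I" 
      using z0 conjunct1[OF conjunct2[OF JJ]] by (auto simp: open_contains_ball)
    obtain R where R: "path_image (?f \<circ> J) \<subseteq> ball 0 R" "R > 0"
      using bounded_simple_path_image[OF J'(1)] bounded_subset_ballD by blast
    have big: "w \<in> ?O'" if "norm w \<ge> R" for w
      using outside_subset_convex[OF convex_ball R(1)] that by auto
    \<comment> \<open>The bound \<open>e/2\<close> keeps \<open>z0 + d\<close> inside the curve, and
      \<open>1/R\<close> sends it at least \<open>R\<close> away from the origin, hence into the
      unbounded side.\<close>
    define d where "d = min (e/2) (1/R)"
    have d: "d > 0" "d < e" "1/d \<ge> R" using e R by (auto simp: d_def field_simps min_def)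
    define x2 where "x2 = z0 + of_real d"
    have x2: "x2 \<in> ?I" using e d by (auto simp: x2_def dist_norm subset_iff)
    have fx2: "?f x2 \<in> ?O'" using d by (intro big) (auto simp: x2_def norm_divide)
    \<comment> \<open>\<open>0\<close> is the image of infinity, where the inverse map is not
      continuous. A connected open set of the plane stays connected without one point.\<close>
    have con: "connected (?O' - {0})" using JJ' by (intro connected_open_delete) auto
    have "continuous_on (?O' - {0}) ?g" by (intro continuous_intros) auto
    then have con2: "connected (?g ` (?O' - {0}))" using con connected_continuous_image by blast
    have y0: "y \<noteq> 0" "?f x2 \<noteq> 0" using x xz d by (auto simp: x2_def)
    have gy: "?g y = x" "?g (?f x2) = x2" using x xz by auto
    have "?g ` (?O' - {0}) \<inter> path_image J = {}"
    proof (rule ccontr)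
      assume "\<not> ?thesis"
      then obtain w where w: "w \<in> ?O'" "w \<noteq> 0" "?g w \<in> path_image J" by auto
      then have "w = ?f (?g w)" by auto
      then have "w \<in> path_image (?f \<circ> J)" using w(3) unfolding path_image_def image_comp[symmetric] by blast
      then show False using w JJ' by blast
    qed
    then have "?g ` (?O' - {0}) \<subseteq> ?I \<union> ?O" by auto
    then have "?I \<inter> (?g ` (?O' - {0})) = {} \<or> ?O \<inter> (?g ` (?O' - {0})) = {}"
    proof (intro connectedD[OF con2])
      show "?I \<inter> ?O \<inter> ?g ` (?O' - {0}) = {}" by simp
    qed (use JJ in auto)
    moreover have "x \<in> ?g ` (?O' - {0})" "x2 \<in> ?g ` (?O' - {0})"
      using gy yO fx2 y0 by (metis Diff_iff image_eqI singletonD)+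
    ultimately show False using x(1) x2 by blast
  qed
qed

text \<open>Frees the previous argument from the bounded face. The set \<open>M\<close> only forces
  \<open>c3\<close> and \<open>W\<close> into the same face of \<open>c1\<close> and
  \<open>c2\<close>; if this is the outer one, an inversion moves it to the inside.\<close>

lemma theta_curve_face:
  fixes c1 c2 c3 :: "real \<Rightarrow> complex"
  assumes arcs: "arc c1" "arc c2" "arc c3"
    and s: "pathstart c1 = a" "pathstart c2 = a" "pathstart c3 = a"
    and f: "pathfinish c1 = b" "pathfinish c2 = b" "pathfinish c3 = b"
    and I: "path_image c1 \<inter> path_image c2 = {a,b}" "path_image c1 \<inter> path_image c3 = {a,b}"
      "path_image c2 \<inter> path_image c3 = {a,b}"
    and M: "connected M" "M \<inter> (path_image c1 \<union> path_image c2) = {}" "path_image c3 - {a,b} \<subseteq> M"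
    and W: "connected W" "W \<subseteq> M" "W \<inter> path_image c3 = {}"
    and p1: "p1 \<in> path_image c1" "p1 \<notin> {a,b}" "p1 \<in> closure W"
    and p2: "p2 \<in> path_image c2" "p2 \<notin> {a,b}" "p2 \<in> closure W"
  shows False
proof -
  define J where "J = c1 +++ reversepath c2"
  have J: "simple_path J" "pathfinish J = pathstart J" and im: "path_image J = path_image c1 \<union> path_image c2"
    using arcs s f I by (auto simp: J_def simple_path_join_loop_eq arc_reversepath path_image_join)
  note JJ = Jordan_inside_outside[OF J]
  have "inside (path_image J) \<inter> M = {} \<or> outside (path_image J) \<inter> M = {}"
  proof (rule connectedD[OF M(1)])
    show "inside (path_image J) \<inter> outside (path_image J) \<inter> M = {}" by simp
    show "M \<subseteq> inside (path_image J) \<union> outside (path_image J)" using M(2) by (auto simp: im)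
  qed (use JJ in auto)
  moreover have "M \<subseteq> inside (path_image J) \<union> outside (path_image J)"
    using M(2) by (auto simp: im)
  ultimately have "M \<subseteq> inside (path_image J) \<or> M \<subseteq> outside (path_image J)"
    by blast
  then show False
  proof
    assume "M \<subseteq> inside (path_image J)"
    then have "M \<subseteq> inside (path_image c1 \<union> path_image c2)" by (simp only: im)
    then show False
      using theta_curve_inside[OF arcs s f I order_trans[OF M(3)] W(1) order_trans[OF W(2)] W(3) p1 p2]
      by simp
  next
    assume out: "M \<subseteq> outside (path_image J)"
    obtain z0 where z0: "z0 \<in> inside (path_image J)" using JJ by blast
    let ?f = "\<lambda>z. 1 / (z - z0)"
    have sub: "?f ` M \<subseteq> inside (path_image (?f \<circ> J))"
      using inversion_outside_subset_inside[OF J z0] out by blast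
    \<comment> \<open>Injective on the whole plane: by the convention \<open>1 / 0 = 0\<close>, the
      point \<open>z0\<close> too has an image that no other point has.\<close>
    have injf: "inj ?f" by (auto simp: inj_def)
    have clW: "closure W \<subseteq> - inside (path_image J)"
    proof (rule closure_minimal)
      show "W \<subseteq> - inside (path_image J)"
        using out W(2) inside_Int_outside[of "path_image J"] by blast
    qed (use JJ in \<open>auto simp: closed_Compl\<close>)
    have ends: "a \<in> path_image c1" "b \<in> path_image c1" using s f by auto
    have zn: "z0 \<notin> path_image c1 \<union> path_image c2" "z0 \<notin> M" "z0 \<notin> path_image c3" "z0 \<notin> closure W"
    proof -
      have nJ: "z0 \<notin> path_image J" "z0 \<notin> outside (path_image J)"
        using z0 inside_no_overlap[of "path_image J"] inside_Int_outside[of "path_image J"] by blast+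
      then show "z0 \<notin> path_image c1 \<union> path_image c2" "z0 \<notin> M" using im out by auto
      then show "z0 \<notin> path_image c3" using M(3) ends by blast
      show "z0 \<notin> closure W" using clW z0 by blast
    qed
    have cont: "continuous_on S ?f" if "z0 \<notin> S" for S using that by (intro continuous_intros) auto
    have arcs': "arc (?f \<circ> c1)" "arc (?f \<circ> c2)" "arc (?f \<circ> c3)"
      using arcs zn unfolding arc_def
      by (auto intro!: path_continuous_image cont comp_inj_on inj_on_subset[OF injf] simp del: o_apply)
    have imf: "path_image (?f \<circ> c) = ?f ` path_image c" for c by (simp add: path_image_compose)
    have se: "pathstart (?f \<circ> c) = ?f (pathstart c)" "pathfinish (?f \<circ> c) = ?f (pathfinish c)" for c
      by (simp_all add: pathstart_def pathfinish_def)
    have imJ: "path_image (?f \<circ> J) = ?f ` path_image c1 \<union> ?f ` path_image c2" by (simp only: imf im image_Un)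
    have pc: "?f p \<in> closure (?f ` W)" if "p \<in> closure W" for p
    proof -
      have "?f ` closure W \<subseteq> closure (?f ` W)"
        by (rule image_closure_subset[OF cont[OF zn(4)] closed_closure closure_subset])
      then show ?thesis using that by blast
    qed
    have II: "?f ` path_image c1 \<inter> ?f ` path_image c2 = {?f a, ?f b}"
      "?f ` path_image c1 \<inter> ?f ` path_image c3 = {?f a, ?f b}"
      "?f ` path_image c2 \<inter> ?f ` path_image c3 = {?f a, ?f b}"
      unfolding image_Int[OF injf, symmetric] I by (simp_all only: image_insert image_empty)
    show False
    proof (rule theta_curve_inside[OF arcs', where a = "?f a" and b = "?f b" and W = "?f ` W"
          and ?p1.0 = "?f p1" and ?p2.0 = "?f p2"], unfold se imf)
      show "connected (?f ` W)"
        using W(1) cont[of W] zn W(2) by (intro connected_continuous_image) auto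
      show "?f ` path_image c3 - {?f a, ?f b} \<subseteq> inside (?f ` path_image c1 \<union> ?f ` path_image c2)"
        using sub M(3) unfolding imJ by blast
      show "?f ` W \<subseteq> inside (?f ` path_image c1 \<union> ?f ` path_image c2)"
        using sub W(2) unfolding imJ by blast
      show "?f ` W \<inter> ?f ` path_image c3 = {}"
        unfolding image_Int[OF injf, symmetric] W(3) by (simp only: image_empty)
      show "?f p1 \<notin> {?f a, ?f b}" "?f p2 \<notin> {?f a, ?f b}"
        using p1(2) p2(2) by (simp_all only: insert_iff empty_iff inj_eq[OF injf] not_False_eq_True)
      show "?f p1 \<in> ?f ` path_image c1" "?f p2 \<in> ?f ` path_image c2"
        by (rule imageI[OF p1(1)], rule imageI[OF p2(1)])
    qed (rule II pc p1 p2 arg_cong[where f = ?f] s f)+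
  qed
qed

text \<open>\<open>g i j\<close> is the arc of the edge joining the \<open>i\<close>-th vertex of one side to the \<open>j\<close>-th of the other.\<close>

lemma no_plane_K33:
  fixes g :: "nat \<Rightarrow> nat \<Rightarrow> real \<Rightarrow> complex"
  assumes arc: "\<And>i j. i < 3 \<Longrightarrow> j < 3 \<Longrightarrow> arc (g i j)"
    and st: "\<And>i j. i < 3 \<Longrightarrow> j < 3 \<Longrightarrow> pathstart (g i j) = x i"
    and fi: "\<And>i j. i < 3 \<Longrightarrow> j < 3 \<Longrightarrow> pathfinish (g i j) = p j"
    and dis: "\<And>i j k l. i < 3 \<Longrightarrow> j < 3 \<Longrightarrow> k < 3 \<Longrightarrow> l < 3 \<Longrightarrow> (i, j) \<noteq> (k, l) \<Longrightarrow>
       path_image (g i j) \<inter> path_image (g k l) \<subseteq> {z. (i = k \<and> z = x i) \<or> (j = l \<and> z = p j)}"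
    and injx: "inj_on x {..<3}" and injp: "inj_on p {..<3}" and xp: "\<And>i j. i < 3 \<Longrightarrow> j < 3 \<Longrightarrow> x i \<noteq> p j"
  shows False
proof -
  define P where "P i j = path_image (g i j)" for i j
  have mem: "x i \<in> P i j" "p j \<in> P i j" if "i < 3" "j < 3" for i j
    using pathstart_in_path_image[of "g i j"] pathfinish_in_path_image[of "g i j"] st fi that
    by (simp_all add: P_def)
  have D0: "P i j \<inter> P k l = {}" if "i < 3" "j < 3" "k < 3" "l < 3" "i \<noteq> k" "j \<noteq> l" for i j k l
    using dis[of i j k l] that by (auto simp: P_def)
  have D1: "P i j \<inter> P i l = {x i}" if "i < 3" "j < 3" "l < 3" "j \<noteq> l" for i j l
    using dis[of i j i l] mem[of i j] mem[of i l] that by (auto simp: P_def)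
  have D2: "P i j \<inter> P k j = {p j}" if "i < 3" "j < 3" "k < 3" "i \<noteq> k" for i j k
    using dis[of i j k j] mem[of i j] mem[of k j] that by (auto simp: P_def)
  have xne: "x 0 \<noteq> x 1" "x 0 \<noteq> x 2" "x 1 \<noteq> x 2" "p 0 \<noteq> p 1" "p 0 \<noteq> p 2" "p 1 \<noteq> p 2"
    by (simp_all add: inj_on_eq_iff[OF injx] inj_on_eq_iff[OF injp])
  \<comment> \<open>The vertices \<open>x 0\<close> and \<open>x 1\<close> and the three paths
    between them through \<open>p 0\<close>, \<open>p 1\<close>, \<open>p 2\<close> form a theta
    curve; the contradiction comes from placing \<open>x 2\<close>.\<close>
  define c where "c j = g 0 j +++ reversepath (g 1 j)" for j
  have cim: "path_image (c j) = P 0 j \<union> P 1 j" if "j < 3" for j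
    using fi[of 0 j] fi[of 1 j] that by (simp add: c_def path_image_join P_def)
  have cims: "path_image (c 0) = P 0 0 \<union> P 1 0" "path_image (c 1) = P 0 1 \<union> P 1 1"
    "path_image (c 2) = P 0 2 \<union> P 1 2" by (rule cim; simp)+
  have carc: "arc (c j)" if "j < 3" for j
    using arc[of 0 j] arc[of 1 j] fi[of 0 j] fi[of 1 j] that D2[of 0 j 1]
    by (simp add: c_def arc_join_eq arc_reversepath P_def)
  have cends: "pathstart (c j) = x 0" "pathfinish (c j) = x 1" if "j < 3" for j
    using st[of 0 j] st[of 1 j] that by (simp_all add: c_def)
  have cI: "path_image (c j) \<inter> path_image (c l) = {x 0, x 1}" if "j < 3" "l < 3" "j \<noteq> l" for j l
  proof -
    have "path_image (c j) \<inter> path_image (c l) =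
      (P 0 j \<inter> P 0 l) \<union> (P 0 j \<inter> P 1 l) \<union> (P 1 j \<inter> P 0 l) \<union> (P 1 j \<inter> P 1 l)"
      using that by (auto simp: cim)
    then show ?thesis
      using that D0[of 0 j 1 l] D0[of 1 j 0 l] D1[of 0 j l] D1[of 1 j l] by simp
  qed
  define w where "w = reversepath (g 2 0) +++ g 2 1"
  have wim: "path_image w = P 2 0 \<union> P 2 1"
    using st[of 2 0] st[of 2 1] by (simp add: w_def path_image_join P_def)
  have warc: "arc w" using arc[of 2 0] arc[of 2 1] st[of 2 0] st[of 2 1] D1[of 2 0 1]
    by (simp add: w_def arc_join_eq arc_reversepath P_def)
  have wends: "pathstart w = p 0" "pathfinish w = p 1"
    using fi[of 2 0] fi[of 2 1] by (simp_all add: w_def)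
  define W where "W = path_image w - {p 0, p 1}"
  have Wcon: "connected W"
    using connected_simple_path_endless[of w] warc wends by (simp add: W_def arc_imp_simple_path)
  \<comment> \<open>Puts \<open>p 0\<close> and \<open>p 1\<close>, which were removed from
    \<open>W\<close>, into its closure.\<close>
  have "w ` closure {0<..<1} \<subseteq> closure W"
  proof (rule image_closure_subset)
    show "continuous_on (closure {0<..<1}) w" using warc by (simp add: arc_def path_def)
    show "w ` {0<..<1} \<subseteq> closure W"
      using simple_path_endless[OF arc_imp_simple_path[OF warc]] wends closure_subset[of W] by (simp add: W_def)
  qed simp
  then have Wcl: "path_image w \<subseteq> closure W" by (simp add: path_image_def)
  define c3 where "c3 = path_image (c 2) - {x 0, x 1}"
  have c3con: "connected c3"
    using connected_simple_path_endless[of "c 2"] carc[of 2] cends[of 2] by (simp add: c3_def arc_imp_simple_path)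
  have Pcon: "connected (P 2 2)" unfolding P_def
    by (rule connected_path_image) (use arc[of 2 2] in \<open>auto simp: arc_imp_path\<close>)
  \<comment> \<open>The edge from \<open>x 2\<close> to \<open>p 2\<close> ties \<open>W\<close> to
    the inner part of \<open>c 2\<close> without meeting \<open>c 0\<close> or \<open>c 1\<close>.
    So both lie in one face, where \<open>c 2\<close> separates the inner points of
    \<open>c 0\<close> from those of \<open>c 1\<close>; yet \<open>W\<close> reaches both.\<close>
  define M where "M = W \<union> P 2 2 \<union> c3"
  have x2W: "x 2 \<in> W" unfolding W_def wim using mem[of 2 0] xp[of 2 0] xp[of 2 1] by auto
  have p2c: "p 2 \<in> c3" unfolding c3_def using mem[of 0 2] cim[of 2] xp[of 0 2] xp[of 1 2] by auto
  have Mcon: "connected M" unfolding M_def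
    using x2W p2c mem[of 2 2] by (intro connected_Un Wcon Pcon c3con) auto
  have Mdis: "M \<inter> (path_image (c 0) \<union> path_image (c 1)) = {}"
  proof -
    have "W \<inter> (path_image (c 0) \<union> path_image (c 1)) = {}"
      unfolding W_def wim cims
      using D0[of 2 0 0 1] D0[of 2 0 1 1] D0[of 2 1 0 0] D0[of 2 1 1 0]
        D2[of 2 0 0] D2[of 2 0 1] D2[of 2 1 0] D2[of 2 1 1] by auto
    moreover have "P 2 2 \<inter> (path_image (c 0) \<union> path_image (c 1)) = {}"
      unfolding cims
      using D0[of 2 2 0 1] D0[of 2 2 1 1] D0[of 2 2 0 0] D0[of 2 2 1 0] by auto
    moreover have "c3 \<inter> (path_image (c 0) \<union> path_image (c 1)) = {}"
      using cI[of 2 0] cI[of 2 1] unfolding c3_def by auto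
    ultimately show ?thesis unfolding M_def by blast
  qed
  show False
  proof (rule theta_curve_face[OF carc[of 0] carc[of 1] carc[of 2], of "x 0" "x 1" M W "p 0" "p 1"])
    show "W \<inter> path_image (c 2) = {}"
      unfolding W_def wim cims
      using D0[of 2 0 0 2] D0[of 2 0 1 2] D0[of 2 1 0 2] D0[of 2 1 1 2] by auto
    show "p 0 \<in> closure W" "p 1 \<in> closure W" using Wcl mem[of 2 0] mem[of 2 1] by (auto simp: wim)
    show "p 0 \<in> path_image (c 0)" "p 1 \<in> path_image (c 1)" using mem cim by auto
    show "p 0 \<notin> {x 0, x 1}" "p 1 \<notin> {x 0, x 1}" using xp[of 0 0] xp[of 1 0] xp[of 0 1] xp[of 1 1] by auto
  qed (use cends cI Mcon Mdis Wcon in \<open>auto simp: M_def c3_def\<close>)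
qed

section \<open>Minors of planar graphs\<close>

definition induces_connected :: "('a \<times> 'a) set \<Rightarrow> 'a set \<Rightarrow> bool" where
  "induces_connected G A \<longleftrightarrow> (\<forall>u\<in>A. \<forall>w\<in>A. (u, w) \<in> (G \<inter> A \<times> A)\<^sup>*)"

definition graph_path :: "('a \<times> 'a) set \<Rightarrow> 'a set \<Rightarrow> 'a list \<Rightarrow> bool" where
  "graph_path G C xs \<longleftrightarrow> xs \<noteq> [] \<and> distinct xs \<and> set xs \<subseteq> C \<and> successively (\<lambda>x y. (x, y) \<in> G) xs"

text \<open>The path is built backwards along a walk. A new vertex in \<open>S\<close> starts afresh
  as a path of its own, a vertex already on the path cuts off a loop, and any other vertex is put in
  front.\<close>

lemma graph_path_first_hit:
  assumes "(u, w) \<in> (G \<inter> C \<times> C)\<^sup>*" "w \<in> S" "w \<in> C"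
  shows "\<exists>xs. graph_path G C xs \<and> hd xs = u \<and> set xs \<inter> S = {last xs}"
  using assms
proof (induction rule: converse_rtrancl_induct)
  case base
  then show ?case by (intro exI[of _ "[w]"]) (auto simp: graph_path_def)
next
  case (step u v)
  then obtain xs where xs: "graph_path G C xs" "hd xs = v" "set xs \<inter> S = {last xs}" by blast
  have uC: "u \<in> C" "(u, v) \<in> G" using step by auto
  consider "u \<in> S" | "u \<notin> S" "u \<in> set xs" | "u \<notin> S" "u \<notin> set xs" by blast
  then show ?case
  proof cases
    case 1
    then show ?thesis using uC by (intro exI[of _ "[u]"]) (auto simp: graph_path_def)
  next
    case 2
    then obtain ys zs where e: "xs = ys @ u # zs" by (meson split_list)
    then have l: "last (u # zs) = last xs" by simp
    have "last xs \<in> set (u # zs)" unfolding l[symmetric] by (rule last_in_set) simp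
    moreover have "set (u # zs) \<subseteq> set xs" using e by auto
    ultimately have "set (u # zs) \<inter> S = {last (u # zs)}" using xs(3) unfolding l by blast
    moreover have "graph_path G C (u # zs)"
      using xs(1) unfolding e graph_path_def by (auto simp: successively_append_iff)
    ultimately show ?thesis by (intro exI[of _ "u # zs"]) simp
  next
    case 3
    have "graph_path G C (u # xs)" using xs 3 uC by (auto simp: graph_path_def successively_Cons)
    moreover have "last (u # xs) = last xs" using xs(1) by (auto simp: graph_path_def)
    ultimately show ?thesis using 3 xs(3) by (intro exI[of _ "u # xs"]) auto
  qed
qed

lemma graph_path_rev: "sym G \<Longrightarrow> graph_path G C xs \<Longrightarrow> graph_path G C (rev xs)"
  by (auto simp: graph_path_def sym_def elim: successively_mono)

text \<open>Take a path from \<open>t 0\<close> to \<open>t 1\<close> and a path from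
  \<open>t 2\<close> that stops at its first vertex on it; that vertex is the center
  \<open>x\<close>. A leg may consist of \<open>x\<close> alone.\<close>

lemma tripod_exists:
  assumes "sym G" "induces_connected G C" "t 0 \<in> C" "t 1 \<in> C" "t 2 \<in> C"
  shows "\<exists>P x. (\<forall>i<3::nat. graph_path G C (P i) \<and> hd (P i) = x \<and> last (P i) = t i) \<and>
     (\<forall>i<3. \<forall>j<3. i \<noteq> j \<longrightarrow> set (P i) \<inter> set (P j) = {x})"
proof -
  have "(t 0, t 1) \<in> (G \<inter> C \<times> C)\<^sup>*" using assms by (auto simp: induces_connected_def)
  from graph_path_first_hit[OF this, of "{t 1}"] assms obtain xs where
    xs: "graph_path G C xs" "hd xs = t 0" "last xs = t 1" by auto
  have xne: "xs \<noteq> []" using xs by (auto simp: graph_path_def)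
  have "(t 2, t 0) \<in> (G \<inter> C \<times> C)\<^sup>*" using assms by (auto simp: induces_connected_def)
  moreover have "t 0 \<in> set xs" using xs xne by (metis hd_in_set)
  ultimately obtain ys where ys: "graph_path G C ys" "hd ys = t 2" "set ys \<inter> set xs = {last ys}"
    using graph_path_first_hit[of "t 2" "t 0" G C "set xs"] assms by blast
  define x where "x = last ys"
  have yne: "ys \<noteq> []" using ys by (auto simp: graph_path_def)
  have "x \<in> set xs" using ys by (auto simp: x_def)
  then obtain as bs where e: "xs = as @ x # bs" by (meson split_list)
  define P where "P i = (if i = 0 then rev (as @ [x]) else if i = 1 then x # bs else rev ys)" for i :: nat
  have g1: "graph_path G C (as @ [x])" and g2: "graph_path G C (x # bs)"
    using xs(1) unfolding e graph_path_def by (auto simp: successively_append_iff)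
  have s: "set (P 0) \<subseteq> set xs" "set (P 1) \<subseteq> set xs" "set (P 2) = set ys" "x \<in> set (P 0)" "x \<in> set (P 1)"
    by (auto simp: P_def e)
  have "set (P 0) \<inter> set (P 1) = {x}" using xs(1) by (auto simp: graph_path_def e P_def)
  moreover have "set (P 0) \<inter> set (P 2) = {x}" "set (P 1) \<inter> set (P 2) = {x}"
    using s ys(3) x_def by auto
  moreover have "hd (P i) = x" if "i < 3" for i using that yne by (auto simp: P_def hd_rev x_def)
  moreover have "last (P 0) = t 0" using xs(2) e by (cases as) (auto simp: P_def last_rev)
  moreover have "last (P 1) = t 1" using xs(3) e by (auto simp: P_def)
  moreover have "last (P 2) = t 2" using ys(2) yne by (auto simp: P_def last_rev)
  moreover have "graph_path G C (P i)" for i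
    using graph_path_rev[OF assms(1) g1] g2 graph_path_rev[OF assms(1) ys(1)] by (simp add: P_def)
  ultimately show ?thesis
    by (intro exI[of _ P] exI[of _ x]) (auto simp: numeral_3_eq_3 numeral_2_eq_2 less_Suc_eq)
qed

section \<open>Paths of a plane graph drawn as arcs\<close>

fun path_edges :: "'a list \<Rightarrow> 'a set set" where
  "path_edges (x # y # zs) = insert {x, y} (path_edges (y # zs))"
| "path_edges _ = {}"

lemma path_edges_subset: "e \<in> path_edges xs \<Longrightarrow> e \<subseteq> set xs"
  by (induction xs rule: path_edges.induct) auto

lemma path_edges_doubleton: "distinct xs \<Longrightarrow> e \<in> path_edges xs \<Longrightarrow> \<exists>u v. e = {u, v} \<and> u \<noteq> v"
  by (induction xs rule: path_edges.induct) auto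

lemma path_edges_in: "successively (\<lambda>x y. {x, y} \<in> E) xs \<Longrightarrow> path_edges xs \<subseteq> E"
  by (induction xs rule: path_edges.induct) auto

lemma plane_drawing_meet:
  assumes "plane_drawing V E pt \<gamma>" "path_edges xs \<subseteq> E" "path_edges ys \<subseteq> E"
    "path_edges xs \<inter> path_edges ys = {}"
  shows "(\<Union>e\<in>path_edges xs. path_image (\<gamma> e)) \<inter> (\<Union>e\<in>path_edges ys. path_image (\<gamma> e))
    \<subseteq> pt ` (set xs \<inter> set ys)"
proof
  fix z assume "z \<in> (\<Union>e\<in>path_edges xs. path_image (\<gamma> e)) \<inter> (\<Union>e\<in>path_edges ys. path_image (\<gamma> e))"
  then obtain e f where ef: "e \<in> path_edges xs" "f \<in> path_edges ys" "z \<in> path_image (\<gamma> e) \<inter> path_image (\<gamma> f)"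
    by blast
  then have "e \<noteq> f" "e \<in> E" "f \<in> E" using assms by auto
  then have "z \<in> pt ` (e \<inter> f)" using ef assms(1) unfolding plane_drawing_def by blast
  then show "z \<in> pt ` (set xs \<inter> set ys)" using ef(1,2)[THEN path_edges_subset] by blast
qed

text \<open>Edge arcs are glued in order, each reversed where necessary. The result is an arc
  because the drawing of the remaining path meets the first edge only in the second vertex.\<close>

lemma path_arc:
  assumes pd: "plane_drawing V E pt \<gamma>"
  shows "length xs \<ge> 2 \<Longrightarrow> distinct xs \<Longrightarrow> set xs \<subseteq> V \<Longrightarrow> path_edges xs \<subseteq> E \<Longrightarrow>
    \<exists>g. arc g \<and> pathstart g = pt (hd xs) \<and> pathfinish g = pt (last xs) \<and>
      path_image g = (\<Union>e\<in>path_edges xs. path_image (\<gamma> e))"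
proof (induction xs rule: path_edges.induct)
  case (1 x y zs)
  have e: "{x, y} \<in> E" "x \<noteq> y" "x \<in> V" "y \<in> V" using 1 by auto
  have ne: "pt x \<noteq> pt y" using pd e unfolding plane_drawing_def inj_on_def by blast
  have a: "arc (\<gamma> {x, y})" "{pathstart (\<gamma> {x, y}), pathfinish (\<gamma> {x, y})} = {pt x, pt y}"
    using pd e(1) unfolding plane_drawing_def by auto
  obtain g where g: "arc g" "pathstart g = pt x" "pathfinish g = pt y" "path_image g = path_image (\<gamma> {x, y})"
  proof (cases "pathstart (\<gamma> {x, y}) = pt x")
    case True
    then show ?thesis using a ne that[of "\<gamma> {x, y}"] by (auto simp: doubleton_eq_iff)
  next
    case False
    then show ?thesis using a ne that[of "reversepath (\<gamma> {x, y})"]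
      by (auto simp: doubleton_eq_iff arc_reversepath)
  qed
  show ?case
  proof (cases zs)
    case Nil
    then show ?thesis using g by (intro exI[of _ g]) auto
  next
    case (Cons z zs')
    then obtain h where h: "arc h" "pathstart h = pt y" "pathfinish h = pt (last (y # zs))"
      "path_image h = (\<Union>e\<in>path_edges (y # zs). path_image (\<gamma> e))"
      using 1 by auto
    have "path_edges [x, y] \<inter> path_edges (y # zs) = {}"
      using path_edges_subset[of "{x, y}" "y # zs"] 1(3) by auto
    then have "path_image g \<inter> path_image h \<subseteq> pt ` (set [x, y] \<inter> set (y # zs))"
      using plane_drawing_meet[OF pd, of "[x, y]" "y # zs"] 1(5) g(4) h(4) by auto
    also have "\<dots> = {pt y}" using 1(3) by auto
    finally have "arc (g +++ h)" using g h by (intro arc_join) auto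
    moreover have "path_image (g +++ h) = (\<Union>e\<in>path_edges (x # y # zs). path_image (\<gamma> e))"
      using g h by (subst path_image_join) auto
    ultimately show ?thesis using g h by (intro exI[of _ "g +++ h"]) auto
  qed
qed auto

definition edge_rel :: "'a set set \<Rightarrow> ('a \<times> 'a) set" where
  "edge_rel E = {(u, v). u \<noteq> v \<and> {u, v} \<in> E}"

lemma sym_edge_rel: "sym (edge_rel E)"
  by (auto simp: edge_rel_def sym_def insert_commute)

definition sets_adjacent :: "('a \<times> 'a) set \<Rightarrow> 'a set \<Rightarrow> 'a set \<Rightarrow> bool" where
  "sets_adjacent G A B \<longleftrightarrow> (\<exists>a\<in>A. \<exists>b\<in>B. (a, b) \<in> G)"

text \<open>Nothing is contracted in the plane. In each branch set, a tripod leads to the ends of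
  three chosen edges to the other side; legs and chosen edges combine to nine paths that meet only
  in the tripod centers, which is a drawn \<open>K\<^sub>3\<^sub>,\<^sub>3\<close>.\<close>

lemma planar_no_K33_minor:
  fixes a b :: "nat \<Rightarrow> 'a set"
  assumes pl: "planar_graph V E"
    and sub: "\<And>i. i < 3 \<Longrightarrow> a i \<subseteq> V" "\<And>i. i < 3 \<Longrightarrow> b i \<subseteq> V"
    and con: "\<And>i. i < 3 \<Longrightarrow> induces_connected (edge_rel E) (a i)"
      "\<And>i. i < 3 \<Longrightarrow> induces_connected (edge_rel E) (b i)"
    and disj: "\<And>i j. i < 3 \<Longrightarrow> j < 3 \<Longrightarrow> i \<noteq> j \<Longrightarrow> a i \<inter> a j = {}"
      "\<And>i j. i < 3 \<Longrightarrow> j < 3 \<Longrightarrow> i \<noteq> j \<Longrightarrow> b i \<inter> b j = {}"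
      "\<And>i j. i < 3 \<Longrightarrow> j < 3 \<Longrightarrow> a i \<inter> b j = {}"
    and adj: "\<And>i j. i < 3 \<Longrightarrow> j < 3 \<Longrightarrow> sets_adjacent (edge_rel E) (a i) (b j)"
  shows False
proof -
  let ?G = "edge_rel E"
  obtain pt \<gamma> where pd: "plane_drawing V E pt \<gamma>" using pl by (auto simp: planar_graph_def)
  have "\<forall>i\<in>{..<3}. \<forall>j\<in>{..<3}. \<exists>s t. s \<in> a i \<and> t \<in> b j \<and> (s, t) \<in> ?G"
    using adj unfolding sets_adjacent_def by blast
  then obtain s t where st: "\<And>i j. i < 3 \<Longrightarrow> j < 3 \<Longrightarrow> s i j \<in> a i \<and> t i j \<in> b j \<and> (s i j, t i j) \<in> ?G"
    unfolding bchoice_iff by auto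
  have "\<forall>i\<in>{..<3}. \<exists>P x. (\<forall>j<3. graph_path ?G (a i) (P j) \<and> hd (P j) = x \<and> last (P j) = s i j) \<and>
     (\<forall>j<3. \<forall>k<3. j \<noteq> k \<longrightarrow> set (P j) \<inter> set (P k) = {x})"
    by (intro ballI tripod_exists[OF sym_edge_rel con(1)]) (simp_all add: st)
  then obtain P x where PX: "\<forall>i\<in>{..<3}. (\<forall>j<3. graph_path ?G (a i) (P i j) \<and> hd (P i j) = x i \<and> last (P i j) = s i j) \<and>
     (\<forall>j<3. \<forall>k<3. j \<noteq> k \<longrightarrow> set (P i j) \<inter> set (P i k) = {x i})"
    unfolding bchoice_iff by blast
  have "\<forall>j\<in>{..<3}. \<exists>Q y. (\<forall>i<3. graph_path ?G (b j) (Q i) \<and> hd (Q i) = y \<and> last (Q i) = t i j) \<and>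
     (\<forall>i<3. \<forall>k<3. i \<noteq> k \<longrightarrow> set (Q i) \<inter> set (Q k) = {y})"
    by (intro ballI tripod_exists[OF sym_edge_rel con(2), where t = "\<lambda>i. t i _"]) (simp_all add: st)
  then obtain Q' y where QX: "\<forall>j\<in>{..<3}. (\<forall>i<3. graph_path ?G (b j) (Q' j i) \<and> hd (Q' j i) = y j \<and> last (Q' j i) = t i j) \<and>
     (\<forall>i<3. \<forall>k<3. i \<noteq> k \<longrightarrow> set (Q' j i) \<inter> set (Q' j k) = {y j})"
    unfolding bchoice_iff by blast
  define Q where "Q i j = Q' j i" for i j
  have P: "graph_path ?G (a i) (P i j)" "hd (P i j) = x i" "last (P i j) = s i j"
    "P i j \<noteq> []" "distinct (P i j)" "set (P i j) \<subseteq> a i" "x i \<in> set (P i j)" if "i < 3" "j < 3" for i j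
    using PX that hd_in_set[of "P i j"] by (auto simp: graph_path_def)
  have Q: "graph_path ?G (b j) (Q i j)" "hd (Q i j) = y j" "last (Q i j) = t i j"
    "Q i j \<noteq> []" "distinct (Q i j)" "set (Q i j) \<subseteq> b j" "y j \<in> set (Q i j)" if "i < 3" "j < 3" for i j
    using QX that hd_in_set[of "Q i j"] by (auto simp: Q_def graph_path_def)
  define R where "R i j = P i j @ rev (Q i j)" for i j
  have setR: "set (R i j) = set (P i j) \<union> set (Q i j)" for i j by (simp add: R_def)
  have R: "distinct (R i j)" "length (R i j) \<ge> 2" "set (R i j) \<subseteq> V" "path_edges (R i j) \<subseteq> E"
    "hd (R i j) = x i" "last (R i j) = y j" if ij: "i < 3" "j < 3" for i j
  proof -
    show "distinct (R i j)" using P[OF ij] Q[OF ij] disj(3)[OF ij] by (auto simp: R_def)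
    show "length (R i j) \<ge> 2"
      using P(4)[OF ij] Q(4)[OF ij] unfolding R_def by (cases "P i j"; cases "Q i j") auto
    show "set (R i j) \<subseteq> V" using P(6)[OF ij] Q(6)[OF ij] sub(1)[OF ij(1)] sub(2)[OF ij(2)] by (auto simp: R_def)
    show "hd (R i j) = x i" "last (R i j) = y j"
      using P(2,4)[OF ij] Q(2,4)[OF ij] by (simp_all add: R_def last_rev)
    show "path_edges (R i j) \<subseteq> E"
    proof (rule path_edges_in)
      have "successively (\<lambda>x y. (x, y) \<in> ?G) (R i j)"
        using P(1,3)[OF ij] graph_path_rev[OF sym_edge_rel Q(1)[OF ij]] st[OF ij] Q(3)[OF ij]
        by (simp add: R_def successively_append_iff graph_path_def hd_rev)
      then show "successively (\<lambda>x y. {x, y} \<in> E) (R i j)"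
        by (rule successively_mono) (auto simp: edge_rel_def)
    qed
  qed
  have meet: "set (R i j) \<inter> set (R k l) \<subseteq> {v. (i = k \<and> v = x i) \<or> (j = l \<and> v = y j)}"
    if ij: "i < 3" "j < 3" "k < 3" "l < 3" "(i, j) \<noteq> (k, l)" for i j k l
  proof -
    have "set (P i j) \<inter> set (P k l) \<subseteq> {v. i = k \<and> v = x i}"
    proof (cases "i = k")
      case True
      then show ?thesis using PX ij by auto
    next
      case False
      then show ?thesis using disj(1)[of i k] P(6)[of i j] P(6)[of k l] ij by auto
    qed
    moreover have "set (Q i j) \<inter> set (Q k l) \<subseteq> {v. j = l \<and> v = y j}"
    proof (cases "j = l")
      case True
      then show ?thesis using QX ij by (auto simp: Q_def)
    next
      case False
      then show ?thesis using disj(2)[of j l] Q(6)[of i j] Q(6)[of k l] ij by auto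
    qed
    moreover have "set (P i j) \<inter> set (Q k l) = {}" "set (Q i j) \<inter> set (P k l) = {}"
      using disj(3)[of i l] disj(3)[of k j] P(6)[of i j] P(6)[of k l] Q(6)[of i j] Q(6)[of k l] ij by auto
    ultimately show ?thesis unfolding setR by blast
  qed
  have xy: "x i \<in> a i" "y j \<in> b j" if "i < 3" "j < 3" for i j
    using P(6,7)[OF that] Q(6,7)[OF that] by auto
  have xyne: "x i \<noteq> y j" if "i < 3" "j < 3" for i j using xy[OF that] disj(3)[OF that] by auto
  have "\<forall>i\<in>{..<3}. \<forall>j\<in>{..<3}. \<exists>g. arc g \<and> pathstart g = pt (x i) \<and> pathfinish g = pt (y j) \<and>
      path_image g = (\<Union>e\<in>path_edges (R i j). path_image (\<gamma> e))"
    using path_arc[OF pd R(2,1,3,4)] R(5,6) by (metis lessThan_iff)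
  then obtain g where g0: "\<forall>i\<in>{..<3}. \<forall>j\<in>{..<3}. arc (g i j) \<and> pathstart (g i j) = pt (x i) \<and>
      pathfinish (g i j) = pt (y j) \<and> path_image (g i j) = (\<Union>e\<in>path_edges (R i j). path_image (\<gamma> e))"
    unfolding bchoice_iff by blast
  then have g: "arc (g i j) \<and> pathstart (g i j) = pt (x i) \<and>
      pathfinish (g i j) = pt (y j) \<and> path_image (g i j) = (\<Union>e\<in>path_edges (R i j). path_image (\<gamma> e))"
    if "i < 3" "j < 3" for i j using that by simp
  have injpt: "inj_on pt V" using pd by (simp add: plane_drawing_def)
  have xV: "x i \<in> V" "y i \<in> V" if "i < 3" for i using xy[OF that that] sub that by auto
  show False
  proof (rule no_plane_K33[of g "\<lambda>i. pt (x i)" "\<lambda>j. pt (y j)"])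
    show "inj_on (\<lambda>i. pt (x i)) {..<3}"
    proof (rule inj_onI)
      fix i j :: nat assume ij: "i \<in> {..<3}" "j \<in> {..<3}" "pt (x i) = pt (x j)"
      then have "x i = x j" using injpt xV by (auto simp: inj_on_def)
      then show "i = j" using xy[of i i] xy[of j j] disj(1)[of i j] ij by auto
    qed
    show "inj_on (\<lambda>i. pt (y i)) {..<3}"
    proof (rule inj_onI)
      fix i j :: nat assume ij: "i \<in> {..<3}" "j \<in> {..<3}" "pt (y i) = pt (y j)"
      then have "y i = y j" using injpt xV by (auto simp: inj_on_def)
      then show "i = j" using xy[of i i] xy[of j j] disj(2)[of i j] ij by auto
    qed
    show "pt (x i) \<noteq> pt (y j)" if "i < 3" "j < 3" for i j
      using xyne[OF that] injpt xV that by (auto simp: inj_on_def)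
    fix i j k l :: nat assume ij: "i < 3" "j < 3" "k < 3" "l < 3" "(i, j) \<noteq> (k, l)"
    \<comment> \<open>As \<open>(i, j) \<noteq> (k, l)\<close>, only one of the two alternatives in
      \<open>meet\<close> can occur. So the paths share at most one vertex and hence no
      edge.\<close>
    have "path_edges (R i j) \<inter> path_edges (R k l) = {}"
    proof (rule ccontr)
      assume "\<not> ?thesis"
      then obtain e where e: "e \<in> path_edges (R i j)" "e \<in> path_edges (R k l)" by blast
      then obtain u v where uv: "e = {u, v}" "u \<noteq> v" using path_edges_doubleton R(1) ij by metis
      have "e \<subseteq> set (R i j) \<inter> set (R k l)" using e[THEN path_edges_subset] by blast
      with meet[OF ij] uv ij show False by auto
    qed
    then have "path_image (g i j) \<inter> path_image (g k l) \<subseteq> pt ` (set (R i j) \<inter> set (R k l))"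
      using plane_drawing_meet[OF pd R(4) R(4)] g ij by auto
    also have "\<dots> \<subseteq> {z. (i = k \<and> z = pt (x i)) \<or> (j = l \<and> z = pt (y j))}" using meet[OF ij] by auto
    finally show "path_image (g i j) \<inter> path_image (g k l) \<subseteq> {z. (i = k \<and> z = pt (x i)) \<or> (j = l \<and> z = pt (y j))}" .
  qed (use g in auto)
qed

section \<open>Separators\<close>

text \<open>The closure is reflexive, so \<open>v\<close> belongs to the set even if
  \<open>v \<notin> R\<close>; facts that need the set to stay within \<open>R\<close> therefore
  assume \<open>v \<in> R\<close>.\<close>

definition component :: "('a \<times> 'a) set \<Rightarrow> 'a set \<Rightarrow> 'a \<Rightarrow> 'a set" where
  "component G R v = (G \<inter> R \<times> R)\<^sup>* `` {v}"

lemma component_self: "v \<in> component G R v"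
  by (simp add: component_def)

lemma component_subset: "v \<in> R \<Longrightarrow> component G R v \<subseteq> R"
proof
  fix w assume "v \<in> R" "w \<in> component G R v"
  then have "(v, w) \<in> (G \<inter> R \<times> R)\<^sup>*" by (simp add: component_def)
  then show "w \<in> R" by (induction) (use \<open>v \<in> R\<close> in auto)
qed

text \<open>The confinement principle: the separation arguments apply it with a set \<open>P\<close>
  that edges avoiding the separator cannot leave.\<close>

lemma component_least: "v \<in> P \<Longrightarrow> (\<And>x y. x \<in> P \<Longrightarrow> x \<in> R \<Longrightarrow> y \<in> R \<Longrightarrow> (x, y) \<in> G \<Longrightarrow> y \<in> P) \<Longrightarrow> component G R v \<subseteq> P"
proof
  fix w assume v: "v \<in> P" and cl: "\<And>x y. x \<in> P \<Longrightarrow> x \<in> R \<Longrightarrow> y \<in> R \<Longrightarrow> (x, y) \<in> G \<Longrightarrow> y \<in> P"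
    and "w \<in> component G R v"
  then have "(v, w) \<in> (G \<inter> R \<times> R)\<^sup>*" by (simp add: component_def)
  then show "w \<in> P" by (induction) (use v cl in blast)+
qed

lemma component_step: "x \<in> component G R v \<Longrightarrow> v \<in> R \<Longrightarrow> y \<in> R \<Longrightarrow> (x, y) \<in> G \<Longrightarrow> y \<in> component G R v"
  using component_subset[of v R G] unfolding component_def by (auto intro: rtrancl_into_rtrancl)

lemma component_mono: "R \<subseteq> R' \<Longrightarrow> component G R v \<subseteq> component G R' v"
  unfolding component_def using rtrancl_mono[of "G \<inter> R \<times> R" "G \<inter> R' \<times> R'"] by blast

lemma sym_Int_Times: "sym G \<Longrightarrow> sym (G \<inter> R \<times> R)"
  by (auto simp: sym_def)

lemma component_eq:
  assumes "sym G" "w \<in> component G R v"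
  shows "component G R w = component G R v"
proof -
  have "(v, w) \<in> (G \<inter> R \<times> R)\<^sup>*" using assms(2) by (simp add: component_def)
  moreover from this have "(w, v) \<in> (G \<inter> R \<times> R)\<^sup>*"
    using sym_rtrancl[OF sym_Int_Times[OF assms(1)]] by (meson symD)
  ultimately show ?thesis unfolding component_def by (auto intro: rtrancl_trans)
qed

lemma component_connected:
  assumes "sym G" "v \<in> R"
  shows "induces_connected G (component G R v)"
proof -
  let ?C = "component G R v"
  have r: "(v, w) \<in> (G \<inter> ?C \<times> ?C)\<^sup>*" if "w \<in> ?C" for w
  proof -
    have "(v, w) \<in> (G \<inter> R \<times> R)\<^sup>*" using that by (simp add: component_def)
    then show ?thesis
    proof (induction)
      case (step y z)
      have "y \<in> ?C" "z \<in> ?C" using step by (auto simp: component_def intro: rtrancl_into_rtrancl)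
      then show ?case using step by (meson IntE IntI SigmaI rtrancl.rtrancl_into_rtrancl)
    qed simp
  qed
  then show ?thesis using sym_rtrancl[OF sym_Int_Times[OF assms(1)], of ?C]
    unfolding induces_connected_def by (meson rtrancl_trans symD)
qed

lemma connected_component_eq_self: "induces_connected G R \<Longrightarrow> v \<in> R \<Longrightarrow> component G R v = R"
  using component_subset[of v R G] by (auto simp: induces_connected_def component_def)

lemma induces_connectedI:
  assumes "sym G" and to_v: "\<And>w. w \<in> A \<Longrightarrow> (w, v) \<in> (G \<inter> A \<times> A)\<^sup>*"
  shows "induces_connected G A"
  unfolding induces_connected_def
proof (intro ballI)
  fix u w assume "u \<in> A" "w \<in> A"
  have "(v, w) \<in> (G \<inter> A \<times> A)\<^sup>*"
    using to_v[OF \<open>w \<in> A\<close>] sym_rtrancl[OF sym_Int_Times[OF assms(1)]] by (meson symD)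
  with to_v[OF \<open>u \<in> A\<close>] show "(u, w) \<in> (G \<inter> A \<times> A)\<^sup>*" by (rule rtrancl_trans)
qed

lemma rtrancl_restrict_mono: "A \<subseteq> B \<Longrightarrow> (x, y) \<in> (G \<inter> A \<times> A)\<^sup>* \<Longrightarrow> (x, y) \<in> (G \<inter> B \<times> B)\<^sup>*"
  using rtrancl_mono[of "G \<inter> A \<times> A" "G \<inter> B \<times> B"] by blast

section \<open>Large components and the state of the search\<close>

definition big_part :: "('a \<times> 'a) set \<Rightarrow> nat \<Rightarrow> 'a set \<Rightarrow> 'a set" where
  "big_part G k R = {v \<in> R. k < 2 * card (component G R v)}"

text \<open>Two different components with more than \<open>k / 2\<close> vertices each are disjoint
  and do not fit into \<open>R\<close>. So this set, which a program can compute vertex by vertex,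
  is empty or one component.\<close>

lemma big_part_component:
  assumes "sym G" "finite R" "card R \<le> k" "v \<in> big_part G k R"
  shows "big_part G k R = component G R v"
proof
  have v: "v \<in> R" "k < 2 * card (component G R v)" using assms by (auto simp: big_part_def)
  show "component G R v \<subseteq> big_part G k R"
    using v component_eq[OF assms(1)] subsetD[OF component_subset[OF v(1)]] by (auto simp: big_part_def)
  show "big_part G k R \<subseteq> component G R v"
  proof
    fix w assume "w \<in> big_part G k R"
    then have w: "w \<in> R" "k < 2 * card (component G R w)" by (auto simp: big_part_def)
    have fin: "finite (component G R v)" "finite (component G R w)"
      by (rule finite_subset[OF component_subset assms(2)], rule v(1), rule finite_subset[OF component_subset assms(2)], rule w(1))
    have "component G R v \<inter> component G R w \<noteq> {}"
    proof
      assume "component G R v \<inter> component G R w = {}"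
      then have "card (component G R v) + card (component G R w) = card (component G R v \<union> component G R w)"
        using fin by (simp add: card_Un_disjoint)
      also have "\<dots> \<le> card R" by (intro card_mono assms(2) Un_least component_subset v(1) w(1))
      finally show False using v w assms(3) by linarith
    qed
    then obtain x where "x \<in> component G R v" "x \<in> component G R w" by blast
    then show "w \<in> component G R v" using component_eq[OF assms(1)] component_self by metis
  qed
qed

text \<open>This is the side of a contact that lies in \<open>B\<close>, from which balls are grown;
  its size is not bounded. What \<open>search_inv\<close> bounds is the labelled side, which goes
  into the final separator.\<close>

definition touch :: "('a \<times> 'a) set \<Rightarrow> 'a set \<Rightarrow> ('a \<Rightarrow> nat) \<Rightarrow> nat \<Rightarrow> 'a set" where
  "touch G B lab i = {v \<in> B. \<exists>w. lab w = i \<and> (w, v) \<in> G}"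

definition ball_layer :: "('a \<times> 'a) set \<Rightarrow> 'a set \<Rightarrow> 'a set \<Rightarrow> 'a set" where
  "ball_layer G B U = {v \<in> B - U. \<exists>w\<in>U. (w, v) \<in> G}"

text \<open>The only trace of planarity that the search sees, phrased for a relation so that
  drawings are no longer mentioned.\<close>

definition no_K33_minor :: "('a \<times> 'a) set \<Rightarrow> 'a set \<Rightarrow> bool" where
  "no_K33_minor G V \<longleftrightarrow> \<not> (\<exists>a b :: nat \<Rightarrow> 'a set.
     (\<forall>i<3. a i \<subseteq> V \<and> b i \<subseteq> V \<and> induces_connected G (a i) \<and> induces_connected G (b i)) \<and>
     (\<forall>i<3. \<forall>j<3. i \<noteq> j \<longrightarrow> a i \<inter> a j = {} \<and> b i \<inter> b j = {}) \<and>
     (\<forall>i<3. \<forall>j<3. a i \<inter> b j = {} \<and> sets_adjacent G (a i) (b j)))"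

lemma planar_imp_no_K33_minor: "planar_graph V E \<Longrightarrow> no_K33_minor (edge_rel E) V"
  unfolding no_K33_minor_def
proof (intro notI, elim exE conjE)
  fix a b :: "nat \<Rightarrow> 'a set"
  assume pl: "planar_graph V E"
    and 1: "\<forall>i<3. a i \<subseteq> V \<and> b i \<subseteq> V \<and> induces_connected (edge_rel E) (a i) \<and> induces_connected (edge_rel E) (b i)"
    and 2: "\<forall>i<3. \<forall>j<3. i \<noteq> j \<longrightarrow> a i \<inter> a j = {} \<and> b i \<inter> b j = {}"
    and 3: "\<forall>i<3. \<forall>j<3. a i \<inter> b j = {} \<and> sets_adjacent (edge_rel E) (a i) (b j)"
  show False
    by (rule planar_no_K33_minor[OF pl, of a b]) (simp_all add: 1 2 3)
qed

text \<open>The state of the separator search in the connected set \<open>K\<close> with \<open>k\<close> vertices: the part \<open>B\<close>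
  still to be separated, and disjoint sets \<open>{v. lab v = i}\<close>, \<open>i \<in> {1..5}\<close>. Those that touch \<open>B\<close> are
  connected and pairwise adjacent, so together with a connected set meeting all of their
  neighbourhoods they would form a \<open>K\<^sub>6\<close> minor.\<close>

definition search_inv :: "('a \<times> 'a) set \<Rightarrow> 'a set \<Rightarrow> 'a set \<Rightarrow> ('a \<Rightarrow> nat) \<Rightarrow> bool" where
  "search_inv G K B lab \<longleftrightarrow>
     B \<subseteq> K \<and> induces_connected G B \<and> card K < 2 * card B \<and>
     (\<forall>v. lab v \<noteq> 0 \<longrightarrow> v \<in> K - B) \<and>
     (\<forall>v\<in>K. \<forall>w\<in>B. (v, w) \<in> G \<longrightarrow> v \<in> B \<or> lab v \<noteq> 0) \<and>
     (\<forall>v. lab v \<le> 5) \<and>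
     (\<forall>i\<in>{1..5}. real (card {v \<in> K. lab v = i \<and> (\<exists>w\<in>B. (v, w) \<in> G)}) \<le> 11 * sqrt (card K)) \<and>
     (\<forall>i\<in>{1..5}. touch G B lab i \<noteq> {} \<longrightarrow> induces_connected G {v. lab v = i}) \<and>
     (\<forall>i\<in>{1..5}. \<forall>j\<in>{1..5}. i \<noteq> j \<longrightarrow> touch G B lab i \<noteq> {} \<longrightarrow> touch G B lab j \<noteq> {} \<longrightarrow>
        sets_adjacent G {v. lab v = i} {v. lab v = j})"

lemmas search_inv_subset = search_inv_def[THEN iffD1, THEN conjunct1]
lemmas search_inv_connected = search_inv_def[THEN iffD1, THEN conjunct2, THEN conjunct1]
lemmas search_inv_big = search_inv_def[THEN iffD1, THEN conjunct2, THEN conjunct2, THEN conjunct1]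
lemmas search_inv_lab = search_inv_def[THEN iffD1, THEN conjunct2, THEN conjunct2, THEN conjunct2, THEN conjunct1, rule_format]
lemmas search_inv_boundary = search_inv_def[THEN iffD1, THEN conjunct2, THEN conjunct2, THEN conjunct2, THEN conjunct2, THEN conjunct1, rule_format]
lemmas search_inv_lab_le = search_inv_def[THEN iffD1, THEN conjunct2, THEN conjunct2, THEN conjunct2, THEN conjunct2, THEN conjunct2, THEN conjunct1, rule_format]
lemmas search_inv_card = search_inv_def[THEN iffD1, THEN conjunct2, THEN conjunct2, THEN conjunct2, THEN conjunct2, THEN conjunct2, THEN conjunct2, THEN conjunct1, rule_format]
lemmas search_inv_label_connected = search_inv_def[THEN iffD1, THEN conjunct2, THEN conjunct2, THEN conjunct2, THEN conjunct2, THEN conjunct2, THEN conjunct2, THEN conjunct2, THEN conjunct1, rule_format]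
lemmas search_inv_label_adjacent = search_inv_def[THEN iffD1, THEN conjunct2, THEN conjunct2, THEN conjunct2, THEN conjunct2, THEN conjunct2, THEN conjunct2, THEN conjunct2, THEN conjunct2, rule_format]

locale separator_search =
  fixes G :: "('a \<times> 'a) set" and K V :: "'a set"
  assumes sym: "sym G" and finK: "finite K" and KV: "K \<subseteq> V" and noK33: "no_K33_minor G V"
begin

lemma symG: "(x, y) \<in> G \<Longrightarrow> (y, x) \<in> G"
  using sym by (auto simp: sym_def)

lemma search_inv_start:
  assumes "induces_connected G K" "K \<noteq> {}"
  shows "search_inv G K K (\<lambda>_. 0)"
proof -
  have pos: "card K > 0" using assms(2) finK by (simp add: card_gt_0_iff)
  have no: "touch G K (\<lambda>_. 0) i = {}" "{v \<in> K. (0::nat) = i \<and> (\<exists>w\<in>K. (v, w) \<in> G)} = {}"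
    if "i \<in> {1..5}" for i using that by (auto simp: touch_def)
  show ?thesis unfolding search_inv_def
  proof (intro conjI ballI allI impI)
    fix i :: nat assume i: "i \<in> {1..5}"
    show "real (card {v \<in> K. 0 = i \<and> (\<exists>w\<in>K. (v, w) \<in> G)}) \<le> 11 * sqrt (card K)"
      unfolding no(2)[OF i] by simp
    show "induces_connected G {v. (0::nat) = i}" if "touch G K (\<lambda>_. 0) i \<noteq> {}"
      using that no(1)[OF i] by contradiction
    show "sets_adjacent G {v. (0::nat) = i} {v. (0::nat) = j}" if "touch G K (\<lambda>_. 0) i \<noteq> {}" for j
      using that no(1)[OF i] by contradiction
  next
    show "card K < 2 * card K" using pos by simp
    show "induces_connected G K" by (rule assms(1))
  qed simp_all
qed

text \<open>Otherwise \<open>T\<close> is a sixth connected set adjacent to the five labelled ones.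
  The sets numbered 1 to 3 and those numbered 4 to 6 are then the two sides of a
  \<open>K\<^sub>3\<^sub>,\<^sub>3\<close> minor.\<close>

lemma free_slot_exists:
  assumes inv: "search_inv G K B lab" and T: "T \<subseteq> B" "induces_connected G T"
    and meets: "\<And>i. i \<in> {1..5} \<Longrightarrow> touch G B lab i \<noteq> {} \<Longrightarrow> T \<inter> touch G B lab i \<noteq> {}"
  shows "\<exists>i\<in>{1..5}. touch G B lab i = {}"
proof (rule ccontr)
  assume "\<not> ?thesis"
  then have act: "touch G B lab i \<noteq> {}" if "i \<in> {1..5}" for i using that by blast
  define C where "C i = (if i = 6 then T else {v. lab v = i})" for i :: nat
  note BK = search_inv_subset[OF inv] and conB = search_inv_connected[OF inv] and labK = search_inv_lab[OF inv]
    and nb = search_inv_boundary[OF inv] and lab5 = search_inv_lab_le[OF inv] and crd = search_inv_card[OF inv]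
    and con = search_inv_label_connected[OF inv] and adj = search_inv_label_adjacent[OF inv]
    and big = search_inv_big[OF inv]
  have sub: "C i \<subseteq> V" if "i \<in> {1..6}" for i
  proof -
    have "v \<in> V" if "lab v = i" for v using labK[of v] that \<open>i \<in> {1..6}\<close> KV by auto
    then show ?thesis using T BK KV by (auto simp: C_def)
  qed
  have con: "induces_connected G (C i)" if "i \<in> {1..6}" for i
    using that T act con by (simp add: C_def)
  have disj: "C i \<inter> C j = {}" if "i \<in> {1..6}" "j \<in> {1..6}" "i \<noteq> j" for i j
  proof -
    have "v \<notin> T" if "lab v \<noteq> 0" for v using labK[OF that] T by blast
    then show ?thesis using that by (auto simp: C_def)
  qed
  have tadj: "\<exists>a\<in>{v. lab v = i}. \<exists>b\<in>T. (a, b) \<in> G" if "i \<in> {1..5}" for i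
    using meets[OF that act[OF that]] unfolding touch_def by blast
  have adj: "sets_adjacent G (C i) (C j)" if "i \<in> {1..6}" "j \<in> {1..6}" "i \<noteq> j" for i j
  proof -
    have "i = 6 \<or> i \<in> {1..5}" "j = 6 \<or> j \<in> {1..5}" using that by auto
    with that(3) consider "i = 6" "j \<in> {1..5}" | "j = 6" "i \<in> {1..5}" | "i \<in> {1..5}" "j \<in> {1..5}" by blast
    then show ?thesis
    proof cases
      case 1
      then show ?thesis using tadj[of j] symG unfolding sets_adjacent_def C_def by auto
    next
      case 2
      then show ?thesis using tadj[of i] unfolding sets_adjacent_def C_def by auto
    next
      case 3
      then show ?thesis using adj act \<open>i \<noteq> j\<close> by (simp add: C_def)
    qed
  qed
  have "\<exists>a b :: nat \<Rightarrow> 'a set.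
     (\<forall>i<3. a i \<subseteq> V \<and> b i \<subseteq> V \<and> induces_connected G (a i) \<and> induces_connected G (b i)) \<and>
     (\<forall>i<3. \<forall>j<3. i \<noteq> j \<longrightarrow> a i \<inter> a j = {} \<and> b i \<inter> b j = {}) \<and>
     (\<forall>i<3. \<forall>j<3. a i \<inter> b j = {} \<and> sets_adjacent G (a i) (b j))"
    by (rule exI[of _ "\<lambda>i. C (i + 1)"], rule exI[of _ "\<lambda>i. C (i + 4)"])
      (intro conjI allI impI sub con disj adj; simp)
  with noK33 show False unfolding no_K33_minor_def by blast
qed

text \<open>\<open>T\<close> moves into the free slot \<open>f\<close>. The old members of
  \<open>f\<close> lose their label, which is harmless as they have no neighbour in
  \<open>B\<close>. The new contacts number at most \<open>card T\<close>, and those of other labels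
  only shrink.\<close>

lemma tree_step:
  assumes inv: "search_inv G K B lab" and T: "T \<subseteq> B" "induces_connected G T" "T \<noteq> {}"
    and cardT: "real (card T) \<le> 11 * sqrt (card K)"
    and meets: "\<And>i. i \<in> {1..5} \<Longrightarrow> touch G B lab i \<noteq> {} \<Longrightarrow> T \<inter> touch G B lab i \<noteq> {}"
    and f: "f \<in> {1..5}" "touch G B lab f = {}"
    and D: "D = big_part G (card K) (B - T)" "D \<noteq> {}"
  shows "search_inv G K D (\<lambda>v. if v \<in> T then f else if lab v = f then 0 else lab v)" "card D < card B"
proof -
  let ?lab = "\<lambda>v. if v \<in> T then f else if lab v = f then 0 else lab v"
  note BK = search_inv_subset[OF inv] and conB = search_inv_connected[OF inv] and labK = search_inv_lab[OF inv]
    and nb = search_inv_boundary[OF inv] and lab5 = search_inv_lab_le[OF inv] and crd = search_inv_card[OF inv]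
    and con = search_inv_label_connected[OF inv] and adj = search_inv_label_adjacent[OF inv]
    and big = search_inv_big[OF inv]
  have finB: "finite B" using BK finK finite_subset by blast
  obtain d where d: "d \<in> D" using D by blast
  have dR: "d \<in> B - T" "card K < 2 * card (component G (B - T) d)" using d D by (auto simp: big_part_def)
  have "card (B - T) \<le> card K" using BK finK by (meson Diff_subset card_mono order_trans)
  then have Dc: "D = component G (B - T) d" using big_part_component[OF sym] d D finB by blast
  have DB: "D \<subseteq> B - T" unfolding Dc by (rule component_subset[OF dR(1)])
  have Dcl: "y \<in> D" if "x \<in> D" "(x, y) \<in> G" "y \<in> B - T" for x y
    using component_step[OF that(1)[unfolded Dc] dR(1) that(3,2)] unfolding Dc .
  show "card D < card B"
    using DB T finB by (intro psubset_card_mono) auto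
  have labT: "lab v = 0" if "v \<in> B" for v using labK[of v] that by auto
  have Cj: "{v. ?lab v = j} = {v. lab v = j}" if "j \<in> {1..5}" "j \<noteq> f" for j
    using that T labT by auto
  have Cf: "{v. ?lab v = f} = T" using f by auto
  have act: "touch G B lab j \<noteq> {}" if "touch G D ?lab j \<noteq> {}" "j \<in> {1..5}" "j \<noteq> f" for j
    using that Cj[OF that(2,3)] DB unfolding touch_def by blast
  have tadj: "\<exists>a\<in>{v. lab v = i}. \<exists>b\<in>T. (a, b) \<in> G" if "i \<in> {1..5}" "touch G B lab i \<noteq> {}" for i
    using meets[OF that] unfolding touch_def by blast
  show "search_inv G K D ?lab"
    unfolding search_inv_def
  proof (intro conjI ballI allI impI)
    show "D \<subseteq> K" using DB BK by blast
    show "induces_connected G D" unfolding Dc by (rule component_connected[OF sym dR(1)])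
    show "card K < 2 * card D" using dR Dc by simp
    show "v \<in> K - D" if "?lab v \<noteq> 0" for v
      using that labK[of v] DB T BK by (auto split: if_splits)
    show "v \<in> D \<or> ?lab v \<noteq> 0" if "v \<in> K" "w \<in> D" "(v, w) \<in> G" for v w
    proof (cases "v \<in> B")
      case True
      then show ?thesis using Dcl[of w v] that symG f by auto
    next
      case False
      then have "lab v \<noteq> 0" using nb that DB by blast
      moreover have "lab v \<noteq> f" using f(2) that DB unfolding touch_def by blast
      ultimately show ?thesis using f by auto
    qed
    show "?lab v \<le> 5" for v using lab5 f by auto
    fix i :: nat assume i: "i \<in> {1..5}"
    show "real (card {v \<in> K. ?lab v = i \<and> (\<exists>w\<in>D. (v, w) \<in> G)}) \<le> 11 * sqrt (card K)"
    proof (cases "i = f")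
      case True
      have "{v \<in> K. ?lab v = i \<and> (\<exists>w\<in>D. (v, w) \<in> G)} \<subseteq> T" using Cf True by blast
      then show ?thesis using cardT card_mono[OF finite_subset[OF T(1) finB]] by (meson of_nat_mono order_trans)
    next
      case False
      have "{v \<in> K. ?lab v = i \<and> (\<exists>w\<in>D. (v, w) \<in> G)} \<subseteq> {v \<in> K. lab v = i \<and> (\<exists>w\<in>B. (v, w) \<in> G)}"
        using Cj[OF i False] DB by blast
      then have "card {v \<in> K. ?lab v = i \<and> (\<exists>w\<in>D. (v, w) \<in> G)} \<le> card {v \<in> K. lab v = i \<and> (\<exists>w\<in>B. (v, w) \<in> G)}"
        using finK by (intro card_mono) auto
      then show ?thesis using crd[OF i] by linarith
    qed
    show "induces_connected G {v. ?lab v = i}" if "touch G D ?lab i \<noteq> {}"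
    proof (cases "i = f")
      case True
      then show ?thesis using Cf T by simp
    next
      case False
      then show ?thesis using Cj[OF i False] con[OF i act[OF that i False]] by simp
    qed
    fix j :: nat assume j: "j \<in> {1..5}" "i \<noteq> j"
      "touch G D ?lab i \<noteq> {}" "touch G D ?lab j \<noteq> {}"
    consider "i = f" | "j = f" | "i \<noteq> f" "j \<noteq> f" by blast
    then show "sets_adjacent G {v. ?lab v = i} {v. ?lab v = j}"
    proof cases
      case 1
      then have "j \<noteq> f" using j(2) by simp
      moreover from this obtain a b where "lab a = j" "b \<in> T" "(a, b) \<in> G"
        using tadj[OF j(1) act[OF j(4,1)]] by auto
      ultimately show ?thesis
        unfolding 1 Cf Cj[OF j(1) \<open>j \<noteq> f\<close>] sets_adjacent_def using symG by blast
    next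
      case 2
      then have "i \<noteq> f" using j(2) by simp
      moreover from this obtain a b where "lab a = i" "b \<in> T" "(a, b) \<in> G"
        using tadj[OF i act[OF j(3) i]] by auto
      ultimately show ?thesis
        unfolding 2 Cf Cj[OF i \<open>i \<noteq> f\<close>] sets_adjacent_def by blast
    next
      case 3
      then show ?thesis using Cj[OF i] Cj[OF j(1)] adj[OF i j(1,2) act[OF j(3) i] act[OF j(4,1)]] by simp
    qed
  qed
qed

text \<open>Suppose \<open>D\<close> meets the contacts of every active label. Take \<open>d\<close>
  in \<open>D\<close> and an active label \<open>i\<close> whose ball \<open>U i\<close> misses
  \<open>d\<close>. The component of a contact of \<open>i\<close> cannot cross the layer around
  \<open>U i\<close>, so all of \<open>D\<close>, including \<open>d\<close>, would lie in
  \<open>U i\<close>.\<close>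

lemma cut_misses_touch:
  assumes BK: "B \<subseteq> K" and U: "\<And>i. i \<in> {1..5} \<Longrightarrow> touch G B lab i \<subseteq> U i"
    and none: "\<And>v. v \<in> B \<Longrightarrow> \<exists>i\<in>{1..5}. touch G B lab i \<noteq> {} \<and> v \<notin> U i"
    and Z: "Z = (\<Union>i\<in>{1..5::nat}. ball_layer G B (U i))"
    and D: "D = big_part G (card K) (B - Z)" "D \<noteq> {}"
  shows "\<exists>i\<in>{1..5}. touch G B lab i \<noteq> {} \<and> touch G B lab i \<inter> D = {}"
proof (rule ccontr)
  assume neg: "\<not> ?thesis"
  have finB: "finite B" using BK finK finite_subset by blast
  obtain d where d: "d \<in> D" using D by blast
  have dB: "d \<in> B" using d D by (auto simp: big_part_def)
  obtain i where i: "i \<in> {1..5}" "touch G B lab i \<noteq> {}" "d \<notin> U i" using none[OF dB] by blast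
  then obtain a where a: "a \<in> touch G B lab i" "a \<in> D" using neg by blast
  have "card (B - Z) \<le> card K" using BK finK by (meson Diff_subset card_mono order_trans)
  then have "D = component G (B - Z) a" using big_part_component[OF sym] a D finB by blast
  also have "\<dots> \<subseteq> U i"
  proof (rule component_least)
    show "a \<in> U i" using a U i by blast
    fix x y assume "x \<in> U i" "x \<in> B - Z" "y \<in> B - Z" "(x, y) \<in> G"
    then show "y \<in> U i" using i unfolding Z ball_layer_def by blast
  qed
  finally show False using d i by blast
qed

text \<open>Label \<open>i\<close> swallows whatever its contacts reach in \<open>B - D\<close>. Its
  contact with the rest of \<open>B\<close> is then part of \<open>Z\<close>: old members have their
  neighbours swallowed, an edge from \<open>C\<close> to the rest ends in \<open>D\<close>, and a
  vertex of \<open>B - D\<close> next to \<open>D\<close> is in \<open>Z\<close>.\<close>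

lemma cut_step:
  assumes inv: "search_inv G K B lab" and Z: "Z \<subseteq> B" "real (card Z) \<le> 11 * sqrt (card K)"
    and D: "D = big_part G (card K) (B - Z)" "D \<noteq> {}"
    and i: "i \<in> {1..5}" "touch G B lab i \<noteq> {}" "touch G B lab i \<inter> D = {}"
    and C: "C = (G \<inter> (B - D) \<times> (B - D))\<^sup>* `` touch G B lab i"
  shows "search_inv G K (B - C) (\<lambda>v. if v \<in> C then i else lab v)" "card (B - C) < card B"
proof -
  let ?lab = "\<lambda>v. if v \<in> C then i else lab v"
  note BK = search_inv_subset[OF inv] and conB = search_inv_connected[OF inv] and labK = search_inv_lab[OF inv]
    and nb = search_inv_boundary[OF inv] and lab5 = search_inv_lab_le[OF inv] and crd = search_inv_card[OF inv]
    and con = search_inv_label_connected[OF inv] and adj = search_inv_label_adjacent[OF inv]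
    and big = search_inv_big[OF inv]
  have finB: "finite B" using BK finK finite_subset by blast
  obtain d where d: "d \<in> D" using D by blast
  have dR: "d \<in> B - Z" "card K < 2 * card (component G (B - Z) d)" using d D by (auto simp: big_part_def)
  have "card (B - Z) \<le> card K" using BK finK by (meson Diff_subset card_mono order_trans)
  then have Dc: "D = component G (B - Z) d" using big_part_component[OF sym] d D finB by blast
  have DB: "D \<subseteq> B - Z" unfolding Dc by (rule component_subset[OF dR(1)])
  have Dcl: "y \<in> D" if "x \<in> D" "(x, y) \<in> G" "y \<in> B - Z" for x y
    using component_step[OF that(1)[unfolded Dc] dR(1) that(3,2)] unfolding Dc .
  have Dcon: "induces_connected G D" unfolding Dc by (rule component_connected[OF sym dR(1)])
  let ?A = "touch G B lab i"
  have AB: "?A \<subseteq> B - D" using i by (auto simp: touch_def)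
  have AC: "?A \<subseteq> C" using C by auto
  have CB: "C \<subseteq> B - D"
  proof
    fix x assume "x \<in> C"
    then obtain a where "a \<in> ?A" "(a, x) \<in> (G \<inter> (B - D) \<times> (B - D))\<^sup>*" unfolding C by blast
    from this(2,1) show "x \<in> B - D" by (induction) (use AB in auto)
  qed
  have Ccl: "y \<in> C" if xC: "x \<in> C" and that: "(x, y) \<in> G" "y \<in> B - D" for x y
  proof -
    obtain a where a: "a \<in> ?A" "(a, x) \<in> (G \<inter> (B - D) \<times> (B - D))\<^sup>*"
      using xC unfolding C by blast
    have "(x, y) \<in> G \<inter> (B - D) \<times> (B - D)" using that xC CB by blast
    from rtrancl_into_rtrancl[OF a(2) this] a(1) show ?thesis unfolding C by blast
  qed
  have DC: "D \<subseteq> B - C" using DB CB by blast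
  show "card (B - C) < card B"
    using i AC AB finB by (intro psubset_card_mono) auto
  have labB: "lab v = 0" if "v \<in> B" for v using labK[of v] that by auto
  have Cj: "{v. ?lab v = j} = {v. lab v = j}" if "j \<in> {1..5}" "j \<noteq> i" for j
    using that CB labB by auto
  have Ci: "{v. ?lab v = i} = {v. lab v = i} \<union> C" by auto
  have act: "touch G B lab j \<noteq> {}" if tj: "touch G (B - C) ?lab j \<noteq> {}" and j: "j \<in> {1..5}" for j
  proof (cases "j = i")
    case True
    then show ?thesis using i(2) by simp
  next
    case False
    obtain v w where w: "?lab w = j" "(w, v) \<in> G" "v \<in> B - C" using tj unfolding touch_def by blast
    have "w \<in> {v. lab v = j}" unfolding Cj[OF j False, symmetric] using w(1) by simp
    then show ?thesis using w(2,3) unfolding touch_def by blast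
  qed
  have sub: "{v. lab v = j} \<subseteq> {v. ?lab v = j}" if "j \<in> {1..5}" for j
    using Cj[OF that] Ci by (cases "j = i") simp_all
  show "search_inv G K (B - C) ?lab"
    unfolding search_inv_def
  proof (intro conjI ballI allI impI)
    show "B - C \<subseteq> K" using BK by blast
    \<comment> \<open>Outside \<open>C\<close> and \<open>D\<close>, the next vertex of a walk to
      \<open>d\<close> is not in \<open>C\<close> either, since \<open>C\<close> is closed in
      \<open>B - D\<close>. From the first vertex in \<open>D\<close> on, the connectedness of
      \<open>D\<close> replaces the rest of the walk.\<close>
    have reach: "y \<notin> C \<Longrightarrow> (y, d) \<in> (G \<inter> (B - C) \<times> (B - C))\<^sup>*" if "(y, d) \<in> (G \<inter> B \<times> B)\<^sup>*" for y
      using that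
    proof (induction rule: converse_rtrancl_induct)
      case (step y z)
      show ?case
      proof (cases "y \<in> D")
        case True
        then have "(y, d) \<in> (G \<inter> D \<times> D)\<^sup>*" using Dcon d by (auto simp: induces_connected_def)
        then show ?thesis by (rule rtrancl_restrict_mono[OF DC])
      next
        case False
        have "z \<notin> C" using Ccl[of z y] step False symG by blast
        then have "(y, z) \<in> G \<inter> (B - C) \<times> (B - C)" "(z, d) \<in> (G \<inter> (B - C) \<times> (B - C))\<^sup>*"
          using step by auto
        then show ?thesis by (rule converse_rtrancl_into_rtrancl)
      qed
    qed simp
    show "induces_connected G (B - C)"
    proof (rule induces_connectedI[OF sym, of _ d])
      fix w assume "w \<in> B - C"
      then show "(w, d) \<in> (G \<inter> (B - C) \<times> (B - C))\<^sup>*"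
        using conB reach dR by (auto simp: induces_connected_def)
    qed
    have "card D \<le> card (B - C)" using DC finB by (intro card_mono) auto
    then show "card K < 2 * card (B - C)" using dR Dc by simp
    show "v \<in> K - (B - C)" if "?lab v \<noteq> 0" for v
      using that labK[of v] CB BK by (auto split: if_splits)
    show "v \<in> B - C \<or> ?lab v \<noteq> 0" if "v \<in> K" "w \<in> B - C" "(v, w) \<in> G" for v w
      using nb[of v w] that i by auto
    show "?lab v \<le> 5" for v using lab5 i by auto
    fix j :: nat assume j: "j \<in> {1..5}"
    show "real (card {v \<in> K. ?lab v = j \<and> (\<exists>w\<in>B - C. (v, w) \<in> G)}) \<le> 11 * sqrt (card K)"
    proof (cases "j = i")
      case True
      have "{v \<in> K. ?lab v = j \<and> (\<exists>w\<in>B - C. (v, w) \<in> G)} \<subseteq> Z"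
      proof
        fix v assume "v \<in> {v \<in> K. ?lab v = j \<and> (\<exists>w\<in>B - C. (v, w) \<in> G)}"
        then obtain w where w: "w \<in> B - C" "(v, w) \<in> G" and v: "v \<in> C \<or> lab v = i" using True Ci by blast
        have "v \<in> C"
        proof (rule ccontr)
          assume "v \<notin> C"
          then have "w \<in> ?A" using v w by (auto simp: touch_def)
          then show False using AC w by blast
        qed
        then have "w \<in> D" using Ccl w by blast
        show "v \<in> Z" using Dcl[OF \<open>w \<in> D\<close>] \<open>v \<in> C\<close> CB symG[OF w(2)] by blast
      qed
      then show ?thesis using Z(2) card_mono[OF finite_subset[OF Z(1) finB]] by (meson of_nat_mono order_trans)
    next
      case False
      have "{v \<in> K. ?lab v = j \<and> (\<exists>w\<in>B - C. (v, w) \<in> G)} \<subseteq> {v \<in> K. lab v = j \<and> (\<exists>w\<in>B. (v, w) \<in> G)}"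
        using Cj[OF j False] by blast
      then have "card {v \<in> K. ?lab v = j \<and> (\<exists>w\<in>B - C. (v, w) \<in> G)} \<le> card {v \<in> K. lab v = j \<and> (\<exists>w\<in>B. (v, w) \<in> G)}"
        using finK by (intro card_mono) auto
      then show ?thesis using crd[OF j] by linarith
    qed
    show "induces_connected G {v. ?lab v = j}" if tj: "touch G (B - C) ?lab j \<noteq> {}"
    proof (cases "j = i")
      case False
      then show ?thesis using Cj[OF j False] con[OF j act[OF tj j]] by simp
    next
      case True
      let ?S = "{v. lab v = i} \<union> C"
      obtain a0 c0 where c0: "lab c0 = i" "(c0, a0) \<in> G" using i by (auto simp: touch_def)
      have inC: "(x, c0) \<in> (G \<inter> ?S \<times> ?S)\<^sup>*" if "lab x = i" for x
      proof (rule rtrancl_restrict_mono)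
        show "(x, c0) \<in> (G \<inter> {v. lab v = i} \<times> {v. lab v = i})\<^sup>*"
          using con[OF i(1,2)] c0 that by (auto simp: induces_connected_def)
      qed auto
      have fromA: "(x, c0) \<in> (G \<inter> ?S \<times> ?S)\<^sup>*" if xA: "x \<in> ?A" for x
      proof -
        obtain w where w: "lab w = i" "(w, x) \<in> G" using xA by (auto simp: touch_def)
        have "(x, w) \<in> G \<inter> ?S \<times> ?S" using w xA AC symG by auto
        from this inC[OF w(1)] show ?thesis by (rule converse_rtrancl_into_rtrancl)
      qed
      have fromC: "(x, c0) \<in> (G \<inter> ?S \<times> ?S)\<^sup>*" if xC: "x \<in> C" for x
      proof -
        obtain a where a: "a \<in> ?A" "(a, x) \<in> (G \<inter> (B - D) \<times> (B - D))\<^sup>*"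
          using xC unfolding C by blast
        from a(2) show ?thesis
        proof (induction)
          case base
          then show ?case using fromA a by blast
        next
          case (step y z)
          have "(a, y) \<in> (G \<inter> (B - D) \<times> (B - D))\<^sup>*" "(a, z) \<in> (G \<inter> (B - D) \<times> (B - D))\<^sup>*"
            using step by (simp_all only: rtrancl.rtrancl_into_rtrancl)
          then have "y \<in> C" "z \<in> C" using a(1) unfolding C by blast+
          then have "(z, y) \<in> G \<inter> ?S \<times> ?S" using step symG by blast
          from this step.IH show ?case by (rule converse_rtrancl_into_rtrancl)
        qed
      qed
      show ?thesis unfolding True Ci
        by (rule induces_connectedI[OF sym, of _ c0]) (use inC fromC in blast)
    qed
    fix l :: nat assume l: "l \<in> {1..5}" "j \<noteq> l"
      "touch G (B - C) ?lab j \<noteq> {}" "touch G (B - C) ?lab l \<noteq> {}"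
    have "sets_adjacent G {v. lab v = j} {v. lab v = l}"
      using adj[OF j l(1,2)] act l j by blast
    then show "sets_adjacent G {v. ?lab v = j} {v. ?lab v = l}"
      using sub[OF j] sub[OF l(1)] unfolding sets_adjacent_def by blast
  qed
qed

text \<open>All neighbours of \<open>B\<close> in \<open>K\<close> are in \<open>X\<close>, so a
  component of \<open>K - X\<close> lies inside or outside \<open>B\<close>. Inside it is small
  since no big part is left, outside since \<open>B\<close> has more than half of \<open>K\<close>.
  The constant is \<open>66 = 11 + 5 * 11\<close>, for \<open>Y\<close> and the contacts of five
  labels.\<close>

lemma search_final:
  assumes inv: "search_inv G K B lab" and Y: "Y \<subseteq> B" "real (card Y) \<le> 11 * sqrt (card K)"
    and D: "big_part G (card K) (B - Y) = {}"
    and X: "X = Y \<union> {v \<in> K - B. \<exists>w\<in>B. (w, v) \<in> G}"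
  shows "real (card X) \<le> 66 * sqrt (card K)" "v \<in> K - X \<Longrightarrow> 2 * card (component G (K - X) v) \<le> card K"
proof -
  note BK = search_inv_subset[OF inv] and conB = search_inv_connected[OF inv] and labK = search_inv_lab[OF inv]
    and nb = search_inv_boundary[OF inv] and lab5 = search_inv_lab_le[OF inv] and crd = search_inv_card[OF inv]
    and con = search_inv_label_connected[OF inv] and adj = search_inv_label_adjacent[OF inv]
    and big = search_inv_big[OF inv]
  have finB: "finite B" using BK finK finite_subset by blast
  let ?P = "\<lambda>i. {v \<in> K. lab v = i \<and> (\<exists>w\<in>B. (v, w) \<in> G)}"
  have finP: "finite (?P i)" for i using finK by auto
  have "X \<subseteq> Y \<union> (\<Union>i\<in>{1..5}. ?P i)"
  proof
    fix v assume "v \<in> X"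
    then consider "v \<in> Y" | w where "v \<in> K" "v \<notin> B" "w \<in> B" "(v, w) \<in> G" using X symG by blast
    then show "v \<in> Y \<union> (\<Union>i\<in>{1..5}. ?P i)"
    proof cases
      case 2
      then have "lab v \<noteq> 0" using nb by blast
      then have "lab v \<in> {1..5}" using lab5[of v] by auto
      then show ?thesis using 2 by blast
    qed simp
  qed
  then have "card X \<le> card (Y \<union> (\<Union>i\<in>{1..5}. ?P i))"
    using finP finB Y finite_subset by (intro card_mono) auto
  also have "\<dots> \<le> card Y + card (\<Union>i\<in>{1..5}. ?P i)" by (rule card_Un_le)
  also have "card (\<Union>i\<in>{1..5}. ?P i) \<le> (\<Sum>i\<in>{1..5}. card (?P i))" by (rule card_UN_le) simp
  finally have "card X \<le> card Y + (\<Sum>i\<in>{1..5}. card (?P i))" by simp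
  then have "real (card X) \<le> real (card Y) + (\<Sum>i\<in>{1..5}. real (card (?P i)))"
    by (simp only: of_nat_add[symmetric] of_nat_sum[symmetric] of_nat_le_iff)
  also have "(\<Sum>i\<in>{1..5}. real (card (?P i))) \<le> (\<Sum>i\<in>{1..5::nat}. 11 * sqrt (card K))"
    using crd by (intro sum_mono) auto
  finally show "real (card X) \<le> 66 * sqrt (card K)" using Y by simp
  assume v: "v \<in> K - X"
  have sep: "y \<in> B" if "x \<in> B" "y \<in> K - X" "(x, y) \<in> G" for x y using that X by auto
  show "2 * card (component G (K - X) v) \<le> card K"
  proof (cases "v \<in> B")
    case True
    have "component G (K - X) v \<subseteq> component G (B - Y) v"
    proof (rule component_least[OF component_self])
      fix x y assume xy: "x \<in> component G (B - Y) v" "x \<in> K - X" "y \<in> K - X" "(x, y) \<in> G"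
      have vY: "v \<in> B - Y" using True v X by blast
      have "x \<in> B" using subsetD[OF component_subset[OF vY] xy(1)] by simp
      then have "y \<in> B" using sep[OF _ xy(3,4)] by simp
      then have "y \<in> B - Y" using xy(3) X by simp
      then show "y \<in> component G (B - Y) v" using component_step[OF xy(1) vY _ xy(4)] by simp
    qed
    moreover have vY: "v \<in> B - Y" using True v X by blast
    then have "finite (component G (B - Y) v)" by (rule finite_subset[OF component_subset finite_Diff[OF finB]])
    ultimately have "card (component G (K - X) v) \<le> card (component G (B - Y) v)" by (intro card_mono)
    moreover have "2 * card (component G (B - Y) v) \<le> card K" using D vY by (auto simp: big_part_def not_less)
    ultimately show ?thesis by linarith
  next
    case False
    have "component G (K - X) v \<subseteq> K - B"
    proof (rule component_least)
      show "v \<in> K - B" using v False by blast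
      fix x y assume "x \<in> K - B" "x \<in> K - X" "y \<in> K - X" "(x, y) \<in> G"
      then show "y \<in> K - B" using sep[of y x] symG by blast
    qed
    then have "card (component G (K - X) v) \<le> card (K - B)" using finK by (simp add: card_mono)
    also have "\<dots> = card K - card B" using BK finB by (simp add: card_Diff_subset)
    finally show ?thesis using big by linarith
  qed
qed

end

section \<open>From separators to colorings\<close>

text \<open>Weights for an amortized count: a component with \<open>k > r\<close> vertices weighs
  \<open>sqrt k\<close> in total, and halving it multiplies this by at least \<open>sqrt 2\<close>.
  The cutoff at \<open>r / 2\<close> caps each weight at the value given to members of
  \<open>S\<close>. It does not disturb the halving, as only components with more than
  \<open>r\<close> vertices are split.\<close>

definition potential :: "('a \<times> 'a) set \<Rightarrow> 'a set \<Rightarrow> real \<Rightarrow> 'a set \<Rightarrow> 'a \<Rightarrow> real" where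
  "potential G V r S v = (if v \<in> S then sqrt 2 / sqrt r
     else 1 / sqrt (max (real (card (component G (V - S) v))) (r / 2)))"

lemma component_remove_other:
  assumes "sym G" "v \<in> V - S" "v0 \<in> V - S" "v \<notin> component G (V - S) v0" "X \<subseteq> component G (V - S) v0"
  shows "component G (V - (S \<union> X)) v = component G (V - S) v"
proof
  let ?K = "component G (V - S) v0"
  show "component G (V - (S \<union> X)) v \<subseteq> component G (V - S) v" by (rule component_mono) blast
  have vR: "v \<in> V - (S \<union> X)" using assms by blast
  have "component G (V - S) v \<subseteq> component G (V - (S \<union> X)) v - ?K"
  proof (rule component_least)
    show "v \<in> component G (V - (S \<union> X)) v - ?K" using component_self[of v G] assms(4) by simp
    fix x y assume xy: "x \<in> component G (V - (S \<union> X)) v - ?K" "x \<in> V - S" "y \<in> V - S" "(x, y) \<in> G"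
    have yx: "(y, x) \<in> G" using assms(1) xy(4) by (rule symD)
    have "y \<notin> ?K" using component_step[OF _ assms(3) xy(2) yx] xy(1) by blast
    then have "y \<in> V - (S \<union> X)" using xy(3) assms(5) by blast
    then show "y \<in> component G (V - (S \<union> X)) v - ?K"
      using component_step[OF _ vR _ xy(4)] xy(1) \<open>y \<notin> ?K\<close> by blast
  qed
  then show "component G (V - S) v \<subseteq> component G (V - (S \<union> X)) v" by blast
qed

lemma component_remove_same:
  assumes "v0 \<in> V - S" "v \<in> component G (V - S) v0 - X"
  shows "component G (V - (S \<union> X)) v \<subseteq> component G (component G (V - S) v0 - X) v"
proof (rule component_least[OF component_self])
  let ?K = "component G (V - S) v0"
  fix x y assume xy: "x \<in> component G (?K - X) v" "x \<in> V - (S \<union> X)" "y \<in> V - (S \<union> X)" "(x, y) \<in> G"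
  have "x \<in> ?K" using subsetD[OF component_subset[OF assms(2)] xy(1)] by blast
  then have "y \<in> ?K" using component_step[OF _ assms(1) _ xy(4)] xy(3) by blast
  then show "y \<in> component G (?K - X) v"
    using component_step[OF xy(1) assms(2) _ xy(4)] xy(3) by blast
qed

lemma potential_le: "r > 0 \<Longrightarrow> potential G V r S v \<le> sqrt 2 / sqrt r"
proof -
  assume r: "r > 0"
  let ?m = "max (real (card (component G (V - S) v))) (r / 2)"
  have "1 / sqrt ?m \<le> 1 / sqrt (r / 2)" using r by (intro divide_left_mono real_sqrt_le_mono) auto
  also have "\<dots> = sqrt 2 / sqrt r" by (simp add: real_sqrt_divide)
  finally show ?thesis by (auto simp: potential_def)
qed

text \<open>Only the weights on \<open>K\<close> change, and they gain at least
  \<open>(sqrt 2 - 1) * sqrt k\<close>. The factor \<open>66 * (sqrt 2 + 1)\<close> turns this into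
  the cost \<open>66 * sqrt k\<close> of \<open>X\<close>, because
  \<open>(sqrt 2 + 1) * (sqrt 2 - 1) = 1\<close>.\<close>

lemma separation_step:
  assumes sym: "sym G" and V: "finite V" "S \<subseteq> V" and r: "r > 0"
    and v0: "v0 \<in> V - S" and K: "K = component G (V - S) v0" "real (card K) > r"
    and X: "X \<subseteq> K" "real (card X) \<le> 66 * sqrt (card K)"
    and small: "\<And>v. v \<in> K - X \<Longrightarrow> 2 * card (component G (K - X) v) \<le> card K"
    and S: "real (card S) \<le> 66 * (sqrt 2 + 1) * (\<Sum>v\<in>V. potential G V r S v)"
  shows "real (card (S \<union> X)) \<le> 66 * (sqrt 2 + 1) * (\<Sum>v\<in>V. potential G V r (S \<union> X) v)"
proof -
  let ?k = "real (card K)"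
  have KV: "K \<subseteq> V - S" unfolding K(1) by (rule component_subset[OF v0])
  have finK: "finite K" using KV V(1) by (meson finite_Diff finite_subset)
  have k: "?k > 0" using K(2) r by linarith
  have rk: "sqrt r \<le> sqrt ?k" using K(2) by simp
  have inK: "potential G V r S v = 1 / sqrt ?k" if "v \<in> K" for v
  proof -
    have "component G (V - S) v = K" using component_eq[OF sym] that K(1) by metis
    moreover have "v \<notin> S" using KV that by blast
    moreover have "max ?k (r / 2) = ?k" using K(2) r by simp
    ultimately show ?thesis by (simp add: potential_def)
  qed
  have inK': "potential G V r (S \<union> X) v \<ge> sqrt 2 / sqrt ?k" if "v \<in> K" for v
  proof (cases "v \<in> X")
    case True
    have "sqrt 2 / sqrt ?k \<le> sqrt 2 / sqrt r" using rk r k by (intro divide_left_mono) auto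
    then show ?thesis using True by (simp add: potential_def)
  next
    case False
    let ?C = "component G (V - (S \<union> X)) v"
    have vK: "v \<in> K - X" using that False by blast
    have "?C \<subseteq> component G (K - X) v" using component_remove_same[OF v0] vK unfolding K(1) by blast
    moreover have "finite (component G (K - X) v)"
      by (rule finite_subset[OF component_subset[OF vK]]) (use finK in simp)
    ultimately have "card ?C \<le> card (component G (K - X) v)" by (intro card_mono)
    then have "real (card ?C) \<le> ?k / 2" using small[OF vK] by linarith
    then have m: "max (real (card ?C)) (r / 2) \<le> ?k / 2" using K(2) by simp
    have "sqrt 2 / sqrt ?k = 1 / sqrt (?k / 2)" by (simp add: real_sqrt_divide)
    also have "\<dots> \<le> 1 / sqrt (max (real (card ?C)) (r / 2))"
    proof (intro divide_left_mono real_sqrt_le_mono m mult_pos_pos)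
      have "0 < max (real (card ?C)) (r / 2)" using r by (simp add: less_max_iff_disj)
      then show "0 < sqrt (max (real (card ?C)) (r / 2))" by simp
    qed (use k in auto)
    finally show ?thesis using KV vK by (auto simp: potential_def)
  qed
  have outK: "potential G V r (S \<union> X) v = potential G V r S v" if "v \<in> V - K" for v
  proof (cases "v \<in> S")
    case True
    then show ?thesis by (simp add: potential_def)
  next
    case False
    then have "component G (V - (S \<union> X)) v = component G (V - S) v"
      using component_remove_other[OF sym _ v0] that X(1) unfolding K(1) by blast
    moreover have "v \<notin> X" using that X by blast
    ultimately show ?thesis using False by (simp add: potential_def)
  qed
  have split: "(\<Sum>v\<in>V. potential G V r T v) = (\<Sum>v\<in>V - K. potential G V r T v) + (\<Sum>v\<in>K. potential G V r T v)" for T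
    using sum.subset_diff[of K V] KV V(1) by blast
  have "(\<Sum>v\<in>K. potential G V r S v) = ?k * (1 / sqrt ?k)" using inK by simp
  moreover have "(\<Sum>v\<in>K. potential G V r (S \<union> X) v) \<ge> ?k * (sqrt 2 / sqrt ?k)"
    using sum_mono[of K "\<lambda>_. sqrt 2 / sqrt ?k" "potential G V r (S \<union> X)"] inK' by simp
  moreover have "(\<Sum>v\<in>V - K. potential G V r (S \<union> X) v) = (\<Sum>v\<in>V - K. potential G V r S v)"
    by (rule sum.cong) (use outK in auto)
  moreover have a: "?k * (1 / sqrt ?k) = sqrt ?k" using real_div_sqrt[of ?k] k by simp
  moreover have "?k * (sqrt 2 / sqrt ?k) = sqrt 2 * (?k * (1 / sqrt ?k))" by simp
  ultimately have inc: "(\<Sum>v\<in>V. potential G V r (S \<union> X) v) \<ge> (\<Sum>v\<in>V. potential G V r S v) + (sqrt 2 - 1) * sqrt ?k"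
    unfolding split[of S] split[of "S \<union> X"] a by (simp only: left_diff_distrib mult_1_left)
  have ring: "66 * a * p + 66 * (a * b) * q = 66 * a * (p + b * q)" for a b p q :: real by (simp add: algebra_simps)
  have one: "(sqrt 2 + 1) * (sqrt 2 - 1) = (1::real)" by (simp add: algebra_simps)
  have "real (card (S \<union> X)) \<le> real (card S) + real (card X)" using card_Un_le[of S X] by linarith
  also have "\<dots> \<le> 66 * (sqrt 2 + 1) * (\<Sum>v\<in>V. potential G V r S v) + 66 * sqrt ?k" using S X by linarith
  also have "66 * sqrt ?k = 66 * ((sqrt 2 + 1) * (sqrt 2 - 1)) * sqrt ?k" unfolding one by simp
  also have "66 * (sqrt 2 + 1) * (\<Sum>v\<in>V. potential G V r S v) + 66 * ((sqrt 2 + 1) * (sqrt 2 - 1)) * sqrt ?k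
      = 66 * (sqrt 2 + 1) * ((\<Sum>v\<in>V. potential G V r S v) + (sqrt 2 - 1) * sqrt ?k)"
    by (rule ring)
  also have "\<dots> \<le> 66 * (sqrt 2 + 1) * (\<Sum>v\<in>V. potential G V r (S \<union> X) v)"
    by (rule mult_left_mono[OF inc]) simp
  finally show ?thesis .
qed

lemma separator_card_bound:
  assumes V: "finite V" "card V = n" and n: "n > 0"
    and S: "real (card S) \<le> 66 * (sqrt 2 + 1) * (\<Sum>v\<in>V. potential G V (real n powr (2 / 3)) S v)"
  shows "real (card S) \<le> 231 * real n powr (2 / 3)"
proof -
  let ?r = "real n powr (2 / 3)"
  have r: "?r > 0" using n by simp
  have sr: "sqrt ?r = real n powr (1 / 3)" using n by (simp add: powr_half_sqrt[symmetric] powr_powr)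
  \<comment> \<open>This equation determines the exponent: it makes the bound
    \<open>sqrt 2 * n / sqrt r\<close> on the total weight a multiple of \<open>r\<close>.\<close>
  have nr: "real n / sqrt ?r = ?r"
    unfolding sr using n powr_diff[of "real n" 1 "1/3"] by simp
  have "(\<Sum>v\<in>V. potential G V ?r S v) \<le> (\<Sum>v\<in>V. sqrt 2 / sqrt ?r)"
    by (intro sum_mono potential_le r)
  also have "\<dots> = sqrt 2 * (real n / sqrt ?r)" using V by simp
  finally have "(\<Sum>v\<in>V. potential G V ?r S v) \<le> sqrt 2 * ?r" unfolding nr .
  then have "66 * (sqrt 2 + 1) * (\<Sum>v\<in>V. potential G V ?r S v) \<le> 66 * (sqrt 2 + 1) * (sqrt 2 * ?r)"
    by (intro mult_left_mono) simp_all
  also have "\<dots> = (132 + 66 * sqrt 2) * ?r" by (simp add: algebra_simps)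
  also have "\<dots> \<le> 231 * ?r"
  proof (rule mult_right_mono)
    \<comment> \<open>The estimate \<open>sqrt 2 \<le> 3 / 2\<close> gives
      \<open>132 + 99 = 231\<close>.\<close>
    have "sqrt 2 \<le> sqrt ((3/2)\<^sup>2)" by (rule real_sqrt_le_mono) (simp add: power2_eq_square)
    then show "132 + 66 * sqrt 2 \<le> (231::real)" by simp
  qed (use r in simp)
  finally show ?thesis using S by linarith
qed

section \<open>Color groups compared with the optimum\<close>

lemma card_color_group_le:
  assumes "finite E"
  shows "card (color_group E c k) \<le> largest_group_size E c"
proof (cases "color_group E c k = {}")
  case False
  then have "k \<in> c ` E" by (auto simp: color_group_def)
  then show ?thesis unfolding largest_group_size_def using assms by (intro Max_ge) auto
qed simp

lemma degree_le_OPT2: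
  assumes "finite E" "v \<in> V"
  shows "card {e \<in> E. v \<in> e} \<le> 2 * OPT2 V E"
proof -
  obtain c where c: "edge_2_coloring V E c" "largest_group_size E c = OPT2 V E" using OPT2_attained by blast
  let ?D = "{e \<in> E. v \<in> e}"
  have "?D \<subseteq> (\<Union>k\<in>c ` ?D. color_group E c k)" by (auto simp: color_group_def)
  then have "card ?D \<le> card (\<Union>k\<in>c ` ?D. color_group E c k)"
    using assms(1) by (intro card_mono) (auto simp: color_group_def)
  also have "\<dots> \<le> (\<Sum>k\<in>c ` ?D. card (color_group E c k))" using assms(1) by (intro card_UN_le) simp
  also have "\<dots> \<le> (\<Sum>k\<in>c ` ?D. OPT2 V E)"
    using card_color_group_le[OF assms(1), of c] c(2) by (intro sum_mono) simp
  also have "\<dots> \<le> 2 * OPT2 V E" using c(1) assms(2) by (auto simp: edge_2_coloring_def)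
  finally show ?thesis .
qed

text \<open>Serves both kinds of color groups: \<open>A\<close> is \<open>S\<close> for the color
  \<open>0\<close>, and a component of \<open>V - S\<close> for any other color.\<close>

lemma incident_edges_bound:
  assumes "finite E" "finite A" "A \<subseteq> V" "F \<subseteq> E" "\<And>e. e \<in> F \<Longrightarrow> e \<inter> A \<noteq> {}" "real (card A) \<le> M"
  shows "real (card F) \<le> 2 * M * real (OPT2 V E)"
proof -
  have "F \<subseteq> (\<Union>v\<in>A. {e \<in> E. v \<in> e})" using assms(4,5) by blast
  then have "card F \<le> card (\<Union>v\<in>A. {e \<in> E. v \<in> e})" using assms(1,2) by (intro card_mono) auto
  also have "\<dots> \<le> (\<Sum>v\<in>A. card {e \<in> E. v \<in> e})" using assms(2) by (rule card_UN_le)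
  also have "\<dots> \<le> (\<Sum>v\<in>A. 2 * OPT2 V E)" using degree_le_OPT2[OF assms(1)] assms(3) by (intro sum_mono) blast
  also have "\<dots> = card A * (2 * OPT2 V E)" by simp
  finally have "real (card F) \<le> real (card A) * (2 * real (OPT2 V E))"
    by (metis (no_types, lifting) of_nat_le_iff of_nat_mult of_nat_numeral)
  also have "\<dots> \<le> M * (2 * real (OPT2 V E))" using assms(6) by (intro mult_right_mono) auto
  finally show ?thesis by simp
qed

text \<open>\<open>rep\<close> names the components of \<open>V - S\<close>, and \<open>Suc\<close>
  keeps these colors apart from \<open>0\<close>. As \<open>c1\<close> holds at both ends of an
  edge, a vertex sees at most \<open>0\<close> and the color of its own component, and all edges of
  one positive color meet one component.\<close>

lemma separator_coloring:
  fixes c :: "'a set \<Rightarrow> nat"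
  assumes V: "finite V" "S \<subseteq> V" and E: "finite E" "\<And>e. e \<in> E \<Longrightarrow> e \<subseteq> V \<and> e \<noteq> {}"
    and c0: "\<And>e. e \<in> E \<Longrightarrow> e \<inter> S \<noteq> {} \<Longrightarrow> c e = 0"
    and c1: "\<And>e u. e \<in> E \<Longrightarrow> e \<inter> S = {} \<Longrightarrow> u \<in> e \<Longrightarrow> c e = Suc (rep u)"
    and rep: "\<And>u w. u \<in> V - S \<Longrightarrow> w \<in> V - S \<Longrightarrow> rep u = rep w \<Longrightarrow> w \<in> component G (V - S) u"
    and M: "real (card S) \<le> M" "\<And>v. v \<in> V - S \<Longrightarrow> real (card (component G (V - S) v)) \<le> M"
  shows "edge_2_coloring V E c" "real (largest_group_size E c) \<le> 2 * M * real (OPT2 V E)"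
proof -
  show "edge_2_coloring V E c"
    unfolding edge_2_coloring_def
  proof
    fix v assume "v \<in> V"
    have "c e \<in> {0, Suc (rep v)}" if "e \<in> E" "v \<in> e" for e
      using c0[OF that(1)] c1[OF that(1) _ that(2)] by (cases "e \<inter> S = {}") simp_all
    then have "c ` {e \<in> E. v \<in> e} \<subseteq> {0, Suc (rep v)}" by (intro image_subsetI) simp
    then have "card (c ` {e \<in> E. v \<in> e}) \<le> card {0, Suc (rep v)}" by (intro card_mono) auto
    then show "card (c ` {e \<in> E. v \<in> e}) \<le> 2" by simp
  qed
  have group: "real (card (color_group E c k)) \<le> 2 * M * real (OPT2 V E)" if kE: "k \<in> c ` E" for k
  proof -
    obtain e0 where e0: "e0 \<in> E" "c e0 = k" using kE by blast
    show ?thesis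
    proof (cases "k = 0")
      case True
      have "e \<inter> S \<noteq> {}" if "e \<in> color_group E c k" for e
      proof
        assume "e \<inter> S = {}"
        moreover have "e \<in> E" "c e = 0" using that True by (auto simp: color_group_def)
        ultimately show False using c1[of e] E(2)[of e] by fastforce
      qed
      then show ?thesis
        using finite_subset[OF V(2,1)] by (intro incident_edges_bound[OF E(1) _ V(2) _ _ M(1)]) (auto simp: color_group_def)
    next
      case False
      then have e0S: "e0 \<inter> S = {}" using c0[OF e0(1)] e0(2) False by auto
      obtain u where u: "u \<in> e0" using E(2)[OF e0(1)] by auto
      have uV: "u \<in> V - S" using u e0S E(2)[OF e0(1)] by auto
      have k: "k = Suc (rep u)" using c1[OF e0(1) e0S u] e0 by simp
      let ?C = "component G (V - S) u"
      have CV: "?C \<subseteq> V" using component_subset[OF uV, of G] by auto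
      have "e \<inter> ?C \<noteq> {}" if "e \<in> color_group E c k" for e
      proof -
        have e: "e \<in> E" "c e = k" using that by (auto simp: color_group_def)
        then have eS: "e \<inter> S = {}" using c0[OF e(1)] e(2) False by auto
        obtain w where w: "w \<in> e" using E(2)[OF e(1)] by auto
        have "w \<in> V - S" using w eS E(2)[OF e(1)] by auto
        moreover have "rep u = rep w" using c1[OF e(1) eS w] e(2) k by simp
        ultimately have "w \<in> ?C" by (rule rep[OF uV])
        then show ?thesis using w by auto
      qed
      then show ?thesis
        using finite_subset[OF CV V(1)]
        by (intro incident_edges_bound[OF E(1) _ CV _ _ M(2)[OF uV]]) (auto simp: color_group_def)
    qed
  qed
  have "0 \<le> M" using M(1) by linarith
  then have "0 \<le> 2 * M * real (OPT2 V E)" by simp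
  moreover have "largest_group_size E c \<in> insert 0 ((\<lambda>k. card (color_group E c k)) ` c ` E)"
    unfolding largest_group_size_def using E(1) by (intro Max_in) auto
  ultimately show "real (largest_group_size E c) \<le> 2 * M * real (OPT2 V E)" using group by auto
qed

section \<open>A language of parallel array assignments\<close>

text \<open>All search is pushed into expressions: the bounded sum \<open>Sm\<close> is the only
  binder and serves as existential quantifier, as counter and for minimization as well.\<close>

datatype ex =
    Cn nat
  | Ix nat
  | Ar string ex
  | Pl ex ex
  | Mi ex ex
  | If ex ex ex
  | Sm nat ex

fun ev :: "ex \<Rightarrow> (nat \<Rightarrow> nat) \<Rightarrow> store \<Rightarrow> nat" where
  "ev (Cn k) \<rho> s = k"
| "ev (Ix x) \<rho> s = \<rho> x"
| "ev (Ar a e) \<rho> s = s a (ev e \<rho> s)"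
| "ev (Pl a b) \<rho> s = ev a \<rho> s + ev b \<rho> s"
| "ev (Mi a b) \<rho> s = ev a \<rho> s - ev b \<rho> s"
| "ev (If c a b) \<rho> s = (if ev c \<rho> s \<noteq> 0 then ev a \<rho> s else ev b \<rho> s)"
| "ev (Sm x e) \<rho> s = (\<Sum>i<s ''N'' 0. ev e (\<rho>(x := i)) s)"

text \<open>There is no loop with a condition. \<open>It\<close> always repeats \<open>N\<close>
  times, so termination and running time depend on the syntax alone.\<close>

datatype st =
    Asg string ex
  | Sq st st
  | It st

fun run :: "st \<Rightarrow> store \<Rightarrow> store" where
  "run (Asg a e) s = s(a := (\<lambda>i. if i < s ''N'' 0 then ev e ((\<lambda>_. 0)(0 := i)) s else s a i))"
| "run (Sq p q) s = run q (run p s)"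
| "run (It p) s = (run p ^^ s ''N'' 0) s"

fun arrays :: "ex \<Rightarrow> string set" where
  "arrays (Ar a e) = insert a (arrays e)"
| "arrays (Pl a b) = arrays a \<union> arrays b"
| "arrays (Mi a b) = arrays a \<union> arrays b"
| "arrays (If c a b) = arrays c \<union> arrays a \<union> arrays b"
| "arrays (Sm x e) = arrays e"
| "arrays _ = {}"

fun reads :: "st \<Rightarrow> string set" where
  "reads (Asg a e) = arrays e"
| "reads (Sq p q) = reads p \<union> reads q"
| "reads (It p) = reads p"

fun writes :: "st \<Rightarrow> string set" where
  "writes (Asg a e) = {a}"
| "writes (Sq p q) = writes p \<union> writes q"
| "writes (It p) = writes p"

lemma run_frame: "a \<notin> writes p \<Longrightarrow> run p s a = s a"
proof (induction p arbitrary: s)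
  case (It p)
  have "(run p ^^ k) s a = s a" for k by (induction k) (use It in auto)
  then show ?case by simp
qed auto

lemma ev_cong:
  assumes "\<And>a. a \<in> insert ''N'' (arrays e) \<Longrightarrow> s a = s' a"
  shows "ev e \<rho> s = ev e \<rho> s'"
proof -
  have "\<forall>a\<in>insert ''N'' (arrays e). s a = s' a" using assms by blast
  then show ?thesis by (induction e arbitrary: \<rho>) simp_all
qed

lemma ev_cong_off:
  assumes "arrays e \<inter> R = {}" "''N'' \<notin> R" "\<And>a. a \<notin> R \<Longrightarrow> s a = s' a"
  shows "ev e \<rho> s = ev e \<rho> s'"
  by (rule ev_cong) (use assms in blast)

text \<open>The compiled code keeps the bound variables in \<open>_i\<close>, a register stack in \<open>_r\<close>, the new
  values of a parallel assignment in \<open>_t\<close>, and the counters of the iterations in \<open>_c\<close>.\<close>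

fun compile_ex :: "ex \<Rightarrow> nat \<Rightarrow> prog" where
  "compile_ex (Cn k) d = Assign ''_r'' (Lit d) (Lit k)"
| "compile_ex (Ix x) d = Assign ''_r'' (Lit d) (Read ''_i'' (Lit x))"
| "compile_ex (Ar a e) d = Seq (compile_ex e d) (Assign ''_r'' (Lit d) (Read a (Read ''_r'' (Lit d))))"
| "compile_ex (Pl a b) d = Seq (compile_ex a d) (Seq (compile_ex b (d + 1))
     (Assign ''_r'' (Lit d) (Add (Read ''_r'' (Lit d)) (Read ''_r'' (Lit (d + 1))))))"
| "compile_ex (Mi a b) d = Seq (compile_ex a d) (Seq (compile_ex b (d + 1))
     (Assign ''_r'' (Lit d) (Sub (Read ''_r'' (Lit d)) (Read ''_r'' (Lit (d + 1))))))"
| "compile_ex (If c a b) d = Seq (compile_ex c d)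
     (Cond (Read ''_r'' (Lit d)) (compile_ex a d) (compile_ex b d))"
| "compile_ex (Sm x e) d =
     Seq (Assign ''_r'' (Lit (d + 1)) (Read ''_i'' (Lit x)))
    (Seq (Assign ''_r'' (Lit d) (Lit 0))
    (Seq (Assign ''_i'' (Lit x) (Lit 0))
    (Seq (While (Sub (Read ''N'' (Lit 0)) (Read ''_i'' (Lit x)))
       (Seq (compile_ex e (d + 2))
       (Seq (Assign ''_r'' (Lit d) (Add (Read ''_r'' (Lit d)) (Read ''_r'' (Lit (d + 2)))))
            (Assign ''_i'' (Lit x) (Add (Read ''_i'' (Lit x)) (Lit 1))))))
         (Assign ''_i'' (Lit x) (Read ''_r'' (Lit (d + 1)))))))"

fun compile :: "st \<Rightarrow> nat \<Rightarrow> prog" where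
  "compile (Asg a e) c =
     Seq (While (Sub (Read ''N'' (Lit 0)) (Read ''_i'' (Lit 0)))
       (Seq (compile_ex e 0)
       (Seq (Assign ''_t'' (Read ''_i'' (Lit 0)) (Read ''_r'' (Lit 0)))
            (Assign ''_i'' (Lit 0) (Add (Read ''_i'' (Lit 0)) (Lit 1))))))
    (Seq (Assign ''_i'' (Lit 0) (Lit 0))
    (Seq (While (Sub (Read ''N'' (Lit 0)) (Read ''_i'' (Lit 0)))
       (Seq (Assign a (Read ''_i'' (Lit 0)) (Read ''_t'' (Read ''_i'' (Lit 0))))
            (Assign ''_i'' (Lit 0) (Add (Read ''_i'' (Lit 0)) (Lit 1)))))
         (Assign ''_i'' (Lit 0) (Lit 0))))"
| "compile (Sq p q) c = Seq (compile p c) (compile q c)"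
| "compile (It p) c =
     Seq (Assign ''_c'' (Lit c) (Lit 0))
         (While (Sub (Read ''N'' (Lit 0)) (Read ''_c'' (Lit c)))
           (Seq (compile p (c + 1)) (Assign ''_c'' (Lit c) (Add (Read ''_c'' (Lit c)) (Lit 1)))))"

text \<open>\<open>[:0, 1:]\<close> stands for \<open>N\<close>. The sums are bracketed like the
  compiled \<open>Seq\<close>s, so that the timing rules apply without arithmetic; a conditional is
  charged for both branches, which avoids a maximum of polynomials.\<close>

fun cost_ex :: "ex \<Rightarrow> nat poly" where
  "cost_ex (Cn k) = 1"
| "cost_ex (Ix x) = 1"
| "cost_ex (Ar a e) = cost_ex e + 1"
| "cost_ex (Pl a b) = cost_ex a + (cost_ex b + 1)"
| "cost_ex (Mi a b) = cost_ex a + (cost_ex b + 1)"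
| "cost_ex (If c a b) = cost_ex c + (1 + (cost_ex a + cost_ex b))"
| "cost_ex (Sm x e) = 1 + (1 + (1 + (([:0, 1:] * (cost_ex e + (1 + 1) + 1) + 1) + 1)))"

fun cost :: "st \<Rightarrow> nat poly" where
  "cost (Asg a e) = ([:0, 1:] * (cost_ex e + (1 + 1) + 1) + 1) + (1 + (([:0, 1:] * (1 + 1 + 1) + 1) + 1))"
| "cost (Sq p q) = cost p + cost q"
| "cost (It p) = 1 + ([:0, 1:] * (cost p + 1 + 1) + 1)"

section \<open>Timed correctness of the compiler\<close>

definition runs :: "prog \<Rightarrow> store \<Rightarrow> nat \<Rightarrow> (store \<Rightarrow> bool) \<Rightarrow> bool" where
  "runs P s T Q \<longleftrightarrow> (\<exists>t s'. exec P s t s' \<and> t \<le> T \<and> Q s')"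

lemma runs_Assign: "Q (s(x := (s x)(val a s := val b s))) \<Longrightarrow> runs (Assign x a b) s 1 Q"
  unfolding runs_def by (intro exI conjI, rule exec.Assign) auto

lemma runs_Seq:
  "runs P s T R \<Longrightarrow> (\<And>s'. R s' \<Longrightarrow> runs P' s' T' Q) \<Longrightarrow> runs (Seq P P') s (T + T') Q"
  unfolding runs_def by (meson exec.Seq add_mono)

lemma runs_Assign_Seq:
  "runs P (s(x := (s x)(val a s := val b s))) T Q \<Longrightarrow> runs (Seq (Assign x a b) P) s (1 + T) Q"
  unfolding runs_def by (meson exec.Assign exec.Seq add_left_mono)

lemma runs_conseq: "runs P s T R \<Longrightarrow> T \<le> T' \<Longrightarrow> (\<And>s'. R s' \<Longrightarrow> Q s') \<Longrightarrow> runs P s T' Q"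
  unfolding runs_def by (meson le_trans)

lemma runs_Cond:
  assumes "val b s \<noteq> 0 \<Longrightarrow> runs P s T Q" "val b s = 0 \<Longrightarrow> runs P' s T' Q"
  shows "runs (Cond b P P') s (1 + (T + T')) Q"
proof (cases "val b s = 0")
  case True
  then obtain t s' where "exec P' s t s'" "t \<le> T'" "Q s'" using assms unfolding runs_def by blast
  then show ?thesis unfolding runs_def using exec.CondFalse[OF True, of P' t s' P]
    by (intro exI[of _ "1 + t"] exI[of _ s']) auto
next
  case False
  then obtain t s' where "exec P s t s'" "t \<le> T" "Q s'" using assms unfolding runs_def by blast
  then show ?thesis unfolding runs_def using exec.CondTrue[OF False, of P t s' P']
    by (intro exI[of _ "1 + t"] exI[of _ s']) auto
qed

text \<open>The invariant carries the number of finished rounds. Each round pays \<open>T\<close>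
  and one unit for its test, and the last unit pays for the failing test.\<close>

lemma runs_While:
  assumes I: "I 0 s"
    and step: "\<And>i s. i < n \<Longrightarrow> I i s \<Longrightarrow> val b s \<noteq> 0 \<and> runs P s T (I (Suc i))"
    and stop: "\<And>s. I n s \<Longrightarrow> val b s = 0"
  shows "runs (While b P) s (n * (T + 1) + 1) (I n)"
proof -
  have "k \<le> n \<Longrightarrow> I (n - k) s \<Longrightarrow> runs (While b P) s (k * (T + 1) + 1) (I n)" for k s
  proof (induction k arbitrary: s)
    case 0
    then show ?case using stop[of s] exec.WhileFalse[of b s P] unfolding runs_def by force
  next
    case (Suc k)
    then have b: "val b s \<noteq> 0" and "runs P s T (I (Suc (n - Suc k)))"
      using step[of "n - Suc k" s] by auto
    then obtain t s' where t: "exec P s t s'" "t \<le> T" "I (n - k) s'"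
      using Suc.prems(1) unfolding runs_def by (auto simp: Suc_diff_Suc)
    have "k \<le> n" using Suc.prems by simp
    from Suc.IH[OF this t(3)] obtain u s'' where "exec (While b P) s' u s''"
      "u \<le> k * (T + 1) + 1" "I n s''"
      unfolding runs_def by blast
    then show ?case using exec.WhileTrue[OF b t(1)] t(2) unfolding runs_def
      by (intro exI[of _ "1 + t + u"] exI[of _ s'']) auto
  qed
  from this[of n s] I show ?thesis by simp
qed

text \<open>A stack discipline: registers below \<open>d\<close> belong to the enclosing expressions
  and survive. Since every array other than \<open>_r\<close> is unchanged, the bound variables in
  \<open>_i\<close> are restored as well.\<close>

lemma runs_compile_ex:
  assumes "arrays e \<inter> {''_r'', ''_i''} = {}"
  shows "runs (compile_ex e d) s (poly (cost_ex e) (s ''N'' 0))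
    (\<lambda>s'. s' ''_r'' d = ev e (s ''_i'') s \<and> (\<forall>j<d. s' ''_r'' j = s ''_r'' j) \<and> (\<forall>a. a \<noteq> ''_r'' \<longrightarrow> s' a = s a))"
  using assms
proof (induction e arbitrary: d s)
  case (Cn k)
  show ?case unfolding compile_ex.simps cost_ex.simps poly_1 by (rule runs_Assign) auto
next
  case (Ix x)
  show ?case unfolding compile_ex.simps cost_ex.simps poly_1 by (rule runs_Assign) auto
next
  case (Ar a e)
  show ?case unfolding compile_ex.simps cost_ex.simps poly_add poly_1
    by (rule runs_Seq[OF Ar.IH], use Ar.prems in simp, rule runs_Assign) (use Ar.prems in auto)
next
  case (Pl a b)
  let ?R1 = "\<lambda>s'. s' ''_r'' d = ev a (s ''_i'') s \<and> (\<forall>j<d. s' ''_r'' j = s ''_r'' j) \<and> (\<forall>a. a \<noteq> ''_r'' \<longrightarrow> s' a = s a)"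
  show ?case unfolding compile_ex.simps cost_ex.simps poly_add poly_1
  proof (rule runs_Seq[where R = ?R1])
    show "runs (compile_ex a d) s (poly (cost_ex a) (s ''N'' 0)) ?R1" using Pl by auto
    fix s1 assume R1: "?R1 s1"
    have "ev b \<rho> s1 = ev b \<rho> s" for \<rho>
      using R1 Pl.prems by (intro ev_cong_off[of _ "{''_r'', ''_i''}"]) auto
    with R1 have "ev b (s1 ''_i'') s1 = ev b (s ''_i'') s" by simp
    with R1 show "runs (Seq (compile_ex b (d + 1)) (Assign ''_r'' (Lit d)
        (Add (Read ''_r'' (Lit d)) (Read ''_r'' (Lit (d + 1)))))) s1 (poly (cost_ex b) (s ''N'' 0) + 1)
        (\<lambda>s'. s' ''_r'' d = ev (Pl a b) (s ''_i'') s \<and> (\<forall>j<d. s' ''_r'' j = s ''_r'' j) \<and> (\<forall>a. a \<noteq> ''_r'' \<longrightarrow> s' a = s a))"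
      by (intro runs_Seq[where R = "\<lambda>s'. s' ''_r'' (d + 1) = ev b (s1 ''_i'') s1 \<and>
          (\<forall>j<d + 1. s' ''_r'' j = s1 ''_r'' j) \<and> (\<forall>a. a \<noteq> ''_r'' \<longrightarrow> s' a = s1 a)"] runs_Assign)
        (use Pl.IH(2)[of "d + 1" s1] Pl.prems in auto)
  qed
next
  case (Mi a b)
  let ?R1 = "\<lambda>s'. s' ''_r'' d = ev a (s ''_i'') s \<and> (\<forall>j<d. s' ''_r'' j = s ''_r'' j) \<and> (\<forall>a. a \<noteq> ''_r'' \<longrightarrow> s' a = s a)"
  show ?case unfolding compile_ex.simps cost_ex.simps poly_add poly_1
  proof (rule runs_Seq[where R = ?R1])
    show "runs (compile_ex a d) s (poly (cost_ex a) (s ''N'' 0)) ?R1" using Mi by auto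
    fix s1 assume R1: "?R1 s1"
    have "ev b \<rho> s1 = ev b \<rho> s" for \<rho>
      using R1 Mi.prems by (intro ev_cong_off[of _ "{''_r'', ''_i''}"]) auto
    with R1 have "ev b (s1 ''_i'') s1 = ev b (s ''_i'') s" by simp
    with R1 show "runs (Seq (compile_ex b (d + 1)) (Assign ''_r'' (Lit d)
        (Sub (Read ''_r'' (Lit d)) (Read ''_r'' (Lit (d + 1)))))) s1 (poly (cost_ex b) (s ''N'' 0) + 1)
        (\<lambda>s'. s' ''_r'' d = ev (Mi a b) (s ''_i'') s \<and> (\<forall>j<d. s' ''_r'' j = s ''_r'' j) \<and> (\<forall>a. a \<noteq> ''_r'' \<longrightarrow> s' a = s a))"
      by (intro runs_Seq[where R = "\<lambda>s'. s' ''_r'' (d + 1) = ev b (s1 ''_i'') s1 \<and>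
          (\<forall>j<d + 1. s' ''_r'' j = s1 ''_r'' j) \<and> (\<forall>a. a \<noteq> ''_r'' \<longrightarrow> s' a = s1 a)"] runs_Assign)
        (use Mi.IH(2)[of "d + 1" s1] Mi.prems in auto)
  qed
next
  case (If c a b)
  let ?R1 = "\<lambda>s'. s' ''_r'' d = ev c (s ''_i'') s \<and> (\<forall>j<d. s' ''_r'' j = s ''_r'' j) \<and> (\<forall>a. a \<noteq> ''_r'' \<longrightarrow> s' a = s a)"
  show ?case unfolding compile_ex.simps cost_ex.simps poly_add poly_1
  proof (rule runs_Seq[where R = ?R1])
    show "runs (compile_ex c d) s (poly (cost_ex c) (s ''N'' 0)) ?R1" using If by auto
    fix s1 assume R1: "?R1 s1"
    have "ev b \<rho> s1 = ev b \<rho> s" "ev a \<rho> s1 = ev a \<rho> s" for \<rho>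
      using R1 If.prems by (intro ev_cong_off[of _ "{''_r'', ''_i''}"]; auto)+
    with R1 have eq: "ev b (s1 ''_i'') s1 = ev b (s ''_i'') s" "ev a (s1 ''_i'') s1 = ev a (s ''_i'') s" "s1 ''N'' = s ''N''"
      by simp_all
    show "runs (Cond (Read ''_r'' (Lit d)) (compile_ex a d) (compile_ex b d)) s1
      (1 + (poly (cost_ex a) (s ''N'' 0) + poly (cost_ex b) (s ''N'' 0)))
        (\<lambda>s'. s' ''_r'' d = ev (If c a b) (s ''_i'') s \<and> (\<forall>j<d. s' ''_r'' j = s ''_r'' j) \<and> (\<forall>a. a \<noteq> ''_r'' \<longrightarrow> s' a = s a))"
    proof (rule runs_Cond)
      assume "val (Read ''_r'' (Lit d)) s1 \<noteq> 0"
      then show "runs (compile_ex a d) s1 (poly (cost_ex a) (s ''N'' 0))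
        (\<lambda>s'. s' ''_r'' d = ev (If c a b) (s ''_i'') s \<and> (\<forall>j<d. s' ''_r'' j = s ''_r'' j) \<and> (\<forall>a. a \<noteq> ''_r'' \<longrightarrow> s' a = s a))"
        using If.IH(2)[of d s1] If.prems R1 eq by (auto elim!: runs_conseq)
    next
      assume "val (Read ''_r'' (Lit d)) s1 = 0"
      then show "runs (compile_ex b d) s1 (poly (cost_ex b) (s ''N'' 0))
        (\<lambda>s'. s' ''_r'' d = ev (If c a b) (s ''_i'') s \<and> (\<forall>j<d. s' ''_r'' j = s ''_r'' j) \<and> (\<forall>a. a \<noteq> ''_r'' \<longrightarrow> s' a = s a))"
        using If.IH(3)[of d s1] If.prems R1 eq by (auto elim!: runs_conseq)
    qed
  qed
next
  case (Sm x e)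
  let ?N = "s ''N'' 0"
  \<comment> \<open>Register \<open>d\<close> accumulates the sum, \<open>d + 1\<close> saves the
    outer value of the variable \<open>x\<close> that the loop overwrites, and the summand is
    evaluated from \<open>d + 2\<close> on.\<close>
  define I where "I i s' \<longleftrightarrow> s' ''_r'' (d + 1) = s ''_i'' x \<and> s' ''_r'' d = (\<Sum>j<i. ev e ((s ''_i'')(x := j)) s) \<and>
    (\<forall>j<d. s' ''_r'' j = s ''_r'' j) \<and> s' ''_i'' = (s ''_i'')(x := i) \<and> (\<forall>a. a \<noteq> ''_r'' \<and> a \<noteq> ''_i'' \<longrightarrow> s' a = s a)"
    for i and s' :: store
  let ?s3 = "s(''_r'' := (s ''_r'')(d + 1 := s ''_i'' x, d := 0), ''_i'' := (s ''_i'')(x := 0))"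
  have I0: "I 0 ?s3" by (auto simp: I_def)
  have step: "runs (Seq (compile_ex e (d + 2))
       (Seq (Assign ''_r'' (Lit d) (Add (Read ''_r'' (Lit d)) (Read ''_r'' (Lit (d + 2)))))
            (Assign ''_i'' (Lit x) (Add (Read ''_i'' (Lit x)) (Lit 1))))) s' (poly (cost_ex e) ?N + (1 + 1)) (I (Suc i))"
    if "I i s'" for i s'
  proof (rule runs_Seq)
    have N: "s' ''N'' = s ''N''" using that by (auto simp: I_def)
    have "arrays e \<inter> {''_r'', ''_i''} = {}" using Sm.prems by auto
    from Sm.IH[OF this, of "d + 2" s']
    show "runs (compile_ex e (d + 2)) s' (poly (cost_ex e) ?N) (\<lambda>s1. s1 ''_r'' (d + 2) = ev e (s' ''_i'') s' \<and>
      (\<forall>j<d + 2. s1 ''_r'' j = s' ''_r'' j) \<and> (\<forall>a. a \<noteq> ''_r'' \<longrightarrow> s1 a = s' a))" by (simp only: N)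
    fix s1 assume s1: "s1 ''_r'' (d + 2) = ev e (s' ''_i'') s' \<and>
      (\<forall>j<d + 2. s1 ''_r'' j = s' ''_r'' j) \<and> (\<forall>a. a \<noteq> ''_r'' \<longrightarrow> s1 a = s' a)"
    have "ev e ((s ''_i'')(x := i)) s' = ev e ((s ''_i'')(x := i)) s"
      using that Sm.prems by (intro ev_cong_off[of _ "{''_r'', ''_i''}"]) (auto simp: I_def)
    then have e1: "s1 ''_r'' (Suc (Suc d)) = ev e ((s ''_i'')(x := i)) s" using s1 that by (auto simp: I_def)
    show "runs (Seq (Assign ''_r'' (Lit d) (Add (Read ''_r'' (Lit d)) (Read ''_r'' (Lit (d + 2)))))
            (Assign ''_i'' (Lit x) (Add (Read ''_i'' (Lit x)) (Lit 1)))) s1 (1 + 1) (I (Suc i))"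
      by (rule runs_Assign_Seq, rule runs_Assign)
        (use s1 that e1 in \<open>auto simp: I_def\<close>)
  qed
  have loop: "runs (While (Sub (Read ''N'' (Lit 0)) (Read ''_i'' (Lit x)))
       (Seq (compile_ex e (d + 2))
       (Seq (Assign ''_r'' (Lit d) (Add (Read ''_r'' (Lit d)) (Read ''_r'' (Lit (d + 2)))))
            (Assign ''_i'' (Lit x) (Add (Read ''_i'' (Lit x)) (Lit 1)))))) ?s3
     (?N * (poly (cost_ex e) ?N + (1 + 1) + 1) + 1) (I ?N)"
    by (rule runs_While[where I = I, OF I0]) (use step in \<open>auto simp: I_def\<close>)
  show ?case
    unfolding compile_ex.simps cost_ex.simps poly_add poly_1 poly_mult poly_pCons poly_0 mult_0_right mult_1_right add_0_left
    apply (rule runs_Assign_Seq)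
    apply (rule runs_Assign_Seq)
    apply (rule runs_Assign_Seq)
    apply (rule runs_Seq[where R = "I ?N"])
     apply (use loop in simp)
    apply (rule runs_Assign)
    apply (auto simp: I_def)
    done
qed

definition reserved :: "string set" where
  "reserved = {''_r'', ''_i'', ''_t'', ''_c''}"

text \<open>\<open>N\<close> must not be written, because compiled loops read their bound anew at
  every test.\<close>

definition well_formed :: "st \<Rightarrow> bool" where
  "well_formed p \<longleftrightarrow> reads p \<inter> reserved = {} \<and> writes p \<inter> insert ''N'' reserved = {}"

text \<open>Bound variables have to be zero between statements, since \<open>run\<close> evaluates
  an assignment in the environment \<open>(\<lambda>_. 0)(0 := i)\<close>.\<close>

definition simulates :: "store \<Rightarrow> store \<Rightarrow> bool" where
  "simulates s \<sigma> \<longleftrightarrow> s ''_i'' = (\<lambda>_. 0) \<and> (\<forall>a. a \<notin> reserved \<longrightarrow> s a = \<sigma> a)"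

text \<open>Loops within the statement count in the cells of \<open>_c\<close> from \<open>c\<close>
  on; preserving the cells below \<open>c\<close> protects the counters of the enclosing
  loops.\<close>

lemma runs_compile:
  assumes "well_formed p" "simulates s \<sigma>"
  shows "runs (compile p c) s (poly (cost p) (\<sigma> ''N'' 0))
    (\<lambda>s'. simulates s' (run p \<sigma>) \<and> (\<forall>j<c. s' ''_c'' j = s ''_c'' j))"
  using assms
proof (induction p arbitrary: c s \<sigma>)
  case (Asg a e)
  let ?N = "\<sigma> ''N'' 0"
  have wf: "arrays e \<inter> {''_r'', ''_i''} = {}" "''_t'' \<notin> arrays e" "''_c'' \<notin> arrays e" "a \<notin> insert ''N'' reserved"
    using Asg.prems by (auto simp: well_formed_def reserved_def)
  have sim: "s ''_i'' = (\<lambda>_. 0)" "\<And>x. x \<notin> reserved \<Longrightarrow> s x = \<sigma> x" using Asg.prems by (auto simp: simulates_def)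
  define v where "v i = ev e ((\<lambda>_. 0)(0 := i)) \<sigma>" for i
  \<comment> \<open>An assignment takes two passes since \<open>e\<close> may read the array
    \<open>a\<close> itself: pass \<open>I\<close> collects all new values in \<open>_t\<close>, and
    pass \<open>J\<close> copies them.\<close>
  define I where "I i s' \<longleftrightarrow> s' ''_i'' = (\<lambda>_. 0)(0 := i) \<and> (\<forall>j<i. s' ''_t'' j = v j) \<and> s' ''_c'' = s ''_c'' \<and>
     (\<forall>x. x \<notin> reserved \<longrightarrow> s' x = \<sigma> x)" for i and s' :: store
  define J where "J i s' \<longleftrightarrow> s' ''_i'' = (\<lambda>_. 0)(0 := i) \<and> (\<forall>j<?N. s' ''_t'' j = v j) \<and> s' ''_c'' = s ''_c'' \<and>
     s' a = (\<lambda>j. if j < i then v j else \<sigma> a j) \<and>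
     (\<forall>x. x \<notin> reserved \<and> x \<noteq> a \<longrightarrow> s' x = \<sigma> x)" for i and s' :: store
  have I0: "I 0 s" using sim by (auto simp: I_def)
  have N: "s' ''N'' = \<sigma> ''N''" if "I i s' \<or> J i s'" for s' i
  proof -
    have "''N'' \<notin> reserved" "''N'' \<noteq> a" using wf(4) by (auto simp: reserved_def)
    then show ?thesis using that unfolding I_def J_def by blast
  qed
  have Istep: "runs (Seq (compile_ex e 0)
       (Seq (Assign ''_t'' (Read ''_i'' (Lit 0)) (Read ''_r'' (Lit 0)))
            (Assign ''_i'' (Lit 0) (Add (Read ''_i'' (Lit 0)) (Lit 1))))) s' (poly (cost_ex e) ?N + (1 + 1)) (I (Suc i))"
    if "I i s'" for i s'
  proof (rule runs_Seq)
    have N': "s' ''N'' = \<sigma> ''N''" using N that by blast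
    from runs_compile_ex[OF wf(1), of 0 s']
    show "runs (compile_ex e 0) s' (poly (cost_ex e) ?N) (\<lambda>s1. s1 ''_r'' 0 = ev e (s' ''_i'') s' \<and>
      (\<forall>j<0. s1 ''_r'' j = s' ''_r'' j) \<and> (\<forall>a. a \<noteq> ''_r'' \<longrightarrow> s1 a = s' a))" by (simp only: N')
    fix s1 assume s1: "s1 ''_r'' 0 = ev e (s' ''_i'') s' \<and>
      (\<forall>j<0. s1 ''_r'' j = s' ''_r'' j) \<and> (\<forall>a. a \<noteq> ''_r'' \<longrightarrow> s1 a = s' a)"
    have "ev e ((\<lambda>_. 0)(0 := i)) s' = ev e ((\<lambda>_. 0)(0 := i)) \<sigma>"
      using that wf by (intro ev_cong_off[of _ reserved]) (auto simp: I_def reserved_def)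
    then have e1: "s1 ''_r'' 0 = v i" using s1 that by (auto simp: I_def v_def)
    show "runs (Seq (Assign ''_t'' (Read ''_i'' (Lit 0)) (Read ''_r'' (Lit 0)))
            (Assign ''_i'' (Lit 0) (Add (Read ''_i'' (Lit 0)) (Lit 1)))) s1 (1 + 1) (I (Suc i))"
      by (rule runs_Assign_Seq, rule runs_Assign)
        (use s1 that e1 in \<open>auto simp: I_def reserved_def less_Suc_eq\<close>)
  qed
  have Iloop: "runs (While (Sub (Read ''N'' (Lit 0)) (Read ''_i'' (Lit 0)))
       (Seq (compile_ex e 0)
       (Seq (Assign ''_t'' (Read ''_i'' (Lit 0)) (Read ''_r'' (Lit 0)))
            (Assign ''_i'' (Lit 0) (Add (Read ''_i'' (Lit 0)) (Lit 1)))))) s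
       (?N * (poly (cost_ex e) ?N + (1 + 1) + 1) + 1) (I ?N)"
  proof (rule runs_While[where I = I, OF I0], goal_cases)
    case (1 i s')
    then have "s' ''_i'' 0 = i" "s' ''N'' 0 = ?N" using N[of i s'] by (simp_all add: I_def)
    with 1 Istep[of i s'] show ?case by simp
  next
    case (2 s')
    then have "s' ''_i'' 0 = ?N" "s' ''N'' 0 = ?N" using N[of ?N s'] by (simp_all add: I_def)
    then show ?case by simp
  qed
  have Jstep: "runs (Seq (Assign a (Read ''_i'' (Lit 0)) (Read ''_t'' (Read ''_i'' (Lit 0))))
            (Assign ''_i'' (Lit 0) (Add (Read ''_i'' (Lit 0)) (Lit 1)))) s' (1 + 1) (J (Suc i))"
    if "J i s'" "i < ?N" for i s'
    by (rule runs_Assign_Seq, rule runs_Assign)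
      (use that wf(4) in \<open>auto simp: J_def reserved_def fun_eq_iff less_Suc_eq\<close>)
  have Jloop: "runs (While (Sub (Read ''N'' (Lit 0)) (Read ''_i'' (Lit 0)))
       (Seq (Assign a (Read ''_i'' (Lit 0)) (Read ''_t'' (Read ''_i'' (Lit 0))))
            (Assign ''_i'' (Lit 0) (Add (Read ''_i'' (Lit 0)) (Lit 1))))) s'
       (?N * (1 + 1 + 1) + 1) (J ?N)" if "J 0 s'" for s'
  proof (rule runs_While[where I = J, OF that], goal_cases)
    case (1 i s')
    then have "s' ''_i'' 0 = i" "s' ''N'' 0 = ?N" using N[of i s'] by (simp_all add: J_def)
    with 1 Jstep[of i s'] show ?case by simp
  next
    case (2 s')
    then have "s' ''_i'' 0 = ?N" "s' ''N'' 0 = ?N" using N[of ?N s'] by (simp_all add: J_def)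
    then show ?case by simp
  qed
  have Jfin: "simulates (s'(''_i'' := (s' ''_i'')(0 := 0))) (run (Asg a e) \<sigma>) \<and> s' ''_c'' = s ''_c''"
    if "J ?N s'" for s'
  proof -
    have i: "s' ''_i'' = (\<lambda>_. 0)(0 := ?N)" and c: "s' ''_c'' = s ''_c''"
      and a: "s' a = (\<lambda>j. if j < ?N then v j else \<sigma> a j)" and o: "\<And>x. x \<notin> reserved \<Longrightarrow> x \<noteq> a \<Longrightarrow> s' x = \<sigma> x"
      using that unfolding J_def by blast+
    have "(s'(''_i'' := (s' ''_i'')(0 := 0))) x = run (Asg a e) \<sigma> x" if "x \<notin> reserved" for x
    proof -
      have "x \<noteq> ''_i''" using that by (auto simp: reserved_def)
      then show ?thesis using a o[OF that] by (cases "x = a") (simp_all add: v_def cong: if_cong)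
    qed
    moreover have "(s'(''_i'' := (s' ''_i'')(0 := 0))) ''_i'' = (\<lambda>_. 0)" using i by auto
    ultimately show ?thesis using c unfolding simulates_def by blast
  qed
  have "runs (compile (Asg a e) c) s (?N * (poly (cost_ex e) ?N + (1 + 1) + 1) + 1 + (1 + ((?N * (1 + 1 + 1) + 1) + 1)))
     (\<lambda>s'. simulates s' (run (Asg a e) \<sigma>) \<and> (\<forall>j<c. s' ''_c'' j = s ''_c'' j))"
    unfolding compile.simps
  proof (rule runs_Seq[OF Iloop])
    fix s1 assume "I ?N s1"
    then have J0: "J 0 (s1(''_i'' := (s1 ''_i'')(0 := 0)))" using wf(4) by (auto simp: I_def J_def reserved_def)
    show "runs (Seq (Assign ''_i'' (Lit 0) (Lit 0))
       (Seq (While (Sub (Read ''N'' (Lit 0)) (Read ''_i'' (Lit 0)))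
         (Seq (Assign a (Read ''_i'' (Lit 0)) (Read ''_t'' (Read ''_i'' (Lit 0))))
            (Assign ''_i'' (Lit 0) (Add (Read ''_i'' (Lit 0)) (Lit 1)))))
         (Assign ''_i'' (Lit 0) (Lit 0)))) s1 (1 + ((?N * (1 + 1 + 1) + 1) + 1))
      (\<lambda>s'. simulates s' (run (Asg a e) \<sigma>) \<and> (\<forall>j<c. s' ''_c'' j = s ''_c'' j))"
      apply (rule runs_Assign_Seq)
      apply (rule runs_Seq[OF Jloop], use J0 in simp)
      apply (rule runs_Assign)
      apply (use Jfin in simp)
      done
  qed
  then show ?case by (rule runs_conseq) (simp_all del: run.simps)
next
  case (Sq p q)
  have wf: "well_formed p" "well_formed q" using Sq.prems by (auto simp: well_formed_def)
  have N: "run p \<sigma> ''N'' = \<sigma> ''N''" using wf run_frame by (auto simp: well_formed_def)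
  show ?case unfolding compile.simps cost.simps poly_add
  proof (rule runs_Seq[OF Sq.IH(1)[OF wf(1) Sq.prems(2)]])
    fix s1 assume s1: "simulates s1 (run p \<sigma>) \<and> (\<forall>j<c. s1 ''_c'' j = s ''_c'' j)"
    with Sq.IH(2)[OF wf(2), of s1 "run p \<sigma>" c] N
    show "runs (compile q c) s1 (poly (cost q) (\<sigma> ''N'' 0))
      (\<lambda>s'. simulates s' (run (Sq p q) \<sigma>) \<and> (\<forall>j<c. s' ''_c'' j = s ''_c'' j))"
      by (auto elim!: runs_conseq)
  qed
next
  case (It p)
  let ?N = "\<sigma> ''N'' 0"
  have wf: "well_formed p" using It.prems by (auto simp: well_formed_def)
  have N: "run p \<sigma> ''N'' = \<sigma> ''N''" for \<sigma> using wf run_frame by (auto simp: well_formed_def)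
  then have NN: "(run p ^^ k) \<sigma> ''N'' = \<sigma> ''N''" for k by (induction k) auto
  define I where "I i s' \<longleftrightarrow> simulates s' ((run p ^^ i) \<sigma>) \<and> (\<forall>j<c. s' ''_c'' j = s ''_c'' j) \<and> s' ''_c'' c = i"
    for i and s' :: store
  have step: "runs (Seq (compile p (c + 1)) (Assign ''_c'' (Lit c) (Add (Read ''_c'' (Lit c)) (Lit 1)))) s'
     (poly (cost p) ?N + 1) (I (Suc i))" if "I i s'" for i s'
  proof (rule runs_Seq)
    have "simulates s' ((run p ^^ i) \<sigma>)" using that by (simp add: I_def)
    from It.IH[OF wf this, of "c + 1"]
    show "runs (compile p (c + 1)) s' (poly (cost p) ?N) (\<lambda>s1. simulates s1 ((run p ^^ Suc i) \<sigma>) \<and>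
       (\<forall>j<c + 1. s1 ''_c'' j = s' ''_c'' j))" by (simp add: NN)
    fix s1 assume "simulates s1 ((run p ^^ Suc i) \<sigma>) \<and> (\<forall>j<c + 1. s1 ''_c'' j = s' ''_c'' j)"
    then show "runs (Assign ''_c'' (Lit c) (Add (Read ''_c'' (Lit c)) (Lit 1))) s1 1 (I (Suc i))"
      by (intro runs_Assign) (use that in \<open>auto simp: I_def simulates_def reserved_def\<close>)
  qed
  have I0: "I 0 (s(''_c'' := (s ''_c'')(c := 0)))"
    using It.prems(2) by (auto simp: I_def simulates_def reserved_def)
  have Ns: "s' ''N'' 0 = ?N" if "I i s'" for i s'
    using that NN by (auto simp: I_def simulates_def reserved_def)
  have loop: "runs (While (Sub (Read ''N'' (Lit 0)) (Read ''_c'' (Lit c)))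
           (Seq (compile p (c + 1)) (Assign ''_c'' (Lit c) (Add (Read ''_c'' (Lit c)) (Lit 1)))))
      (s(''_c'' := (s ''_c'')(c := 0))) (?N * (poly (cost p) ?N + 1 + 1) + 1) (I ?N)"
  proof (rule runs_While[where I = I, OF I0], goal_cases)
    case (1 i s')
    then have "s' ''_c'' c = i" "s' ''N'' 0 = ?N" using Ns[of i s'] by (simp_all add: I_def)
    with 1 step[of i s'] show ?case by simp
  next
    case (2 s')
    then have "s' ''_c'' c = ?N" "s' ''N'' 0 = ?N" using Ns[of ?N s'] by (simp_all add: I_def)
    then show ?case by simp
  qed
  have "runs (compile (It p) c) s (1 + (?N * (poly (cost p) ?N + 1 + 1) + 1))
      (\<lambda>s'. simulates s' (run (It p) \<sigma>) \<and> (\<forall>j<c. s' ''_c'' j = s ''_c'' j))"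
    unfolding compile.simps
    apply (rule runs_Assign_Seq)
    apply (rule runs_conseq[where R = "I ?N"])
      apply (use loop in simp)
     apply (auto simp: I_def)
    done
  then show ?case by (rule runs_conseq) (simp_all del: run.simps)
qed

lemma poly_nat_mono: "x \<le> y \<Longrightarrow> poly p x \<le> poly p (y :: nat)"
  by (induction p) (auto intro!: add_mono mult_mono)

section \<open>Expressions and the input\<close>

declare run.simps [simp del] ev.simps(6) [simp del]

text \<open>Tests are rewritten to formulas, so that the value of a sum that only serves as a
  quantifier never has to be computed.\<close>

definition holds :: "ex \<Rightarrow> (nat \<Rightarrow> nat) \<Rightarrow> store \<Rightarrow> bool" where
  "holds e \<rho> s \<longleftrightarrow> ev e \<rho> s \<noteq> 0"

lemma ev_If [simp]: "ev (If c a b) \<rho> s = (if holds c \<rho> s then ev a \<rho> s else ev b \<rho> s)"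
  by (simp add: holds_def ev.simps(6))

lemma holds_simps [simp]:
  "holds (Cn k) \<rho> s \<longleftrightarrow> k \<noteq> 0"
  "holds (Ar arr e) \<rho> s \<longleftrightarrow> s arr (ev e \<rho> s) \<noteq> 0"
  "holds (Mi a b) \<rho> s \<longleftrightarrow> ev b \<rho> s < ev a \<rho> s"
  "holds (If c a b) \<rho> s \<longleftrightarrow> (if holds c \<rho> s then holds a \<rho> s else holds b \<rho> s)"
  "holds (Sm x e) \<rho> s \<longleftrightarrow> (\<exists>i<s ''N'' 0. holds e (\<rho>(x := i)) s)"
  by (auto simp: holds_def)

definition "Neg e = If e (Cn 0) (Cn 1)"
definition "And a b = If a b (Cn 0)"
definition "Or a b = If a (Cn 1) b"
abbreviation "Lt a b \<equiv> Mi b a"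
abbreviation "At a x \<equiv> Ar a (Ix x)"
abbreviation "Sc a \<equiv> Ar a (Cn 0)"

definition "Eq a b = Neg (Pl (Mi a b) (Mi b a))"
definition "Cnt x e = Sm x (If e (Cn 1) (Cn 0))"
definition "Mu x y e = Sm x (Neg (Sm y (And (Neg (Lt (Ix x) (Ix y))) e)))"
text \<open>Repeated addition, as the machine has no multiplication; correct if the first factor is
  at most \<open>N\<close>. The variables 8 and 9 are set aside for \<open>Mul\<close> and
  \<open>Adj\<close>.\<close>

definition "Mul a b = Sm 8 (If (Lt (Ix 8) a) b (Cn 0))"
definition "Adj x y = Sm 9 (And (Lt (Ix 9) (Sc ''m''))
   (Or (And (Eq (At ''u'' 9) (Ix x)) (Eq (At ''v'' 9) (Ix y)))
       (And (Eq (At ''u'' 9) (Ix y)) (Eq (At ''v'' 9) (Ix x)))))"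

lemma arrays_derived [simp]:
  "arrays (Neg a) = arrays a"
  "arrays (And a b) = arrays a \<union> arrays b"
  "arrays (Or a b) = arrays a \<union> arrays b"
  "arrays (Eq a b) = arrays a \<union> arrays b"
  "arrays (Cnt x e) = arrays e"
  "arrays (Mu x y e) = arrays e"
  "arrays (Mul a b) = arrays a \<union> arrays b"
  "arrays (Adj x y) = {''m'', ''u'', ''v''}"
  by (auto simp: Eq_def Cnt_def Mu_def Mul_def Adj_def Neg_def And_def Or_def)

lemma holds_connectives [simp]:
  "holds (Neg a) \<rho> s \<longleftrightarrow> \<not> holds a \<rho> s"
  "holds (And a b) \<rho> s \<longleftrightarrow> holds a \<rho> s \<and> holds b \<rho> s"
  "holds (Or a b) \<rho> s \<longleftrightarrow> holds a \<rho> s \<or> holds b \<rho> s"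
  by (simp_all add: Neg_def And_def Or_def)

lemma holds_Eq [simp]: "holds (Eq a b) \<rho> s \<longleftrightarrow> ev a \<rho> s = ev b \<rho> s"
  by (auto simp: Eq_def Neg_def holds_def)

lemma sum_if_eq_card: "(\<Sum>i<(m::nat). if Q i then y else 0) = card {i. i < m \<and> Q i} * (y :: nat)"
proof -
  have "{..<m} \<inter> {i. Q i} = {i. i < m \<and> Q i}" by auto
  then show ?thesis by (simp add: sum.If_cases)
qed

lemma ev_Cnt [simp]: "ev (Cnt x e) \<rho> s = card {i. i < s ''N'' 0 \<and> holds e (\<rho>(x := i)) s}"
  using sum_if_eq_card[where y = 1] by (simp add: Cnt_def cong: if_cong)

text \<open>The least \<open>y\<close> satisfying \<open>P\<close> is the number of those \<open>x\<close> such that no \<open>y \<le> x\<close> satisfies \<open>P\<close>.\<close>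

lemma ev_Mu:
  assumes xy: "x \<noteq> y" and P: "\<And>i j. holds e (\<rho>(x := j, y := i)) s \<longleftrightarrow> P i"
  shows "ev (Mu x y e) \<rho> s = (if \<exists>i<s ''N'' 0. P i then LEAST i. P i else s ''N'' 0)"
proof -
  let ?N = "s ''N'' 0"
  have "ev (Mu x y e) \<rho> s = (\<Sum>j<?N. if \<not> (\<exists>i<?N. i \<le> j \<and> P i) then 1 else 0)"
    unfolding Mu_def Neg_def[of "Sm y _"] using xy by (auto simp: P not_less cong: if_cong intro!: sum.cong)
  also have "\<dots> = card {j. j < ?N \<and> \<not> (\<exists>i<?N. i \<le> j \<and> P i)}"
    unfolding sum_if_eq_card by simp
  also have "\<dots> = (if \<exists>i<?N. P i then LEAST i. P i else ?N)"
  proof (cases "\<exists>i<?N. P i")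
    case True
    then obtain i where i: "i < ?N" "P i" by blast
    let ?l = "LEAST i. P i"
    have l: "P ?l" "?l \<le> i" using i by (auto intro: LeastI Least_le)
    have "{j. j < ?N \<and> \<not> (\<exists>i<?N. i \<le> j \<and> P i)} = {..<?l}"
    proof (intro set_eqI iffI)
      fix j assume "j \<in> {j. j < ?N \<and> \<not> (\<exists>i<?N. i \<le> j \<and> P i)}"
      then have "\<not> ?l \<le> j" using l i by auto
      then show "j \<in> {..<?l}" by simp
    next
      fix j assume "j \<in> {..<?l}"
      then have j: "j < ?l" by simp
      have "\<not> P i'" if "i' \<le> j" for i' using not_less_Least[of i' P] that j by simp
      then show "j \<in> {j. j < ?N \<and> \<not> (\<exists>i<?N. i \<le> j \<and> P i)}" using j l i by auto
    qed
    then show ?thesis using True by simp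
  next
    case False
    then have "{j. j < ?N \<and> \<not> (\<exists>i<?N. i \<le> j \<and> P i)} = {..<?N}" by auto
    then show ?thesis unfolding if_not_P[OF False] by simp
  qed
  finally show ?thesis .
qed

lemma ev_Mul:
  assumes "\<And>i. ev a (\<rho>(8 := i)) s = x" "\<And>i. ev b (\<rho>(8 := i)) s = y" "x \<le> s ''N'' 0"
  shows "ev (Mul a b) \<rho> s = x * y"
proof -
  have "ev (Mul a b) \<rho> s = (\<Sum>i<s ''N'' 0. if i < x then y else 0)"
    by (simp add: Mul_def assms cong: if_cong)
  also have "\<dots> = card {i. i < s ''N'' 0 \<and> i < x} * y" by (rule sum_if_eq_card)
  also have "{i. i < s ''N'' 0 \<and> i < x} = {..<x}" using assms(3) by auto
  finally show ?thesis by simp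
qed

text \<open>Lets a loop of fixed length be treated like one with the stopping condition
  \<open>D\<close>. The measure falls as long as \<open>D\<close> fails, so \<open>T\<close> rounds
  suffice, and the rounds left over preserve \<open>D\<close>.\<close>

lemma iterate_until:
  fixes \<mu> :: "'s \<Rightarrow> nat"
  assumes "I s" and step: "\<And>s. I s \<Longrightarrow> I (f s)"
    and dec: "\<And>s. I s \<Longrightarrow> \<not> D s \<Longrightarrow> \<mu> (f s) < \<mu> s"
    and stay: "\<And>s. I s \<Longrightarrow> D s \<Longrightarrow> D (f s)"
    and "\<mu> s \<le> T"
  shows "I ((f ^^ T) s) \<and> D ((f ^^ T) s)"
proof -
  have "I ((f ^^ t) s) \<and> (D ((f ^^ t) s) \<or> \<mu> ((f ^^ t) s) + t \<le> \<mu> s)" for t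
  proof (induction t)
    case (Suc t)
    then show ?case using step[of "(f ^^ t) s"] dec[of "(f ^^ t) s"] stay[of "(f ^^ t) s"] by force
  qed (use assms in simp)
  from this[of T] show ?thesis using assms(5) dec[of "(f ^^ T) s"] by force
qed

text \<open>Names for families of arrays indexed by labels. The unary suffix lets simplification
  decide equality of names, also against literal ones.\<close>

definition nm :: "char \<Rightarrow> nat \<Rightarrow> string" where
  "nm c i = c # replicate i CHR ''x''"

lemma nm_eq [simp]: "nm c i = nm d j \<longleftrightarrow> c = d \<and> i = j"
  unfolding nm_def by (metis length_replicate list.inject)

lemma nm_Cons [simp]: "nm c i = d # ds \<longleftrightarrow> c = d \<and> replicate i CHR ''x'' = ds"
  "d # ds = nm c i \<longleftrightarrow> d = c \<and> ds = replicate i CHR ''x''"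
  unfolding nm_def by auto

locale input =
  fixes n :: nat and es :: "(nat \<times> nat) list"
  assumes input: "graph_input n es"
begin

text \<open>One index range for all arrays: it exceeds the vertices and the edge numbers, contains
  cell \<open>0\<close>, and leaves room for the times in a ball, which are at most
  \<open>n + 2\<close>. Additions suffice to compute it.\<close>

definition N :: nat where "N = n + 2 * length es + 6"

definition G :: "(nat \<times> nat) set" where "G = edge_rel (edges_of es)"

lemma edge_range: "i < length es \<Longrightarrow> fst (es ! i) < n \<and> snd (es ! i) < n \<and> fst (es ! i) \<noteq> snd (es ! i)"
  using input nth_mem[of i es] unfolding graph_input_def by fastforce

lemma G_iff: "(x, y) \<in> G \<longleftrightarrow> (\<exists>i<length es. (fst (es ! i) = x \<and> snd (es ! i) = y) \<or> (fst (es ! i) = y \<and> snd (es ! i) = x))"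
  (is "?L \<longleftrightarrow> ?R")
proof
  assume ?L
  then have "{x, y} \<in> edges_of es" by (simp add: G_def edge_rel_def)
  then obtain i where "i < length es" "{x, y} = endpoints (es ! i)"
    unfolding edges_of_def by (auto simp: in_set_conv_nth)
  then show ?R unfolding endpoints_def by (auto simp: doubleton_eq_iff)
next
  assume ?R
  then obtain i where i: "i < length es" "(fst (es ! i) = x \<and> snd (es ! i) = y) \<or> (fst (es ! i) = y \<and> snd (es ! i) = x)"
    by blast
  then have "{x, y} = endpoints (es ! i)" by (auto simp: endpoints_def)
  moreover have "endpoints (es ! i) \<in> edges_of es" using i by (simp add: edges_of_def)
  ultimately show ?L using i edge_range[OF i(1)] by (auto simp: G_def edge_rel_def)
qed

lemma symG: "sym G"
  unfolding G_def by (rule sym_edge_rel)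

lemma G_sym: "(x, y) \<in> G \<Longrightarrow> (y, x) \<in> G"
  using symG by (rule symD)

lemma G_range: "(x, y) \<in> G \<Longrightarrow> x < n \<and> y < n"
  using edge_range by (auto simp: G_iff)

lemma N_bounds: "n < N" "length es < N" "5 < N"
  by (simp_all add: N_def)

definition ok :: "store \<Rightarrow> bool" where
  "ok s \<longleftrightarrow> s ''n'' 0 = n \<and> s ''m'' 0 = length es \<and> s ''N'' 0 = N \<and>
     (\<forall>i<length es. s ''u'' i = fst (es ! i) \<and> s ''v'' i = snd (es ! i))"

lemma ok_simps [simp]: "ok s \<Longrightarrow> s ''n'' 0 = n" "ok s \<Longrightarrow> s ''N'' 0 = N" "ok s \<Longrightarrow> s ''m'' 0 = length es"
  by (auto simp: ok_def)

lemma ok_edges [simp]: "ok s \<Longrightarrow> i < length es \<Longrightarrow> s ''u'' i = fst (es ! i)"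
  "ok s \<Longrightarrow> i < length es \<Longrightarrow> s ''v'' i = snd (es ! i)"
  unfolding ok_def by simp_all

lemma ok_run: "ok s \<Longrightarrow> writes p \<inter> {''n'', ''m'', ''N'', ''u'', ''v''} = {} \<Longrightarrow> ok (run p s)"
proof -
  assume s: "ok s" and w: "writes p \<inter> {''n'', ''m'', ''N'', ''u'', ''v''} = {}"
  have "run p s a = s a" if "a \<in> {''n'', ''m'', ''N'', ''u'', ''v''}" for a
    using w that by (intro run_frame) blast
  then show "ok (run p s)" using s unfolding ok_def by simp
qed

lemma holds_Adj [simp]:
  assumes "ok s" "x \<noteq> 9" "y \<noteq> 9"
  shows "holds (Adj x y) \<rho> s \<longleftrightarrow> (\<rho> x, \<rho> y) \<in> G"
proof -
  have "holds (Adj x y) \<rho> s \<longleftrightarrow> (\<exists>i<N. i < length es \<and>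
      (s ''u'' i = \<rho> x \<and> s ''v'' i = \<rho> y \<or> s ''u'' i = \<rho> y \<and> s ''v'' i = \<rho> x))"
    using assms by (simp add: Adj_def)
  also have "\<dots> \<longleftrightarrow> (\<exists>i<length es. fst (es ! i) = \<rho> x \<and> snd (es ! i) = \<rho> y \<or> fst (es ! i) = \<rho> y \<and> snd (es ! i) = \<rho> x)"
  proof (rule ex_cong1)
    fix i
    show "(i < N \<and> i < length es \<and> (s ''u'' i = \<rho> x \<and> s ''v'' i = \<rho> y \<or> s ''u'' i = \<rho> y \<and> s ''v'' i = \<rho> x)) =
      (i < length es \<and> (fst (es ! i) = \<rho> x \<and> snd (es ! i) = \<rho> y \<or> fst (es ! i) = \<rho> y \<and> snd (es ! i) = \<rho> x))"
      using assms(1) N_bounds(2) by (cases "i < length es") simp_all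
  qed
  finally show ?thesis unfolding G_iff .
qed

definition flagged :: "store \<Rightarrow> string \<Rightarrow> nat set" where
  "flagged s a = {i. i < N \<and> s a i \<noteq> 0}"

lemma finite_flagged [simp]: "finite (flagged s a)"
  by (simp add: flagged_def)

lemma run_Asg: "ok s \<Longrightarrow> i < N \<Longrightarrow> run (Asg a e) s a i = ev e ((\<lambda>_. 0)(0 := i)) s"
  by (simp add: run.simps)

lemma flagged_Asg: "ok s \<Longrightarrow> flagged (run (Asg a e) s) a = {i. i < N \<and> holds e ((\<lambda>_. 0)(0 := i)) s}"
  by (auto simp: flagged_def run.simps holds_def)

lemma flagged_frame: "a \<notin> writes p \<Longrightarrow> flagged (run p s) a = flagged s a"
  by (simp add: flagged_def run_frame)

lemma run_It: "ok s \<Longrightarrow> run (It p) s = (run p ^^ N) s"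
  by (simp add: run.simps)

lemma run_It_It:
  assumes "ok s" "writes p \<inter> {''n'', ''m'', ''N'', ''u'', ''v''} = {}"
  shows "run (It (It p)) s = (run p ^^ (N * N)) s"
proof -
  have "(run (It p) ^^ k) s = (run p ^^ (k * N)) s \<and> ok ((run (It p) ^^ k) s)" for k
  proof (induction k)
    case (Suc k)
    then show ?case using run_It[of "(run (It p) ^^ k) s" p] ok_run[of "(run (It p) ^^ k) s" "It p"] assms(2)
      by (auto simp: funpow_add)
  qed (use assms in simp)
  then show ?thesis using run_It[OF assms(1), of "It p"] by simp
qed

end

section \<open>The program\<close>

text \<open>One round of label propagation. The minimum runs over the vertex itself too, so labels
  never rise.\<close>

definition relaxE :: ex where
  "relaxE = Mu 1 2 (Sm 3 (And (At ''R'' 3) (And (Or (Eq (Ix 3) (Ix 0)) (Adj 3 0)) (Eq (At ''r'' 3) (Ix 2)))))"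

text \<open>The number of rounds, \<open>N * N\<close>, fits a simple measure of progress: the sum
  of all labels, at most \<open>n * n\<close> at the start.\<close>

definition componentsP :: st where
  "componentsP = Sq (Asg ''r'' (Ix 0)) (It (It (Asg ''r'' relaxE)))"

definition layerE :: "nat \<Rightarrow> ex" where
  "layerE i = And (At ''B'' 0) (And (Neg (At (nm CHR ''e'' i) 0)) (Sm 1 (And (At (nm CHR ''e'' i) 1) (Adj 1 0))))"

text \<open>Comparing \<open>k\<close> with a square avoids the root: a layer is absorbed if it has
  more than \<open>sqrt k\<close> vertices. At a thin layer nothing changes any more, so surplus
  rounds are harmless.\<close>

definition growP :: "nat \<Rightarrow> st" where
  "growP i = Sq (Asg ''L'' (layerE i)) (Sq (Asg ''c'' (Cnt 1 (At ''L'' 1)))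
     (Asg (nm CHR ''e'' i) (If (And (At ''L'' 0) (Lt (Sc ''k'') (Mul (Sc ''c'') (Sc ''c''))))
        (Pl (Cn 1) (Ar (nm CHR ''e'' i) (Mu 1 2 (And (At (nm CHR ''e'' i) 2) (Adj 2 0)))))
        (At (nm CHR ''e'' i) 0))))"

text \<open>The count \<open>a\<close>, like every scalar, is written to all cells and read from
  cell \<open>0\<close>; it vanishes exactly for a label without contacts. The array
  \<open>z\<close> keeps the boundary at which the growth stopped.\<close>

definition ballP :: "nat \<Rightarrow> st" where
  "ballP i = Sq (Asg (nm CHR ''e'' i) (If (And (At ''B'' 0) (Sm 1 (And (Eq (At ''l'' 1) (Cn i)) (Adj 1 0)))) (Cn 1) (Cn 0)))
     (Sq (Asg (nm CHR ''a'' i) (Cnt 1 (At (nm CHR ''e'' i) 1)))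
     (Sq (It (growP i)) (Asg (nm CHR ''z'' i) (layerE i))))"

text \<open>A parallel assignment can only pull values into a cell. So each vertex asks whether it
  is the parent of a flagged vertex, the parent being the least neighbour whose time is smaller by
  one.\<close>

definition pathP :: "nat \<Rightarrow> st" where
  "pathP i = Sq (Asg (nm CHR ''t'' i) (Eq (Ix 0) (Sc ''g'')))
     (It (Asg (nm CHR ''t'' i) (Or (At (nm CHR ''t'' i) 0) (Sm 1 (And (At (nm CHR ''t'' i) 1)
        (And (Lt (Cn 1) (At (nm CHR ''e'' i) 1))
          (Eq (Ix 0) (Mu 2 3 (And (Adj 3 1) (Eq (Pl (At (nm CHR ''e'' i) 3) (Cn 1)) (At (nm CHR ''e'' i) 1)))))))))))"

lemma writes_pieces [simp]:
  "writes componentsP = {''r''}"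
  "writes (growP i) = {''L'', ''c'', nm CHR ''e'' i}"
  "writes (ballP i) = {''L'', ''c'', nm CHR ''e'' i, nm CHR ''a'' i, nm CHR ''z'' i}"
  "writes (pathP i) = {nm CHR ''t'' i}"
  by (auto simp: componentsP_def growP_def ballP_def pathP_def)

lemma reads_pieces [simp]:
  "reads componentsP = {''R'', ''r'', ''m'', ''u'', ''v''}"
  "reads (ballP i) = {''B'', ''l'', ''L'', ''c'', ''k'', nm CHR ''e'' i, ''m'', ''u'', ''v''}"
  "reads (pathP i) = {''g'', nm CHR ''t'' i, nm CHR ''e'' i, ''m'', ''u'', ''v''}"
  by (auto simp: componentsP_def relaxE_def growP_def layerE_def ballP_def pathP_def)

section \<open>Correctness of label propagation, ball growth and path tracing\<close>

context input
begin

text \<open>Makes an array a function on all numbers, with \<open>0\<close> from \<open>N\<close>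
  on; labels and times become functions in the sense of the graph lemmas.\<close>

definition cell :: "store \<Rightarrow> string \<Rightarrow> nat \<Rightarrow> nat" where
  "cell s a v = (if v < N then s a v else 0)"

lemma flagged_iff: "v \<in> flagged s a \<longleftrightarrow> v < N \<and> s a v \<noteq> 0"
  by (simp add: flagged_def)

lemma flagged_cell: "v \<in> flagged s a \<longleftrightarrow> cell s a v \<noteq> 0"
  by (simp add: flagged_def cell_def)

lemma cell_frame: "a \<notin> writes p \<Longrightarrow> cell (run p s) a = cell s a"
  by (simp add: cell_def run_frame fun_eq_iff)

lemma ev_relaxE:
  assumes s: "ok s" and v: "v \<in> flagged s ''R''" and r: "s ''r'' v < N"
  shows "ev relaxE ((\<lambda>_. 0)(0 := v)) s = (LEAST x. \<exists>w\<in>flagged s ''R''. (w = v \<or> (w, v) \<in> G) \<and> s ''r'' w = x)"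
proof -
  let ?P = "\<lambda>x. \<exists>w\<in>flagged s ''R''. (w = v \<or> (w, v) \<in> G) \<and> s ''r'' w = x"
  have "ev relaxE ((\<lambda>_. 0)(0 := v)) s = (if \<exists>i<s ''N'' 0. ?P i then LEAST i. ?P i else s ''N'' 0)"
    unfolding relaxE_def by (rule ev_Mu) (use s in \<open>auto simp: flagged_iff\<close>)
  moreover have "\<exists>i<s ''N'' 0. ?P i" using s v r by auto
  ultimately show ?thesis by simp
qed

text \<open>A label is always a vertex in the component of its bearer, and in the end labels agree
  along edges. Equal labels then show that two components share a vertex.\<close>

lemma componentsP_spec:
  assumes s: "ok s" and R: "flagged s ''R'' = R" "R \<subseteq> {..<n}" and vw: "v \<in> R" "w \<in> R"
  shows "run componentsP s ''r'' v = run componentsP s ''r'' w \<longleftrightarrow> w \<in> component G R v"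
proof -
  let ?f = "run (Asg ''r'' relaxE)"
  define I where "I s1 \<longleftrightarrow> ok s1 \<and> flagged s1 ''R'' = R \<and> (\<forall>v\<in>R. s1 ''r'' v \<in> component G R v)" for s1
  define D where "D s1 \<longleftrightarrow> (\<forall>v\<in>R. \<forall>w\<in>R. (w, v) \<in> G \<longrightarrow> s1 ''r'' v = s1 ''r'' w)" for s1 :: store
  define \<mu> where "\<mu> s1 = (\<Sum>v\<in>R. s1 ''r'' v)" for s1 :: store
  define s0 where "s0 = run (Asg ''r'' (Ix 0)) s"
  have finR: "finite R" using R(1) finite_flagged by metis
  have RN: "v < N" if "v \<in> R" for v using that R(2) N_bounds(1) by auto
  have ok0: "ok s0" unfolding s0_def by (rule ok_run[OF s]) simp
  have s0: "s0 ''r'' v = v" if "v \<in> R" for v using run_Asg[OF s RN[OF that]] by (simp add: s0_def)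
  have "flagged s0 ''R'' = R" unfolding s0_def by (subst flagged_frame) (use R in auto)
  then have I0: "I s0" using ok0 s0 by (simp add: I_def component_self)
  have new: "?f s1 ''r'' v = (LEAST x. \<exists>w\<in>R. (w = v \<or> (w, v) \<in> G) \<and> s1 ''r'' w = x)"
    if "I s1" "v \<in> R" for s1 v
  proof -
    have s1: "ok s1" "flagged s1 ''R'' = R" "s1 ''r'' v \<in> component G R v" using that by (auto simp: I_def)
    have "s1 ''r'' v \<in> R" using s1(3) component_subset[OF that(2)] by blast
    then show ?thesis
      using run_Asg[OF s1(1) RN[OF that(2)], of "''r''" relaxE] ev_relaxE[OF s1(1), of v] s1(2) that(2) RN by simp
  qed
  have new_ex: "\<exists>w\<in>R. (w = v \<or> (w, v) \<in> G) \<and> s1 ''r'' w = ?f s1 ''r'' v" if "I s1" "v \<in> R" for s1 v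
    unfolding new[OF that] by (rule LeastI[where k = "s1 ''r'' v"]) (use that in blast)
  have new_le: "?f s1 ''r'' v \<le> s1 ''r'' w" if "I s1" "v \<in> R" "w \<in> R" "w = v \<or> (w, v) \<in> G" for s1 v w
    unfolding new[OF that(1,2)] by (rule Least_le) (use that in blast)
  have "I ((?f ^^ (N * N)) s0) \<and> D ((?f ^^ (N * N)) s0)"
  proof (rule iterate_until[where \<mu> = \<mu>])
    show "I s0" by (rule I0)
  next
    fix s1 assume i: "I s1"
    then have "ok (?f s1)" by (intro ok_run) (simp_all add: I_def)
    moreover have "flagged (?f s1) ''R'' = R" using i by (subst flagged_frame) (simp_all add: I_def)
    moreover have "?f s1 ''r'' v \<in> component G R v" if v: "v \<in> R" for v
    proof -
      obtain w where w: "w \<in> R" "w = v \<or> (w, v) \<in> G" "s1 ''r'' w = ?f s1 ''r'' v" using new_ex[OF i v] by blast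
      have "w \<in> component G R v"
      proof (cases "w = v")
        case False
        then show ?thesis using component_step[OF component_self v w(1) G_sym] w(2) by simp
      qed (simp add: component_self)
      then have ceq: "component G R w = component G R v" by (rule component_eq[OF symG])
      have "s1 ''r'' w \<in> component G R w" using i w(1) by (simp add: I_def)
      then show ?thesis unfolding w(3) ceq .
    qed
    ultimately show "I (?f s1)" by (simp add: I_def)
  next
    fix s1 assume i: "I s1" and "\<not> D s1"
    then obtain v w where vw: "v \<in> R" "w \<in> R" "(w, v) \<in> G" "s1 ''r'' v \<noteq> s1 ''r'' w" unfolding D_def by blast
    \<comment> \<open>On an edge whose ends differ, the end with the larger label drops.\<close>
    have "\<exists>v\<in>R. ?f s1 ''r'' v < s1 ''r'' v"
    proof (cases "s1 ''r'' w < s1 ''r'' v")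
      case True
      then show ?thesis using new_le[OF i vw(1,2)] vw(1,3) by (intro bexI[of _ v]) auto
    next
      case False
      then show ?thesis using new_le[OF i vw(2,1)] vw(2,4) G_sym[OF vw(3)] by (intro bexI[of _ w]) auto
    qed
    then show "\<mu> (?f s1) < \<mu> s1"
      unfolding \<mu>_def using new_le[OF i] finR by (intro sum_strict_mono_ex1) auto
  next
    fix s1 assume i: "I s1" and d: "D s1"
    have "?f s1 ''r'' v = s1 ''r'' v" if "v \<in> R" for v
      using new_ex[OF i that] d that unfolding D_def by metis
    then show "D (?f s1)" using d by (simp add: D_def)
  next
    have "\<mu> s0 = (\<Sum>v\<in>R. v)" unfolding \<mu>_def by (rule sum.cong) (use s0 in auto)
    also have "\<dots> \<le> (\<Sum>v\<in>R. n)" by (rule sum_mono) (use R(2) in auto)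
    also have "\<dots> = card R * n" by simp
    also have "\<dots> \<le> N * N"
      using card_mono[OF finite_lessThan R(2)] N_bounds(1) by (intro mult_le_mono) auto
    finally show "\<mu> s0 \<le> N * N" .
  qed
  moreover have "run componentsP s = (?f ^^ (N * N)) s0"
    unfolding componentsP_def run.simps(2) s0_def[symmetric] by (rule run_It_It[OF ok0]) simp
  ultimately have fin: "I (run componentsP s)" "D (run componentsP s)" by simp_all
  let ?r = "run componentsP s ''r''"
  have const: "component G R x \<subseteq> {y. ?r y = ?r x}" if "x \<in> R" for x
  proof (rule component_least)
    fix a b assume ab: "a \<in> {y. ?r y = ?r x}" "a \<in> R" "b \<in> R" "(a, b) \<in> G"
    have "?r b = ?r a" using fin(2)[unfolded D_def, rule_format, OF ab(3,2,4)] .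
    then show "b \<in> {y. ?r y = ?r x}" using ab(1) by simp
  qed simp
  show ?thesis
  proof
    assume "?r v = ?r w"
    then have "?r v \<in> component G R v" "?r v \<in> component G R w" using fin(1) vw by (auto simp: I_def)
    then have "component G R v = component G R w" using component_eq[OF symG] by metis
    then show "w \<in> component G R v" using component_self[of w G R] by simp
  next
    assume "w \<in> component G R v"
    then show "?r v = ?r w" using const[OF vw(1)] by auto
  qed
qed

text \<open>\<open>e v - 1\<close> is the number of the growth step in which \<open>v\<close> joined the ball around \<open>A\<close>.\<close>

definition ball_times :: "nat set \<Rightarrow> nat set \<Rightarrow> (nat \<Rightarrow> nat) \<Rightarrow> bool" where
  "ball_times B A e \<longleftrightarrow> (\<forall>v. e v > 0 \<longrightarrow> v \<in> B) \<and> (\<forall>v. e v = 1 \<longleftrightarrow> v \<in> A) \<and>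
     (\<forall>v. e v > 1 \<longrightarrow> (\<exists>w. (w, v) \<in> G \<and> e w + 1 = e v))"

lemma ball_layer_flagged:
  assumes s: "ok s"
  shows "flagged (run (Asg a (layerE i)) s) a = ball_layer G (flagged s ''B'') (flagged s (nm CHR ''e'' i))"
  unfolding flagged_Asg[OF s] layerE_def ball_layer_def using s by (auto simp: flagged_iff)

lemma growP_spec:
  assumes s: "ok s" and i: "i > 0" and B: "flagged s ''B'' \<subseteq> {..<n}"
  defines "U \<equiv> flagged s (nm CHR ''e'' i)" and "e \<equiv> cell s (nm CHR ''e'' i)"
  defines "Ly \<equiv> ball_layer G (flagged s ''B'') U"
  shows "cell (run (growP i) s) (nm CHR ''e'' i) =
    (\<lambda>v. if v \<in> Ly \<and> s ''k'' 0 < card Ly * card Ly then 1 + e (LEAST w. w \<in> U \<and> (w, v) \<in> G) else e v)"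
proof -
  let ?e = "nm CHR ''e'' i"
  define s1 where "s1 = run (Asg ''L'' (layerE i)) s"
  define s2 where "s2 = run (Asg ''c'' (Cnt 1 (At ''L'' 1))) s1"
  have ok1: "ok s1" unfolding s1_def by (rule ok_run[OF s]) simp
  have ok2: "ok s2" unfolding s2_def by (rule ok_run[OF ok1]) simp
  have L1: "flagged s1 ''L'' = Ly" unfolding s1_def Ly_def U_def by (rule ball_layer_flagged[OF s])
  have L2: "flagged s2 ''L'' = Ly" unfolding s2_def by (subst flagged_frame) (simp_all add: L1)
  have c2: "s2 ''c'' 0 = card Ly"
  proof -
    have "s2 ''c'' 0 = card {j. j < N \<and> s1 ''L'' j \<noteq> 0}"
      unfolding s2_def using run_Asg[OF ok1, of 0] ok1 N_bounds by simp
    also have "{j. j < N \<and> s1 ''L'' j \<noteq> 0} = Ly" using L1 by (simp add: flagged_def)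
    finally show ?thesis .
  qed
  have e2: "s2 ?e = s ?e" and k2: "s2 ''k'' = s ''k''"
    unfolding s2_def s1_def by (simp_all add: run_frame)
  have "card Ly \<le> card {..<n}" unfolding Ly_def ball_layer_def using B by (intro card_mono) auto
  then have cN: "card Ly \<le> N" using N_bounds(1) by simp
  show ?thesis
  proof
    fix v
    show "cell (run (growP i) s) ?e v =
      (if v \<in> Ly \<and> s ''k'' 0 < card Ly * card Ly then 1 + e (LEAST w. w \<in> U \<and> (w, v) \<in> G) else e v)"
    proof (cases "v < N")
      case False
      then show ?thesis by (auto simp: cell_def e_def Ly_def ball_layer_def flagged_iff)
    next
      case True
      let ?\<rho> = "(\<lambda>_. 0)(0 := v)"
      have m: "ev (Mul (Sc ''c'') (Sc ''c'')) ?\<rho> s2 = card Ly * card Ly"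
        by (rule ev_Mul) (use c2 cN ok2 in simp_all)
      have mu: "ev (Mu 1 2 (And (At ?e 2) (Adj 2 0))) ?\<rho> s2 = (LEAST w. w \<in> U \<and> (w, v) \<in> G)" if "v \<in> Ly"
      proof -
        have "ev (Mu 1 2 (And (At ?e 2) (Adj 2 0))) ?\<rho> s2 =
          (if \<exists>w<s2 ''N'' 0. s ?e w \<noteq> 0 \<and> (w, v) \<in> G then LEAST w. s ?e w \<noteq> 0 \<and> (w, v) \<in> G else s2 ''N'' 0)"
          by (rule ev_Mu) (use ok2 e2 in simp_all)
        moreover have "\<exists>w<s2 ''N'' 0. s ?e w \<noteq> 0 \<and> (w, v) \<in> G"
          using that ok2 by (auto simp: Ly_def ball_layer_def U_def flagged_iff)
        moreover have "(s ?e w \<noteq> 0 \<and> (w, v) \<in> G) = (w \<in> U \<and> (w, v) \<in> G)" for w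
          using G_range[of w v] N_bounds(1) by (auto simp: U_def flagged_iff)
        ultimately show ?thesis by simp
      qed
      have lN: "(LEAST w. w \<in> U \<and> (w, v) \<in> G) < N" if vL: "v \<in> Ly"
      proof -
        obtain w where "w \<in> U \<and> (w, v) \<in> G" using vL by (auto simp: Ly_def ball_layer_def)
        then have "(LEAST w. w \<in> U \<and> (w, v) \<in> G) \<in> U \<and> (LEAST w. w \<in> U \<and> (w, v) \<in> G, v) \<in> G" by (rule LeastI)
        then show ?thesis by (simp add: U_def flagged_iff)
      qed
      have Lv: "s2 ''L'' v \<noteq> 0 \<longleftrightarrow> v \<in> Ly" using L2 True by (auto simp: flagged_iff)
      have run: "run (growP i) s = run (Asg ?e (If (And (At ''L'' 0) (Lt (Sc ''k'') (Mul (Sc ''c'') (Sc ''c''))))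
        (Pl (Cn 1) (Ar ?e (Mu 1 2 (And (At ?e 2) (Adj 2 0))))) (At ?e 0))) s2"
        unfolding growP_def run.simps(2) s1_def s2_def ..
      show ?thesis
        unfolding cell_def run using True run_Asg[OF ok2 True] Lv m mu lN by (simp add: e2 k2 e_def cell_def)
    qed
  qed
qed


lemma ball_timesD:
  assumes "ball_times B A e"
  shows "e v > 0 \<Longrightarrow> v \<in> B" "e v = 1 \<longleftrightarrow> v \<in> A" "e v > 1 \<Longrightarrow> \<exists>w. (w, v) \<in> G \<and> e w + 1 = e v"
  using assms unfolding ball_times_def by simp_all

text \<open>A new vertex takes its time from a vertex of the ball, whose own time stays, as the
  layer is disjoint from the ball.\<close>

lemma ball_times_grow:
  assumes bt: "ball_times B A e" and U: "U = {v. e v > 0}" and Ly: "Ly = ball_layer G B U"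
  shows "ball_times B A (\<lambda>v. if v \<in> Ly then 1 + e (LEAST w. w \<in> U \<and> (w, v) \<in> G) else e v)"
proof -
  let ?p = "\<lambda>v. LEAST w. w \<in> U \<and> (w, v) \<in> G"
  let ?e = "\<lambda>v. if v \<in> Ly then 1 + e (?p v) else e v"
  have p: "?p v \<in> U \<and> (?p v, v) \<in> G" if "v \<in> Ly" for v
  proof -
    have "\<exists>w. w \<in> U \<and> (w, v) \<in> G" using that by (auto simp: Ly ball_layer_def)
    then show ?thesis by (rule LeastI_ex)
  qed
  have UL: "v \<notin> Ly" if "v \<in> U" for v using that by (simp add: Ly ball_layer_def)
  show ?thesis
    unfolding ball_times_def
  proof (intro conjI allI impI)
    fix v
    show "v \<in> B" if "?e v > 0"
    proof (cases "v \<in> Ly")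
      case True
      then show ?thesis by (simp add: Ly ball_layer_def)
    next
      case False
      then show ?thesis using that ball_timesD(1)[OF bt, of v] by simp
    qed
    show "?e v = 1 \<longleftrightarrow> v \<in> A"
    proof (cases "v \<in> Ly")
      case True
      then have "e v = 0" by (auto simp: Ly ball_layer_def U)
      moreover have "e (?p v) > 0" using p[OF True] by (simp add: U)
      ultimately show ?thesis using True ball_timesD(2)[OF bt, of v] by auto
    next
      case False
      then show ?thesis using ball_timesD(2)[OF bt, of v] by simp
    qed
    show "\<exists>w. (w, v) \<in> G \<and> ?e w + 1 = ?e v" if v: "?e v > 1"
    proof (cases "v \<in> Ly")
      case True
      then show ?thesis using p[OF True] UL by (intro exI[of _ "?p v"]) simp
    next
      case False
      then obtain w where w: "(w, v) \<in> G" "e w + 1 = e v" using v ball_timesD(3)[OF bt, of v] by auto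
      have "w \<in> U" using w(2) v False by (simp add: U)
      then show ?thesis using UL w False by (intro exI[of _ w]) simp
    qed
  qed
qed

text \<open>Every absorbed layer has more than \<open>sqrt k\<close> vertices of \<open>B\<close>,
  and \<open>card B \<le> k\<close>. So at most \<open>sqrt k\<close> layers are absorbed, which
  bounds the times, and the growth can only stop at a thin boundary.\<close>

lemma ballP_spec:
  assumes s: "ok s" and i: "i > 0" and B: "flagged s ''B'' = B" "B \<subseteq> {..<n}" and k: "card B \<le> s ''k'' 0"
  defines "s' \<equiv> run (ballP i) s" and "A \<equiv> touch G B (cell s ''l'') i"
  shows "ball_times B A (cell s' (nm CHR ''e'' i))" (is ?bt)
    "real (cell s' (nm CHR ''e'' i) v) \<le> sqrt (s ''k'' 0) + 1" (is ?le)
    "(card (ball_layer G B (flagged s' (nm CHR ''e'' i))))\<^sup>2 \<le> s ''k'' 0" (is ?thin)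
    "flagged s' (nm CHR ''z'' i) = ball_layer G B (flagged s' (nm CHR ''e'' i))" (is ?z)
    "s' (nm CHR ''a'' i) 0 = card A" (is ?a)
proof -
  let ?e = "nm CHR ''e'' i" and ?k = "s ''k'' 0"
  have finB: "finite B" using B(2) finite_subset by blast
  have BN: "v < N" if "v \<in> B" for v using that B(2) N_bounds(1) by auto
  define s1 where "s1 = run (Asg ?e (If (And (At ''B'' 0) (Sm 1 (And (Eq (At ''l'' 1) (Cn i)) (Adj 1 0)))) (Cn 1) (Cn 0))) s"
  define s2 where "s2 = run (Asg (nm CHR ''a'' i) (Cnt 1 (At ?e 1))) s1"
  define s3 where "s3 = (run (growP i) ^^ N) s2"
  have ok1: "ok s1" unfolding s1_def by (rule ok_run[OF s]) simp
  have ok2: "ok s2" unfolding s2_def by (rule ok_run[OF ok1]) simp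
  have cond: "holds (And (At ''B'' 0) (Sm 1 (And (Eq (At ''l'' 1) (Cn i)) (Adj 1 0)))) ((\<lambda>_. 0)(0 := v)) s \<longleftrightarrow> v \<in> A"
    if "v < N" for v
  proof -
    have "(\<exists>w<N. s ''l'' w = i \<and> (w, v) \<in> G) \<longleftrightarrow> (\<exists>w. cell s ''l'' w = i \<and> (w, v) \<in> G)"
      using i by (auto simp: cell_def)
    moreover have "s ''B'' v \<noteq> 0 \<longleftrightarrow> v \<in> B" using that B(1) by (auto simp: flagged_iff)
    ultimately show ?thesis using s that by (simp add: A_def touch_def)
  qed
  have AB: "A \<subseteq> B" by (auto simp: A_def touch_def)
  have e1: "cell s1 ?e v = (if v \<in> A then 1 else 0)" for v
  proof (cases "v < N")
    case True
    then show ?thesis unfolding cell_def s1_def using run_Asg[OF s True] cond[OF True] by simp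
  next
    case False
    then show ?thesis using AB BN by (auto simp: cell_def)
  qed
  have a2: "s2 (nm CHR ''a'' i) 0 = card A"
  proof -
    have "s2 (nm CHR ''a'' i) 0 = card {j. j < N \<and> s1 ?e j \<noteq> 0}"
      unfolding s2_def using run_Asg[OF ok1, of 0] ok1 N_bounds by simp
    also have "{j. j < N \<and> s1 ?e j \<noteq> 0} = A"
    proof (rule set_eqI)
      fix j
      show "j \<in> {j. j < N \<and> s1 ?e j \<noteq> 0} \<longleftrightarrow> j \<in> A"
        using e1[of j] AB BN[of j] by (auto simp: cell_def split: if_splits)
    qed
    finally show ?thesis .
  qed
  have e2: "cell s2 ?e = (\<lambda>v. if v \<in> A then 1 else 0)"
    unfolding s2_def by (subst cell_frame) (simp_all add: e1 fun_eq_iff)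
  \<comment> \<open>The witness \<open>t\<close> counts the absorbed layers: times are at most
    \<open>t + 1\<close>, and the ball has at least \<open>t * sqrt k\<close> vertices.\<close>
  define I where "I s4 \<longleftrightarrow> ok s4 \<and> flagged s4 ''B'' = B \<and> s4 ''k'' 0 = ?k \<and> s4 (nm CHR ''a'' i) 0 = card A \<and>
     ball_times B A (cell s4 ?e) \<and>
     (\<exists>t. (\<forall>v. cell s4 ?e v \<le> t + 1) \<and> real t * sqrt ?k \<le> real (card (flagged s4 ?e)))" for s4
  define D where "D s4 \<longleftrightarrow> (card (ball_layer G B (flagged s4 ?e)))\<^sup>2 \<le> ?k" for s4
  have U: "flagged s4 ?e = {v. cell s4 ?e v > 0}" for s4 by (auto simp: flagged_cell)
  have UB: "flagged s4 ?e \<subseteq> B" if "I s4" for s4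
    using that ball_timesD(1) unfolding I_def U by blast
  have I2: "I s2"
  proof -
    have "flagged s2 ''B'' = B" unfolding s2_def s1_def by (simp add: flagged_frame B)
    moreover have "s2 ''k'' 0 = ?k" unfolding s2_def s1_def by (simp add: run_frame)
    moreover have "ball_times B A (cell s2 ?e)"
      unfolding e2 ball_times_def using AB by auto
    moreover have "\<exists>t. (\<forall>v. cell s2 ?e v \<le> t + 1) \<and> real t * sqrt ?k \<le> real (card (flagged s2 ?e))"
      by (rule exI[of _ 0]) (simp add: e2)
    ultimately show ?thesis using ok2 a2 by (simp add: I_def)
  qed
  have "I s3 \<and> D s3"
    unfolding s3_def
  proof (rule iterate_until[where \<mu> = "\<lambda>s4. n - card (flagged s4 ?e)"])
    fix s4 assume i4: "I s4"
    have ok4: "ok s4" and B4: "flagged s4 ''B'' = B" and k4: "s4 ''k'' 0 = ?k" and a4: "s4 (nm CHR ''a'' i) 0 = card A"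
      and bt: "ball_times B A (cell s4 ?e)" using i4 by (simp_all add: I_def)
    obtain t where t: "\<And>v. cell s4 ?e v \<le> t + 1" "real t * sqrt ?k \<le> real (card (flagged s4 ?e))"
      using i4 by (auto simp: I_def)
    let ?s5 = "run (growP i) s4" and ?U = "flagged s4 ?e"
    let ?Ly = "ball_layer G B ?U"
    have ok5: "ok ?s5" by (rule ok_run[OF ok4]) simp
    have B5: "flagged ?s5 ''B'' = B" by (subst flagged_frame) (simp_all add: B4)
    have k5: "?s5 ''k'' 0 = ?k" by (subst run_frame) (simp_all add: k4)
    have a5: "?s5 (nm CHR ''a'' i) 0 = card A" by (subst run_frame) (simp_all add: a4)
    have e5: "cell ?s5 ?e = (\<lambda>v. if v \<in> ?Ly \<and> ?k < card ?Ly * card ?Ly then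
        1 + cell s4 ?e (LEAST w. w \<in> ?U \<and> (w, v) \<in> G) else cell s4 ?e v)"
      using growP_spec[OF ok4 i] B(2) unfolding B4 k4 by simp
    have finU: "finite ?U" by simp
    have Lfin: "finite ?Ly" "?Ly \<inter> ?U = {}" "?Ly \<subseteq> B" using finB by (auto simp: ball_layer_def)
    have unchanged: "cell ?s5 ?e = cell s4 ?e" "flagged ?s5 ?e = ?U" if "D s4"
    proof -
      have "\<not> ?k < card ?Ly * card ?Ly" using that by (simp add: D_def power2_eq_square)
      then show "cell ?s5 ?e = cell s4 ?e" unfolding e5 by simp
      then show "flagged ?s5 ?e = ?U" by (simp add: U)
    qed
    have grown: "cell ?s5 ?e = (\<lambda>v. if v \<in> ?Ly then 1 + cell s4 ?e (LEAST w. w \<in> ?U \<and> (w, v) \<in> G) else cell s4 ?e v)"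
      "flagged ?s5 ?e = ?U \<union> ?Ly" "card (flagged ?s5 ?e) = card ?U + card ?Ly" "?Ly \<noteq> {}" "sqrt ?k \<le> real (card ?Ly)"
      if "\<not> D s4"
    proof -
      have kl: "?k < card ?Ly * card ?Ly" using that by (simp add: D_def power2_eq_square)
      then show g: "cell ?s5 ?e = (\<lambda>v. if v \<in> ?Ly then 1 + cell s4 ?e (LEAST w. w \<in> ?U \<and> (w, v) \<in> G) else cell s4 ?e v)"
        unfolding e5 by simp
      show u: "flagged ?s5 ?e = ?U \<union> ?Ly" unfolding U[of ?s5] g by (auto simp: U[of s4])
      show "card (flagged ?s5 ?e) = card ?U + card ?Ly" unfolding u using finU Lfin by (intro card_Un_disjoint) auto
      show "?Ly \<noteq> {}" using kl by auto
      have "real ?k \<le> (real (card ?Ly))\<^sup>2" using kl by (simp add: power2_eq_square flip: of_nat_mult)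
      then show "sqrt ?k \<le> real (card ?Ly)" by (rule real_le_lsqrt[rotated -1]) simp_all
    qed
    show "I ?s5"
    proof (cases "D s4")
      case True
      then show ?thesis using unchanged[OF True] i4 ok5 B5 k5 a5 by (simp add: I_def)
    next
      case False
      note g = grown[OF False]
      have "ball_times B A (cell ?s5 ?e)" unfolding g(1) by (rule ball_times_grow[OF bt U refl])
      moreover have "\<forall>v. cell ?s5 ?e v \<le> (t + 1) + 1" unfolding g(1) using t(1) by (auto intro: le_SucI)
      moreover have "real (t + 1) * sqrt ?k \<le> real (card (flagged ?s5 ?e))"
        using t(2) g(3,5) by (simp add: algebra_simps)
      ultimately show ?thesis using ok5 B5 k5 a5 unfolding I_def by blast
    qed
    show "n - card (flagged ?s5 ?e) < n - card ?U" if "\<not> D s4"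
    proof -
      note g = grown[OF that]
      have "flagged ?s5 ?e \<subseteq> {..<n}" unfolding g(2) using UB[OF i4] Lfin(3) B(2) by blast
      then have "card (flagged ?s5 ?e) \<le> n" using card_mono[of "{..<n}"] by fastforce
      moreover have "card ?Ly > 0" using g(4) Lfin(1) by (simp add: card_gt_0_iff)
      ultimately show ?thesis using g(3) by linarith
    qed
    show "D ?s5" if "D s4" using that unchanged(2)[OF that] by (simp add: D_def)
  qed (use I2 N_bounds in simp_all)
  then have I3: "I s3" and D3: "D s3" by simp_all
  then have ok3: "ok s3" by (simp add: I_def)
  have s': "s' = run (Asg (nm CHR ''z'' i) (layerE i)) s3"
    unfolding s'_def ballP_def run.simps(2) s1_def[symmetric] s2_def[symmetric] run_It[OF ok2] s3_def ..
  have fr: "flagged s' ?e = flagged s3 ?e" "cell s' ?e = cell s3 ?e" "s' (nm CHR ''a'' i) = s3 (nm CHR ''a'' i)"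
    unfolding s' by (simp_all add: flagged_frame cell_frame run_frame)
  show ?bt unfolding fr using I3 by (simp add: I_def)
  show ?a unfolding fr using I3 by (simp add: I_def)
  show ?thin unfolding fr using D3 by (simp add: D_def)
  show ?z unfolding fr unfolding s' ball_layer_flagged[OF ok3] using I3 by (simp add: I_def)
  obtain t where t: "\<And>v. cell s3 ?e v \<le> t + 1" "real t * sqrt ?k \<le> real (card (flagged s3 ?e))"
    using I3 by (auto simp: I_def)
  have "card (flagged s3 ?e) \<le> card B" using UB[OF I3] finB by (rule card_mono[rotated])
  then have tk: "real t * sqrt ?k \<le> real ?k" using t(2) k by linarith
  show ?le
  \<comment> \<open>The other case cancels \<open>sqrt k\<close>; for \<open>k = 0\<close> the set
    \<open>B\<close> is empty and all times vanish.\<close>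
  proof (cases "?k = 0")
    case True
    then have "B = {}" using k finB by simp
    then have "cell s' ?e v = 0" using ball_timesD(1)[OF \<open>?bt\<close>, of v] by auto
    then show ?thesis by simp
  next
    case False
    have sq: "sqrt ?k * sqrt ?k = real ?k" by simp
    have "real t * sqrt ?k \<le> sqrt ?k * sqrt ?k" using tk sq by linarith
    then have "real t \<le> sqrt ?k" by (rule mult_right_le_imp_le) (use False in simp)
    then show ?thesis unfolding fr using t(1)[of v] by linarith
  qed
qed

text \<open>The time drops by one from child to parent until it is \<open>1\<close>, that is, at a
  contact, where \<open>p\<close> stands still. If \<open>g\<close> has time \<open>0\<close>, the
  orbit is \<open>{g}\<close>; hence the \<open>max 1\<close>.\<close>

lemma parent_orbit:
  assumes p: "\<And>v. e v > 1 \<Longrightarrow> (p v, v) \<in> G \<and> e (p v) + 1 = e v" "\<And>v. e v \<le> 1 \<Longrightarrow> p v = v"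
    and k: "e g \<le> k" and M: "M = (\<lambda>j. (p ^^ j) g) ` {..k}"
  shows "induces_connected G M" "card M \<le> max 1 (e g)" "M \<subseteq> insert g {v. e v > 0}" "e g > 0 \<Longrightarrow> \<exists>a\<in>M. e a = 1"
proof -
  have lev: "e ((p ^^ j) g) = (if j < e g then e g - j else 1)" if "e g > 0" for j
  proof (induction j)
    case (Suc j)
    show ?case
    proof (cases "e ((p ^^ j) g) > 1")
      case True
      then have "e ((p ^^ Suc j) g) + 1 = e ((p ^^ j) g)" using p(1) by simp
      then show ?thesis using Suc True by (auto split: if_splits)
    next
      case False
      then have "e ((p ^^ Suc j) g) = e ((p ^^ j) g)" using p(2) by simp
      then show ?thesis using Suc False that by (auto split: if_splits)
    qed
  qed (use that in simp)
  have stop: "(p ^^ j) g = (p ^^ (e g - 1)) g" if "e g - 1 \<le> j" for j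
    using that
  proof (induction j rule: dec_induct)
    case (step j)
    have "e ((p ^^ j) g) \<le> 1"
    proof (cases "e g = 0")
      case True
      have "(p ^^ j) g = g" for j by (induction j) (use p(2) True in auto)
      then show ?thesis using True by simp
    next
      case False
      then show ?thesis using lev[of j] step by auto
    qed
    then show ?case using p(2) step by simp
  qed simp
  have "M \<subseteq> (\<lambda>j. (p ^^ j) g) ` {..<max 1 (e g)}"
  proof
    fix x assume "x \<in> M"
    then obtain j where "x = (p ^^ j) g" using M by auto
    then show "x \<in> (\<lambda>j. (p ^^ j) g) ` {..<max 1 (e g)}"
      using stop[of j] by (cases "j < max 1 (e g)") auto
  qed
  then have "card M \<le> card ((\<lambda>j. (p ^^ j) g) ` {..<max 1 (e g)})" by (intro card_mono) auto
  also have "\<dots> \<le> max 1 (e g)" using card_image_le[of "{..<max 1 (e g)}"] by fastforce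
  finally show "card M \<le> max 1 (e g)" .
  show "M \<subseteq> insert g {v. e v > 0}"
  proof (cases "e g = 0")
    case True
    have "(p ^^ j) g = g" for j by (induction j) (use p(2) True in auto)
    then show ?thesis using M by auto
  next
    case False
    then show ?thesis using M lev by auto
  qed
  show "\<exists>a\<in>M. e a = 1" if "e g > 0"
    using lev[OF that, of "e g - 1"] that k M by (intro bexI[of _ "(p ^^ (e g - 1)) g"]) auto
  show "induces_connected G M"
  proof (rule induces_connectedI[OF symG, of _ g])
    fix w assume "w \<in> M"
    then obtain j where "w = (p ^^ j) g" "j \<le> k" using M by auto
    moreover have "j \<le> k \<Longrightarrow> ((p ^^ j) g, g) \<in> (G \<inter> M \<times> M)\<^sup>*" for j
    proof (induction j)
      case (Suc j)
      show ?case
      proof (cases "e ((p ^^ j) g) > 1")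
        case True
        have "(p ^^ j) g \<in> M" "(p ^^ Suc j) g \<in> M" 
          using imageI[of j "{..k}" "\<lambda>j. (p ^^ j) g"] imageI[of "Suc j" "{..k}" "\<lambda>j. (p ^^ j) g"] Suc.prems
          unfolding M by simp_all
        then have "((p ^^ Suc j) g, (p ^^ j) g) \<in> G \<inter> M \<times> M" using p(1)[OF True] by simp
        moreover have "((p ^^ j) g, g) \<in> (G \<inter> M \<times> M)\<^sup>*" using Suc by simp
        ultimately show ?thesis by (rule converse_rtrancl_into_rtrancl)
      next
        case False
        then have "(p ^^ Suc j) g = (p ^^ j) g" using p(2) by simp
        then show ?thesis using Suc by simp
      qed
    qed simp
    ultimately show "(w, g) \<in> (G \<inter> M \<times> M)\<^sup>*" by simp
  qed
qed

lemma pathP_spec: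
  assumes s: "ok s" and i: "i > 0" and bt: "ball_times B A (cell s (nm CHR ''e'' i))" and B: "B \<subseteq> {..<n}"
    and eN: "\<And>v. cell s (nm CHR ''e'' i) v \<le> N" and g: "s ''g'' 0 = g" "g < n"
  defines "T \<equiv> flagged (run (pathP i) s) (nm CHR ''t'' i)" and "e \<equiv> cell s (nm CHR ''e'' i)"
  shows "g \<in> T" "induces_connected G T" "card T \<le> max 1 (e g)" "T \<subseteq> insert g {v. e v > 0}"
    "e g > 0 \<Longrightarrow> \<exists>a\<in>T. e a = 1"
proof -
  let ?e = "nm CHR ''e'' i" and ?t = "nm CHR ''t'' i"
  define par where "par v = (LEAST w. (w, v) \<in> G \<and> e w + 1 = e v)" for v
  define p where "p v = (if e v > 1 then par v else v)" for v
  have par: "(par v, v) \<in> G \<and> e (par v) + 1 = e v" if "e v > 1" for v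
  proof -
    have "\<exists>w. (w, v) \<in> G \<and> e w + 1 = e v"
      unfolding e_def by (rule ball_timesD(3)[OF bt that[unfolded e_def]])
    then show ?thesis unfolding par_def by (rule LeastI_ex)
  qed
  let ?E = "Mu 2 3 (And (Adj 3 1) (Eq (Pl (At ?e 3) (Cn 1)) (At ?e 1)))"
  let ?f = "run (Asg ?t (Or (At ?t 0) (Sm 1 (And (At ?t 1) (And (Lt (Cn 1) (At ?e 1)) (Eq (Ix 0) ?E))))))"
  define s0 where "s0 = run (Asg ?t (Eq (Ix 0) (Sc ''g''))) s"
  have ok0: "ok s0" unfolding s0_def by (rule ok_run[OF s]) simp
  have gN: "g < N" using g N_bounds by simp
  have t0: "flagged s0 ?t = {g}" unfolding s0_def flagged_Asg[OF s] using g gN by auto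
  have e0: "s0 ?e = s ?e" unfolding s0_def by (simp add: run_frame)
  \<comment> \<open>After \<open>j\<close> rounds the flags are \<open>g\<close> and its first
    \<open>j\<close> iterates under \<open>p\<close>; beyond a contact nothing is added.\<close>
  have main: "ok ((?f ^^ j) s0) \<and> (?f ^^ j) s0 ?e = s ?e \<and> flagged ((?f ^^ j) s0) ?t = (\<lambda>j. (p ^^ j) g) ` {..j}" for j
  proof (induction j)
    case 0
    then show ?case using ok0 e0 t0 by simp
  next
    case (Suc j)
    let ?s = "(?f ^^ j) s0" and ?M = "(\<lambda>j. (p ^^ j) g) ` {..j}"
    have IH: "ok ?s" "?s ?e = s ?e" "flagged ?s ?t = ?M" using Suc by simp_all
    have E: "ev ?E (((\<lambda>_. 0)(0 := v))(1 := w)) ?s = par w" if w: "1 < e w" for v w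
    proof -
      have "ev ?E (((\<lambda>_. 0)(0 := v))(1 := w)) ?s =
        (if \<exists>x<?s ''N'' 0. (x, w) \<in> G \<and> s ?e x + 1 = s ?e w then LEAST x. (x, w) \<in> G \<and> s ?e x + 1 = s ?e w else ?s ''N'' 0)"
        by (rule ev_Mu) (use IH in simp_all)
      moreover have wN: "w < N" using w by (simp add: e_def cell_def split: if_splits)
      moreover have eq: "((x, w) \<in> G \<and> s ?e x + 1 = s ?e w) = ((x, w) \<in> G \<and> e x + 1 = e w)" for x
        using G_range[of x w] N_bounds(1) wN by (auto simp: e_def cell_def)
      moreover have "\<exists>x<?s ''N'' 0. (x, w) \<in> G \<and> s ?e x + 1 = s ?e w"
        unfolding eq using par[OF w] G_range[of "par w" w] N_bounds(1) IH(1) by (intro exI[of _ "par w"]) simp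
      ultimately show ?thesis unfolding par_def by simp
    qed
    have step: "flagged (?f ?s) ?t = ?M \<union> p ` ?M"
    proof (rule set_eqI)
      fix v
      have Mt: "w < N \<and> ?s ?t w \<noteq> 0 \<longleftrightarrow> w \<in> ?M" for w using IH(3) by (auto simp: flagged_iff)
      have ew: "w < N \<Longrightarrow> ?s ?e w = e w" for w using IH(2) by (simp add: e_def cell_def)
      have "v \<in> flagged (?f ?s) ?t \<longleftrightarrow> v < N \<and> (?s ?t v \<noteq> 0 \<or>
          (\<exists>w<N. ?s ?t w \<noteq> 0 \<and> 1 < ?s ?e w \<and> v = ev ?E (((\<lambda>_. 0)(0 := v))(1 := w)) ?s))"
        unfolding flagged_Asg[OF IH(1)] using IH(1) by simp
      also have "\<dots> \<longleftrightarrow> v < N \<and> (?s ?t v \<noteq> 0 \<or> (\<exists>w<N. ?s ?t w \<noteq> 0 \<and> 1 < e w \<and> v = par w))"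
        using E ew by (metis (no_types, lifting))
      also have "\<dots> \<longleftrightarrow> v \<in> ?M \<or> (\<exists>w\<in>?M. 1 < e w \<and> v = par w)"
      proof -
        have "par w < N" if "1 < e w" for w using par[OF that] G_range[of "par w" w] N_bounds(1) by simp
        then show ?thesis using Mt by (metis (no_types, lifting))
      qed
      also have "\<dots> \<longleftrightarrow> v \<in> ?M \<union> p ` ?M" by (auto simp: p_def)
      finally show "v \<in> flagged (?f ?s) ?t \<longleftrightarrow> v \<in> ?M \<union> p ` ?M" .
    qed
    have "?M \<union> p ` ?M = (\<lambda>j. (p ^^ j) g) ` {..Suc j}"
    proof -
      have "p ` ?M = (\<lambda>j. (p ^^ j) g) ` Suc ` {..j}" by (simp add: image_image)
      moreover have "{..Suc j} = {..j} \<union> Suc ` {..j}" unfolding image_Suc_atMost by auto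
      ultimately show ?thesis by (simp add: image_Un)
    qed
    moreover have "ok (?f ?s)" by (rule ok_run[OF IH(1)]) simp
    moreover have "?f ?s ?e = s ?e" by (subst run_frame, simp, rule IH(2))
    ultimately show ?case using step by simp
  qed
  have "run (pathP i) s = (?f ^^ N) s0"
    unfolding pathP_def run.simps(2) s0_def[symmetric] run_It[OF ok0] ..
  then have T: "T = (\<lambda>j. (p ^^ j) g) ` {..N}" using main[of N] by (simp add: T_def)
  have pp: "e v > 1 \<Longrightarrow> (p v, v) \<in> G \<and> e (p v) + 1 = e v" "e v \<le> 1 \<Longrightarrow> p v = v" for v
    using par[of v] by (simp_all add: p_def)
  have eg: "e g \<le> N" unfolding e_def by (rule eN)
  show "g \<in> T" unfolding T by (rule image_eqI[of _ _ 0]) simp_all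
  show "induces_connected G T" "card T \<le> max 1 (e g)" "T \<subseteq> insert g {v. e v > 0}" "e g > 0 \<Longrightarrow> \<exists>a\<in>T. e a = 1"
    using parent_orbit[OF pp eg T] by simp_all
qed

end

text \<open>Numbering starts at \<open>1\<close>, as for labels, and there are \<open>m + 1\<close>
  pieces; so \<open>seqs p 4\<close> serves the five labels.\<close>

fun seqs :: "(nat \<Rightarrow> st) \<Rightarrow> nat \<Rightarrow> st" where
  "seqs p 0 = p 1"
| "seqs p (Suc m) = Sq (seqs p m) (p (m + 2))"

definition anyE :: "(nat \<Rightarrow> ex) \<Rightarrow> ex" where
  "anyE f = Or (f 1) (Or (f 2) (Or (f 3) (Or (f 4) (f 5))))"

definition firstE :: "(nat \<Rightarrow> ex) \<Rightarrow> ex" where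
  "firstE f = If (f 1) (Cn 1) (If (f 2) (Cn 2) (If (f 3) (Cn 3) (If (f 4) (Cn 4) (If (f 5) (Cn 5) (Cn 0)))))"

lemma one_to_five: "{1..5::nat} = {1, 2, 3, 4, 5}"
  by auto

lemma holds_anyE [simp]: "holds (anyE f) \<rho> s \<longleftrightarrow> (\<exists>i\<in>{1..5}. holds (f i) \<rho> s)"
  unfolding one_to_five anyE_def by simp

lemma arrays_anyE [simp]: "arrays (anyE f) = (\<Union>i\<in>{1..5}. arrays (f i))"
  unfolding one_to_five anyE_def by simp

lemma arrays_firstE [simp]: "arrays (firstE f) = (\<Union>i\<in>{1..5}. arrays (f i))"
  unfolding one_to_five firstE_def by auto

lemma ev_firstE:
  assumes "\<exists>i\<in>{1..5}. holds (f i) \<rho> s"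
  shows "ev (firstE f) \<rho> s \<in> {1..5} \<and> holds (f (ev (firstE f) \<rho> s)) \<rho> s"
  using assms unfolding one_to_five firstE_def by auto

lemma writes_seqs [simp]: "writes (seqs p m) = (\<Union>i\<in>{1..m + 1}. writes (p i))"
proof (induction m)
  case (Suc m)
  have "{1..Suc m + 1} = insert (m + 2) {1..m + 1}" by auto
  then show ?case using Suc by auto
qed auto

lemma reads_seqs [simp]: "reads (seqs p m) = (\<Union>i\<in>{1..m + 1}. reads (p i))"
proof (induction m)
  case (Suc m)
  have "{1..Suc m + 1} = insert (m + 2) {1..m + 1}" by auto
  then show ?case using Suc by auto
qed auto

text \<open>If no vertex lies in the balls of all labels with contacts, \<open>Mu\<close> returns
  \<open>N\<close>, which is not below \<open>n\<close>; the test \<open>g < n\<close> thus tells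
  trees from cuts. As long as no label has contacts, every vertex of \<open>B\<close>
  qualifies.\<close>

definition searchP :: st where
  "searchP = Sq (seqs ballP 4)
    (Sq (Asg ''g'' (Mu 1 2 (And (At ''B'' 2)
       (Neg (anyE (\<lambda>i. And (Sc (nm CHR ''a'' i)) (Neg (At (nm CHR ''e'' i) 2))))))))
    (Sq (seqs pathP 4)
    (Sq (Asg ''Y'' (If (Lt (Sc ''g'') (Sc ''n'')) (anyE (\<lambda>i. At (nm CHR ''t'' i) 0)) (anyE (\<lambda>i. At (nm CHR ''z'' i) 0))))
    (Sq (Asg ''R'' (And (At ''B'' 0) (Neg (At ''Y'' 0))))
    (Sq componentsP
    (Sq (Asg ''D'' (And (At ''R'' 0) (Lt (Sc ''k'') (Pl (Cnt 1 (And (At ''R'' 1) (Eq (At ''r'' 0) (At ''r'' 1))))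
         (Cnt 1 (And (At ''R'' 1) (Eq (At ''r'' 0) (At ''r'' 1))))))))
        (Asg ''h'' (Cnt 1 (At ''D'' 1)))))))))"

definition closureP :: st where
  "closureP = Sq (Asg ''C'' (And (And (At ''B'' 0) (Neg (At ''D'' 0))) (Sm 1 (And (Eq (At ''l'' 1) (Sc ''j'')) (Adj 1 0)))))
    (It (Asg ''C'' (Or (At ''C'' 0) (And (And (At ''B'' 0) (Neg (At ''D'' 0))) (Sm 1 (And (At ''C'' 1) (Adj 1 0)))))))"

text \<open>The closure reads the old labels, and both it and \<open>S\<close> read the old
  \<open>B\<close>; hence \<open>l\<close> and \<open>B\<close> come last. With \<open>h = 0\<close>
  the search is over: \<open>S\<close> receives the separator, and the empty \<open>B\<close> makes
  all later rounds idle.\<close>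

definition updateP :: st where
  "updateP = Sq (Asg ''f'' (firstE (\<lambda>i. Neg (Sc (nm CHR ''a'' i)))))
    (Sq (Asg ''j'' (firstE (\<lambda>i. And (Sc (nm CHR ''a'' i)) (Neg (Sm 1 (And (At ''D'' 1) (Eq (At (nm CHR ''e'' i) 1) (Cn 1))))))))
    (Sq closureP
    (Sq (Asg ''S'' (Or (At ''S'' 0) (And (Neg (Sc ''h'')) (Or (At ''Y'' 0)
         (And (And (At ''K'' 0) (Neg (At ''B'' 0))) (Sm 1 (And (At ''B'' 1) (Adj 1 0))))))))
    (Sq (Asg ''l'' (If (Lt (Sc ''g'') (Sc ''n'')) (If (At ''Y'' 0) (Sc ''f'') (If (Eq (At ''l'' 0) (Sc ''f'')) (Cn 0) (At ''l'' 0)))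
         (If (At ''C'' 0) (Sc ''j'') (At ''l'' 0))))
        (Asg ''B'' (And (Sc ''h'') (If (Lt (Sc ''g'') (Sc ''n'')) (At ''D'' 0) (And (At ''B'' 0) (Neg (At ''C'' 0))))))))))"

lemma writes_step [simp]:
  "writes searchP = {''L'', ''c'', ''g'', ''Y'', ''R'', ''r'', ''D'', ''h''} \<union>
     (\<Union>i\<in>{1..5}. {nm CHR ''e'' i, nm CHR ''a'' i, nm CHR ''z'' i, nm CHR ''t'' i})"
  "writes closureP = {''C''}"
  "writes updateP = {''f'', ''j'', ''C'', ''S'', ''l'', ''B''}"
  by (auto simp: searchP_def closureP_def updateP_def)

section \<open>Correctness of the search half of a step\<close>

context input
begin

text \<open>Pieces may share scratch arrays. Each still finds the inputs that no piece writes, and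
  the outputs that it alone writes survive the later pieces; so its specification carries over to
  the sequence.\<close>

lemma seqs_piece:
  assumes s: "ok s" and prot: "\<And>j. writes (p j) \<inter> {''n'', ''m'', ''N'', ''u'', ''v''} = {}"
  shows "i \<in> {1..m + 1} \<Longrightarrow> \<exists>si. ok si \<and> (\<forall>a. (\<forall>j. a \<notin> writes (p j)) \<longrightarrow> si a = s a) \<and>
     (\<forall>a. (\<forall>j. j \<noteq> i \<longrightarrow> a \<notin> writes (p j)) \<longrightarrow> run (seqs p m) s a = run (p i) si a)"
proof (induction m)
  case 0
  then show ?case using s by (intro exI[of _ s]) auto
next
  case (Suc m)
  show ?case
  proof (cases "i = m + 2")
    case True
    have "writes (seqs p m) \<inter> {''n'', ''m'', ''N'', ''u'', ''v''} = {}"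
      unfolding writes_seqs using prot by blast
    then have "ok (run (seqs p m) s)" by (rule ok_run[OF s])
    moreover have "\<forall>a. (\<forall>j. a \<notin> writes (p j)) \<longrightarrow> run (seqs p m) s a = s a"
      by (intro allI impI run_frame) simp
    ultimately show ?thesis using True by (intro exI[of _ "run (seqs p m) s"]) (simp add: run.simps(2))
  next
    case False
    then have "i \<in> {1..m + 1}" using Suc.prems by auto
    from Suc.IH[OF this] obtain si where si: "ok si" "\<forall>a. (\<forall>j. a \<notin> writes (p j)) \<longrightarrow> si a = s a"
      "\<forall>a. (\<forall>j. j \<noteq> i \<longrightarrow> a \<notin> writes (p j)) \<longrightarrow> run (seqs p m) s a = run (p i) si a" by blast
    have "run (seqs p (Suc m)) s a = run (p i) si a" if "\<forall>j. j \<noteq> i \<longrightarrow> a \<notin> writes (p j)" for a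
    proof -
      have "run (seqs p (Suc m)) s a = run (seqs p m) s a"
        unfolding seqs.simps run.simps(2) by (rule run_frame) (use that False in simp)
      then show ?thesis using si(3) that by simp
    qed
    then show ?thesis using si(1,2) by blast
  qed
qed

lemma cell_eq: "s a = s' a \<Longrightarrow> cell s a = cell s' a"
  by (simp add: cell_def fun_eq_iff)

lemma flagged_eq: "s a = s' a \<Longrightarrow> flagged s a = flagged s' a"
  by (simp add: flagged_def)

lemma balls_spec:
  assumes s: "ok s" and B: "flagged s ''B'' = B" "B \<subseteq> {..<n}" and k: "card B \<le> s ''k'' 0" and i: "i \<in> {1..5}"
  defines "s' \<equiv> run (seqs ballP 4) s" and "A \<equiv> touch G B (cell s ''l'') i"
  shows "ball_times B A (cell s' (nm CHR ''e'' i))"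
    "real (cell s' (nm CHR ''e'' i) v) \<le> sqrt (s ''k'' 0) + 1"
    "(card (ball_layer G B (flagged s' (nm CHR ''e'' i))))\<^sup>2 \<le> s ''k'' 0"
    "flagged s' (nm CHR ''z'' i) = ball_layer G B (flagged s' (nm CHR ''e'' i))"
    "s' (nm CHR ''a'' i) 0 = card A"
proof -
  have "i \<in> {1..4 + 1}" using i by simp
  from seqs_piece[OF s, of ballP, OF _ this] obtain si where si: "ok si"
    "\<And>a. (\<forall>j. a \<notin> writes (ballP j)) \<Longrightarrow> si a = s a"
    "\<And>a. (\<forall>j. j \<noteq> i \<longrightarrow> a \<notin> writes (ballP j)) \<Longrightarrow> s' a = run (ballP i) si a"
    unfolding s'_def by (auto simp del: writes_seqs)
  have i0: "i > 0" using i by simp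
  have fr: "si ''B'' = s ''B''" "si ''k'' = s ''k''" "si ''l'' = s ''l''" by (rule si(2); simp)+
  have fr': "s' (nm CHR ''e'' i) = run (ballP i) si (nm CHR ''e'' i)"
    "s' (nm CHR ''a'' i) = run (ballP i) si (nm CHR ''a'' i)"
    "s' (nm CHR ''z'' i) = run (ballP i) si (nm CHR ''z'' i)" by (rule si(3); simp)+
  have "flagged si ''B'' = flagged s ''B''" by (rule flagged_eq) (rule fr(1))
  then have B': "flagged si ''B'' = B" using B(1) by simp
  have cl: "cell si ''l'' = cell s ''l''" by (rule cell_eq) (rule fr(3))
  have ce: "cell s' (nm CHR ''e'' i) = cell (run (ballP i) si) (nm CHR ''e'' i)" by (rule cell_eq) (rule fr'(1))
  have fe: "flagged s' (nm CHR ''e'' i) = flagged (run (ballP i) si) (nm CHR ''e'' i)" by (rule flagged_eq) (rule fr'(1))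
  have fz: "flagged s' (nm CHR ''z'' i) = flagged (run (ballP i) si) (nm CHR ''z'' i)" by (rule flagged_eq) (rule fr'(3))
  have k': "card B \<le> si ''k'' 0" using k fr(2) by simp
  note sp = ballP_spec[OF si(1) i0 B' B(2) k', unfolded fr(2) cl]
  show "ball_times B A (cell s' (nm CHR ''e'' i))"
    "real (cell s' (nm CHR ''e'' i) v) \<le> sqrt (s ''k'' 0) + 1"
    "(card (ball_layer G B (flagged s' (nm CHR ''e'' i))))\<^sup>2 \<le> s ''k'' 0"
    "flagged s' (nm CHR ''z'' i) = ball_layer G B (flagged s' (nm CHR ''e'' i))"
    "s' (nm CHR ''a'' i) 0 = card A"
    unfolding ce fe fz fr'(2) A_def by (rule sp)+
qed

lemma paths_spec:
  assumes s: "ok s" and i: "i \<in> {1..5}" and bt: "ball_times B A (cell s (nm CHR ''e'' i))" and B: "B \<subseteq> {..<n}"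
    and eN: "\<And>v. cell s (nm CHR ''e'' i) v \<le> N" and g: "s ''g'' 0 = g" "g < n"
  defines "T \<equiv> flagged (run (seqs pathP 4) s) (nm CHR ''t'' i)" and "e \<equiv> cell s (nm CHR ''e'' i)"
  shows "g \<in> T" "induces_connected G T" "card T \<le> max 1 (e g)" "T \<subseteq> insert g {v. e v > 0}"
    "e g > 0 \<Longrightarrow> \<exists>a\<in>T. e a = 1"
proof -
  have "i \<in> {1..4 + 1}" using i by simp
  from seqs_piece[OF s, of pathP, OF _ this] obtain si where si: "ok si"
    "\<And>a. (\<forall>j. a \<notin> writes (pathP j)) \<Longrightarrow> si a = s a"
    "\<And>a. (\<forall>j. j \<noteq> i \<longrightarrow> a \<notin> writes (pathP j)) \<Longrightarrow> run (seqs pathP 4) s a = run (pathP i) si a"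
    by (auto simp del: writes_seqs)
  have i0: "i > 0" using i by simp
  have fr: "si ''g'' = s ''g''" "si (nm CHR ''e'' i) = s (nm CHR ''e'' i)" by (rule si(2); simp)+
  have fr': "run (seqs pathP 4) s (nm CHR ''t'' i) = run (pathP i) si (nm CHR ''t'' i)" by (rule si(3); simp)
  have ce: "cell si (nm CHR ''e'' i) = cell s (nm CHR ''e'' i)" by (rule cell_eq) (rule fr(2))
  have ft: "flagged (run (seqs pathP 4) s) (nm CHR ''t'' i) = flagged (run (pathP i) si) (nm CHR ''t'' i)"
    by (rule flagged_eq) (rule fr')
  note sp = pathP_spec[OF si(1) i0, unfolded ce fr(1), OF bt B eN g]
  show "g \<in> T" "induces_connected G T" "card T \<le> max 1 (e g)" "T \<subseteq> insert g {v. e v > 0}"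
    "e g > 0 \<Longrightarrow> \<exists>a\<in>T. e a = 1"
    unfolding T_def e_def ft by (rule sp)+
qed


lemma union_connected:
  assumes "\<And>i. i \<in> I \<Longrightarrow> g \<in> T i \<and> induces_connected G (T i)"
  shows "induces_connected G (\<Union>i\<in>I. T i)"
proof (rule induces_connectedI[OF symG, of _ g])
  fix w assume "w \<in> (\<Union>i\<in>I. T i)"
  then obtain i where i: "i \<in> I" "w \<in> T i" by blast
  then have "(w, g) \<in> (G \<inter> T i \<times> T i)\<^sup>*" using assms[OF i(1)] by (simp add: induces_connected_def)
  then show "(w, g) \<in> (G \<inter> (\<Union>i\<in>I. T i) \<times> (\<Union>i\<in>I. T i))\<^sup>*"
    by (rule rtrancl_restrict_mono[rotated]) (use i in blast)
qed

lemma searchP_spec: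
  assumes s: "ok s" and B: "flagged s ''B'' = B" "B \<subseteq> {..<n}" and k: "s ''k'' 0 = k" "card B \<le> k" "k \<le> n"
  defines "s' \<equiv> run searchP s" and "A \<equiv> touch G B (cell s ''l'')"
  shows "\<exists>Y U. flagged s' ''Y'' = Y \<and> Y \<subseteq> B \<and> real (card Y) \<le> 11 * sqrt k \<and>
     flagged s' ''D'' = big_part G k (B - Y) \<and> s' ''h'' 0 = card (big_part G k (B - Y)) \<and>
     (\<forall>i\<in>{1..5}. s' (nm CHR ''a'' i) 0 = card (A i)) \<and>
     (\<forall>i\<in>{1..5}. \<forall>v. cell s' (nm CHR ''e'' i) v = 1 \<longleftrightarrow> v \<in> A i) \<and>
     (if s' ''g'' 0 < n then Y \<noteq> {} \<and> induces_connected G Y \<and> (\<forall>i\<in>{1..5}. A i \<noteq> {} \<longrightarrow> Y \<inter> A i \<noteq> {})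
      else (\<forall>i\<in>{1..5}. A i \<subseteq> U i) \<and> (\<forall>v\<in>B. \<exists>i\<in>{1..5}. A i \<noteq> {} \<and> v \<notin> U i) \<and>
        Y = (\<Union>i\<in>{1..5}. ball_layer G B (U i)))"
proof -
  define s1 where "s1 = run (seqs ballP 4) s"
  define s2 where "s2 = run (Asg ''g'' (Mu 1 2 (And (At ''B'' 2)
       (Neg (anyE (\<lambda>i. And (Sc (nm CHR ''a'' i)) (Neg (At (nm CHR ''e'' i) 2)))))))) s1"
  define s3 where "s3 = run (seqs pathP 4) s2"
  define s4 where "s4 = run (Asg ''Y'' (If (Lt (Sc ''g'') (Sc ''n'')) (anyE (\<lambda>i. At (nm CHR ''t'' i) 0)) (anyE (\<lambda>i. At (nm CHR ''z'' i) 0)))) s3"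
  define s5 where "s5 = run (Asg ''R'' (And (At ''B'' 0) (Neg (At ''Y'' 0)))) s4"
  define s6 where "s6 = run componentsP s5"
  define s7 where "s7 = run (Asg ''D'' (And (At ''R'' 0) (Lt (Sc ''k'') (Pl (Cnt 1 (And (At ''R'' 1) (Eq (At ''r'' 0) (At ''r'' 1))))
         (Cnt 1 (And (At ''R'' 1) (Eq (At ''r'' 0) (At ''r'' 1)))))))) s6"
  have s': "s' = run (Asg ''h'' (Cnt 1 (At ''D'' 1))) s7"
    unfolding s'_def searchP_def run.simps(2) s1_def s2_def s3_def s4_def s5_def s6_def s7_def ..
  have ok1: "ok s1" unfolding s1_def by (rule ok_run[OF s]) auto
  have ok2: "ok s2" unfolding s2_def by (rule ok_run[OF ok1]) simp
  have ok3: "ok s3" unfolding s3_def by (rule ok_run[OF ok2]) auto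
  have ok4: "ok s4" unfolding s4_def by (rule ok_run[OF ok3]) simp
  have ok5: "ok s5" unfolding s5_def by (rule ok_run[OF ok4]) simp
  have ok6: "ok s6" unfolding s6_def by (rule ok_run[OF ok5]) simp
  have ok7: "ok s7" unfolding s7_def by (rule ok_run[OF ok6]) simp
  have finB: "finite B" using B(2) finite_subset by blast
  have BN: "v < N" if "v \<in> B" for v using that B(2) N_bounds(1) by auto
  have kB: "card B \<le> s ''k'' 0" using k by simp
  define e where "e i = cell s1 (nm CHR ''e'' i)" for i
  define U where "U i = flagged s1 (nm CHR ''e'' i)" for i
  note bs = balls_spec[OF s B kB, folded s1_def, unfolded k(1)]
  have bt: "ball_times B (A i) (e i)" and ele: "real (e i v) \<le> sqrt k + 1"
    and thin: "(card (ball_layer G B (U i)))\<^sup>2 \<le> k" and z: "flagged s1 (nm CHR ''z'' i) = ball_layer G B (U i)"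
    and a: "s1 (nm CHR ''a'' i) 0 = card (A i)" if "i \<in> {1..5}" for i v
    using bs[OF that] unfolding e_def U_def A_def by simp_all
  have Ue: "U i = {v. e i v > 0}" for i unfolding U_def e_def by (auto simp: flagged_cell)
  have AB: "A i \<subseteq> B" for i by (auto simp: A_def touch_def)
  have finA: "finite (A i)" for i using AB finB finite_subset by blast
  have UB: "U i \<subseteq> B" if "i \<in> {1..5}" for i using ball_timesD(1)[OF bt[OF that]] by (auto simp: Ue)
  have AU: "A i \<subseteq> U i" if "i \<in> {1..5}" for i
  proof
    fix v assume "v \<in> A i"
    then have "e i v = 1" using ball_timesD(2)[OF bt[OF that]] by blast
    then show "v \<in> U i" by (simp add: Ue)
  qed
  have eN: "e i v \<le> N" if "i \<in> {1..5}" for i v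
  proof -
    have "sqrt k \<le> real k + 1" by (rule real_le_lsqrt) (auto simp: power2_eq_square algebra_simps)
    then have "real (e i v) \<le> real k + 2" using ele[OF that, of v] by linarith
    then show ?thesis using k(3) by (simp add: N_def)
  qed
  have B1: "flagged s1 ''B'' = B" unfolding s1_def by (subst flagged_frame) (auto simp: B)
  \<comment> \<open>\<open>P\<close> is the test as the program performs it, and \<open>Gd\<close>
    its meaning: \<open>v\<close> lies in the ball of every label that has contacts.\<close>
  define P where "P v \<longleftrightarrow> s1 ''B'' v \<noteq> 0 \<and> \<not> (\<exists>i\<in>{1..5}. s1 (nm CHR ''a'' i) 0 \<noteq> 0 \<and> s1 (nm CHR ''e'' i) v = 0)" for v
  define Gd where "Gd v \<longleftrightarrow> v \<in> B \<and> (\<forall>i\<in>{1..5}. A i \<noteq> {} \<longrightarrow> e i v > 0)" for v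
  have PGd: "P v \<longleftrightarrow> Gd v" if "v < N" for v
  proof -
    have "s1 ''B'' v \<noteq> 0 \<longleftrightarrow> v \<in> B" using B1 that by (auto simp: flagged_iff)
    moreover have "(\<exists>i\<in>{1..5}. s1 (nm CHR ''a'' i) 0 \<noteq> 0 \<and> s1 (nm CHR ''e'' i) v = 0) \<longleftrightarrow> (\<exists>i\<in>{1..5}. A i \<noteq> {} \<and> e i v = 0)"
      by (rule bex_cong) (use a finA that in \<open>simp_all add: e_def cell_def\<close>)
    ultimately show ?thesis unfolding P_def Gd_def by auto
  qed
  define g where "g = s2 ''g'' 0"
  have g: "g = (if \<exists>v<N. P v then LEAST v. P v else N)"
  proof -
    have "g = ev (Mu 1 2 (And (At ''B'' 2) (Neg (anyE (\<lambda>i. And (Sc (nm CHR ''a'' i)) (Neg (At (nm CHR ''e'' i) 2))))))) ((\<lambda>_. 0)(0 := 0)) s1"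
      unfolding g_def s2_def by (rule run_Asg[OF ok1]) (use N_bounds in simp)
    also have "\<dots> = (if \<exists>v<s1 ''N'' 0. P v then LEAST v. P v else s1 ''N'' 0)"
      by (rule ev_Mu) (simp_all add: P_def)
    finally show ?thesis unfolding ok_simps(2)[OF ok1] .
  qed
  have gyes: "Gd g \<and> g < n" if "g < n"
  proof -
    have ex: "\<exists>v<N. P v" using g that N_bounds(1) by (auto split: if_splits)
    then have "P (LEAST v. P v)" by (meson LeastI)
    moreover have "g = (LEAST v. P v)" using g unfolding if_P[OF ex] .
    ultimately have "P g" by simp
    then show ?thesis using PGd[of g] that N_bounds(1) by simp
  qed
  have gno: "\<not> Gd v" if "\<not> g < n" for v
  proof
    assume v: "Gd v"
    then have vB: "v \<in> B" by (simp add: Gd_def)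
    then have "P v" using PGd v BN by simp
    moreover from this have ex: "\<exists>v<N. P v" using BN[OF vB] by blast
    have "g = (LEAST v. P v)" using g unfolding if_P[OF ex] .
    ultimately have "g \<le> v" by (simp add: Least_le)
    then show False using that vB B(2) by auto
  qed
  have e2: "cell s2 (nm CHR ''e'' i) = e i" for i unfolding e_def s2_def by (subst cell_frame) simp_all
  define T where "T i = flagged s3 (nm CHR ''t'' i)" for i
  have T: "g \<in> T i" "induces_connected G (T i)" "card (T i) \<le> max 1 (e i g)" "T i \<subseteq> insert g (U i)"
    "e i g > 0 \<Longrightarrow> \<exists>a\<in>T i. e i a = 1" if "i \<in> {1..5}" "g < n" for i
  proof -
    note ps = paths_spec[OF ok2 that(1), unfolded e2, OF bt[OF that(1)] B(2) eN[OF that(1)] g_def[symmetric] that(2), folded s3_def, folded T_def]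
    show "g \<in> T i" "induces_connected G (T i)" "card (T i) \<le> max 1 (e i g)" "T i \<subseteq> insert g (U i)"
      "e i g > 0 \<Longrightarrow> \<exists>a\<in>T i. e i a = 1"
      unfolding Ue by (rule ps; assumption?)+
  qed
  define Y where "Y = flagged s4 ''Y''"
  have g3: "s3 ''g'' 0 = g" unfolding s3_def g_def by (subst run_frame) auto
  have z3: "flagged s3 (nm CHR ''z'' i) = ball_layer G B (U i)" if "i \<in> {1..5}" for i
    unfolding s3_def s2_def using z[OF that] by (simp add: flagged_frame)
  have Y: "Y = (if g < n then (\<Union>i\<in>{1..5}. T i) else (\<Union>i\<in>{1..5}. ball_layer G B (U i)))"
  proof -
    have "Y = {v. v < N \<and> (if g < n then \<exists>i\<in>{1..5}. s3 (nm CHR ''t'' i) v \<noteq> 0 else \<exists>i\<in>{1..5}. s3 (nm CHR ''z'' i) v \<noteq> 0)}"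
      unfolding Y_def s4_def flagged_Asg[OF ok3] using ok3 g3 by simp
    also have "\<dots> = (if g < n then (\<Union>i\<in>{1..5}. T i) else (\<Union>i\<in>{1..5}. flagged s3 (nm CHR ''z'' i)))"
      unfolding T_def by (auto simp: flagged_iff)
    also have "(\<Union>i\<in>{1..5}. flagged s3 (nm CHR ''z'' i)) = (\<Union>i\<in>{1..5}. ball_layer G B (U i))"
      by (rule SUP_cong) (use z3 in simp_all)
    finally show ?thesis .
  qed
  have YT: "Y = (\<Union>i\<in>{1..5}. T i)" if "g < n" using Y unfolding if_P[OF that] .
  have YL: "Y = (\<Union>i\<in>{1..5}. ball_layer G B (U i))" if "\<not> g < n" using Y unfolding if_not_P[OF that] .
  have YB: "Y \<subseteq> B"
  proof (cases "g < n")
    case True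
    have "T i \<subseteq> B" if "i \<in> {1..5}" for i
      using T(4)[OF that True] UB[OF that] gyes[OF True] by (auto simp: Gd_def)
    then show ?thesis unfolding YT[OF True] by (rule UN_least)
  next
    case False
    then show ?thesis unfolding YL[OF False] by (intro UN_least) (simp add: ball_layer_def)
  qed
  \<comment> \<open>A tree has at most \<open>5 * (sqrt k + 1)\<close> vertices, which is at most
    \<open>10 * sqrt k\<close> as \<open>k \<ge> 1\<close>, and five thin boundaries have at most
    \<open>5 * sqrt k\<close>.\<close>
  have cardY: "real (card Y) \<le> 11 * sqrt k"
  proof (cases "g < n")
    case True
    have "g \<in> B" using gyes[OF True] by (simp add: Gd_def)
    then have "card B > 0" using finB by (auto simp: card_gt_0_iff)
    then have k1: "sqrt k \<ge> 1" using k by simp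
    have "card Y \<le> (\<Sum>i\<in>{1..5}. card (T i))" unfolding YT[OF True] by (rule card_UN_le) simp
    then have "real (card Y) \<le> (\<Sum>i\<in>{1..5}. real (card (T i)))" by (simp only: of_nat_sum[symmetric] of_nat_le_iff)
    also have "\<dots> \<le> (\<Sum>i\<in>{1..5::nat}. sqrt k + 1)"
    proof (rule sum_mono)
      fix i :: nat assume i: "i \<in> {1..5}"
      have "real (card (T i)) \<le> real (max 1 (e i g))" using T(3)[OF i True] by (simp only: of_nat_le_iff)
      also have "\<dots> \<le> sqrt k + 1" using ele[OF i, of g] k1 by (cases "e i g \<le> 1") (simp_all add: max_def)
      finally show "real (card (T i)) \<le> sqrt k + 1" .
    qed
    also have "\<dots> = 5 * sqrt k + 5" by simp
    also have "\<dots> \<le> 5 * sqrt k + 5 * sqrt k" using k1 by (intro add_left_mono) simp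
    also have "\<dots> \<le> 11 * sqrt k" by simp
    finally show ?thesis .
  next
    case False
    let ?L = "\<lambda>i. ball_layer G B (U i)"
    have "card Y \<le> (\<Sum>i\<in>{1..5}. card (?L i))" unfolding YL[OF False] by (rule card_UN_le) simp
    then have "real (card Y) \<le> (\<Sum>i\<in>{1..5}. real (card (?L i)))" by (simp only: of_nat_sum[symmetric] of_nat_le_iff)
    also have "\<dots> \<le> (\<Sum>i\<in>{1..5::nat}. sqrt k)"
    proof (rule sum_mono)
      fix i :: nat assume i: "i \<in> {1..5}"
      have "(real (card (?L i)))\<^sup>2 \<le> real k" using thin[OF i] by (simp flip: of_nat_power)
      then show "real (card (?L i)) \<le> sqrt k" by (rule real_le_rsqrt)
    qed
    also have "\<dots> = 5 * sqrt k" by simp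
    finally show ?thesis by (rule order_trans) simp
  qed
  have B4: "flagged s4 ''B'' = B" unfolding s4_def s3_def s2_def using B1 by (auto simp: flagged_frame)
  have R5: "flagged s5 ''R'' = B - Y"
    unfolding s5_def flagged_Asg[OF ok4] using B4 BN by (auto simp: flagged_iff Y_def)
  have R6: "flagged s6 ''R'' = B - Y" unfolding s6_def by (subst flagged_frame) (simp_all add: R5)
  have Rn: "B - Y \<subseteq> {..<n}" using B(2) by blast
  have k6: "s6 ''k'' 0 = k" unfolding s6_def s5_def s4_def s3_def s2_def s1_def using k(1) by (auto simp: run_frame)
  have D7: "flagged s7 ''D'' = big_part G k (B - Y)"
  proof -
    have "flagged s7 ''D'' = {v. v < N \<and> s6 ''R'' v \<noteq> 0 \<and> k < 2 * card {w. w < N \<and> s6 ''R'' w \<noteq> 0 \<and> s6 ''r'' v = s6 ''r'' w}}"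
      unfolding s7_def flagged_Asg[OF ok6] using ok6 k6 by (simp add: mult_2)
    also have "\<dots> = {v \<in> B - Y. k < 2 * card {w \<in> B - Y. s6 ''r'' v = s6 ''r'' w}}"
      unfolding R6[symmetric] by (simp add: flagged_iff conj_assoc)
    also have "\<dots> = big_part G k (B - Y)"
    proof -
      have "{w \<in> B - Y. s6 ''r'' v = s6 ''r'' w} = component G (B - Y) v" if v: "v \<in> B - Y" for v
      proof (rule set_eqI)
        fix w
        show "w \<in> {w \<in> B - Y. s6 ''r'' v = s6 ''r'' w} \<longleftrightarrow> w \<in> component G (B - Y) v"
          using componentsP_spec[OF ok5 R5 Rn v, of w] component_subset[OF v, of G] unfolding s6_def by auto
      qed
      then show ?thesis unfolding big_part_def by auto
    qed
    finally show ?thesis .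
  qed
  have h: "s' ''h'' 0 = card (big_part G k (B - Y))"
  proof -
    have "s' ''h'' 0 = card {j. j < N \<and> s7 ''D'' j \<noteq> 0}"
      unfolding s' using run_Asg[OF ok7, of 0] ok7 N_bounds by simp
    also have "{j. j < N \<and> s7 ''D'' j \<noteq> 0} = flagged s7 ''D''" by (simp add: flagged_def)
    finally show ?thesis unfolding D7 .
  qed
  have fY: "flagged s' ''Y'' = Y" unfolding s' s7_def s6_def s5_def Y_def by (simp add: flagged_frame)
  have fD: "flagged s' ''D'' = big_part G k (B - Y)" unfolding s' using D7 by (simp add: flagged_frame)
  have fa: "s' (nm CHR ''a'' i) 0 = card (A i)" if "i \<in> {1..5}" for i
    unfolding s' s7_def s6_def s5_def s4_def s3_def s2_def using a[OF that] by (simp add: run_frame)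
  have fe: "cell s' (nm CHR ''e'' i) = e i" for i
    unfolding s' s7_def s6_def s5_def s4_def s3_def using e2[of i] by (simp add: cell_frame)
  have fg: "s' ''g'' 0 = g" unfolding s' s7_def s6_def s5_def s4_def using g3 by (simp add: run_frame)
  have e1: "\<forall>i\<in>{1..5}. \<forall>v. cell s' (nm CHR ''e'' i) v = 1 \<longleftrightarrow> v \<in> A i"
    unfolding fe using ball_timesD(2)[OF bt] by blast
  have final: "if g < n then Y \<noteq> {} \<and> induces_connected G Y \<and> (\<forall>i\<in>{1..5}. A i \<noteq> {} \<longrightarrow> Y \<inter> A i \<noteq> {})
      else (\<forall>i\<in>{1..5}. A i \<subseteq> U i) \<and> (\<forall>v\<in>B. \<exists>i\<in>{1..5}. A i \<noteq> {} \<and> v \<notin> U i) \<and>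
        Y = (\<Union>i\<in>{1..5}. ball_layer G B (U i))"
  proof (cases "g < n")
    case True
    note Yu = YT[OF True]
    have "g \<in> T 1" by (rule T(1)[OF _ True]) simp
    then have "g \<in> Y" unfolding Yu by (intro UN_I[of 1]) simp_all
    moreover have "induces_connected G Y" unfolding Yu
      by (rule union_connected[of _ g]) (use T(1,2)[OF _ True] in simp)
    moreover have "Y \<inter> A i \<noteq> {}" if i: "i \<in> {1..5}" "A i \<noteq> {}" for i
    proof -
      have "e i g > 0" using gyes[OF True] i by (simp add: Gd_def)
      then obtain x where "x \<in> T i" "e i x = 1" using T(5)[OF i(1) True] by blast
      then have "x \<in> A i" "x \<in> Y" using ball_timesD(2)[OF bt[OF i(1)]] i(1) unfolding Yu by blast+
      then show ?thesis by blast
    qed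
    ultimately show ?thesis unfolding if_P[OF True] by blast
  next
    case False
    have "\<exists>i\<in>{1..5}. A i \<noteq> {} \<and> v \<notin> U i" if "v \<in> B" for v
      using gno[OF False, of v] that unfolding Gd_def Ue by auto
    then show ?thesis unfolding if_not_P[OF False] using AU YL[OF False] by blast
  qed
  show ?thesis
    by (intro exI[of _ Y] exI[of _ U] conjI fY YB cardY fD h e1, use fa in blast, unfold fg, rule final)
qed

end

definition stepP :: st where
  "stepP = Sq searchP updateP"

lemma writes_stepP [simp]: "writes stepP = writes searchP \<union> writes updateP"
  by (simp add: stepP_def)

section \<open>Correctness of the update half of a step\<close>

context input
begin

text \<open>The program starts from the contacts outside \<open>D\<close>. Where its result is used,
  the contacts miss \<open>D\<close>, and the closure is the set \<open>C\<close> of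
  \<open>cut_step\<close>.\<close>

lemma closureP_spec:
  assumes s: "ok s" and B: "flagged s ''B'' = B" "B \<subseteq> {..<n}" and D: "flagged s ''D'' = D"
    and j: "s ''j'' 0 = j" "j > 0"
  shows "flagged (run closureP s) ''C'' = (G \<inter> (B - D) \<times> (B - D))\<^sup>* `` (touch G B (cell s ''l'') j \<inter> (B - D))"
proof -
  let ?A = "touch G B (cell s ''l'') j \<inter> (B - D)"
  let ?Cl = "(G \<inter> (B - D) \<times> (B - D))\<^sup>* `` ?A"
  let ?f = "run (Asg ''C'' (Or (At ''C'' 0) (And (And (At ''B'' 0) (Neg (At ''D'' 0))) (Sm 1 (And (At ''C'' 1) (Adj 1 0))))))"
  define s0 where "s0 = run (Asg ''C'' (And (And (At ''B'' 0) (Neg (At ''D'' 0))) (Sm 1 (And (Eq (At ''l'' 1) (Sc ''j'')) (Adj 1 0))))) s"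
  have ok0: "ok s0" unfolding s0_def by (rule ok_run[OF s]) simp
  have BN: "v < N" if "v \<in> B" for v using that B(2) N_bounds(1) by auto
  have inBD: "v < N \<and> s2 ''B'' v \<noteq> 0 \<and> s2 ''D'' v = 0 \<longleftrightarrow> v \<in> B - D" if "flagged s2 ''B'' = B" "flagged s2 ''D'' = D" for v s2
    using that by (auto simp: flagged_iff)
  have B0: "flagged s0 ''B'' = B" "flagged s0 ''D'' = D" unfolding s0_def using B(1) D by (simp_all add: flagged_frame)
  have C0: "flagged s0 ''C'' = ?A"
  proof -
    have "flagged s0 ''C'' = {v. (v < N \<and> s ''B'' v \<noteq> 0 \<and> s ''D'' v = 0) \<and> (\<exists>w<N. s ''l'' w = j \<and> (w, v) \<in> G)}"
      unfolding s0_def flagged_Asg[OF s] using s j(1) by auto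
    also have "\<dots> = {v. v \<in> B - D \<and> (\<exists>w. cell s ''l'' w = j \<and> (w, v) \<in> G)}"
      unfolding inBD[OF B(1) D] using j(2) by (auto simp: cell_def)
    also have "\<dots> = ?A" by (auto simp: touch_def)
    finally show ?thesis .
  qed
  define I where "I s2 \<longleftrightarrow> ok s2 \<and> flagged s2 ''B'' = B \<and> flagged s2 ''D'' = D \<and> ?A \<subseteq> flagged s2 ''C'' \<and> flagged s2 ''C'' \<subseteq> ?Cl" for s2
  define Dn where "Dn s2 \<longleftrightarrow> (\<forall>w\<in>flagged s2 ''C''. \<forall>v\<in>B - D. (w, v) \<in> G \<longrightarrow> v \<in> flagged s2 ''C'')" for s2
  have Cl: "?Cl \<subseteq> B - D"
  proof
    fix x assume "x \<in> ?Cl"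
    then obtain a where "a \<in> ?A" "(a, x) \<in> (G \<inter> (B - D) \<times> (B - D))\<^sup>*" by blast
    from this(2,1) show "x \<in> B - D" by (induction) auto
  qed
  have step: "flagged (?f s2) ''C'' = flagged s2 ''C'' \<union> {v \<in> B - D. \<exists>w\<in>flagged s2 ''C''. (w, v) \<in> G}" if i2: "I s2" for s2
  proof -
    have o: "ok s2" "flagged s2 ''B'' = B" "flagged s2 ''D'' = D" using i2 by (simp_all add: I_def)
    have "flagged (?f s2) ''C'' = {v. v \<in> flagged s2 ''C'' \<or>
        (v < N \<and> s2 ''B'' v \<noteq> 0 \<and> s2 ''D'' v = 0) \<and> (\<exists>w. w \<in> flagged s2 ''C'' \<and> (w, v) \<in> G)}"
      unfolding flagged_Asg[OF o(1)] using o(1) by (auto simp: flagged_iff)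
    then show ?thesis unfolding inBD[OF o(2,3)] by blast
  qed
  have "I ((?f ^^ N) s0) \<and> Dn ((?f ^^ N) s0)"
  proof (rule iterate_until[where \<mu> = "\<lambda>s2. n - card (flagged s2 ''C'')"])
    show "I s0" unfolding I_def using ok0 B0 C0 by auto
    fix s2 assume i2: "I s2"
    have Cfin: "flagged s2 ''C'' \<subseteq> ?Cl" using i2 by (simp add: I_def)
    have newCl: "flagged (?f s2) ''C'' \<subseteq> ?Cl"
    proof
      fix v assume "v \<in> flagged (?f s2) ''C''"
      then consider "v \<in> flagged s2 ''C''" | w where "v \<in> B - D" "w \<in> flagged s2 ''C''" "(w, v) \<in> G"
        unfolding step[OF i2] by blast
      then show "v \<in> ?Cl"
      proof cases
        case 2
        then obtain a where a: "a \<in> ?A" "(a, w) \<in> (G \<inter> (B - D) \<times> (B - D))\<^sup>*" using Cfin by blast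
        have "w \<in> B - D" using 2(2) Cfin Cl by blast
        then have "(w, v) \<in> G \<inter> (B - D) \<times> (B - D)" using 2 by simp
        with a(2) have "(a, v) \<in> (G \<inter> (B - D) \<times> (B - D))\<^sup>*" by (rule rtrancl_into_rtrancl)
        then show ?thesis using a(1) by blast
      qed (use Cfin in blast)
    qed
    have "ok (?f s2)" by (rule ok_run) (use i2 in \<open>simp_all add: I_def\<close>)
    moreover have "flagged (?f s2) ''B'' = B" "flagged (?f s2) ''D'' = D"
      using i2 by (simp_all add: flagged_frame I_def)
    moreover have "?A \<subseteq> flagged (?f s2) ''C''" unfolding step[OF i2] using i2 unfolding I_def by blast
    ultimately show "I (?f s2)" using newCl unfolding I_def by blast
    show "n - card (flagged (?f s2) ''C'') < n - card (flagged s2 ''C'')" if nd: "\<not> Dn s2"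
    proof -
      obtain w v where "w \<in> flagged s2 ''C''" "v \<in> B - D" "(w, v) \<in> G" "v \<notin> flagged s2 ''C''"
        using nd unfolding Dn_def by blast
      then have "flagged s2 ''C'' \<subset> flagged (?f s2) ''C''" unfolding step[OF i2] by blast
      then have "card (flagged s2 ''C'') < card (flagged (?f s2) ''C'')" by (intro psubset_card_mono) simp
      moreover have "card (flagged (?f s2) ''C'') \<le> card {..<n}"
        by (rule card_mono) (use newCl Cl B(2) in auto)
      ultimately show ?thesis by simp
    qed
    show "Dn (?f s2)" if d: "Dn s2"
    proof -
      have "flagged (?f s2) ''C'' = flagged s2 ''C''" unfolding step[OF i2] using d unfolding Dn_def by blast
      then show ?thesis using d unfolding Dn_def by simp
    qed
  qed (use N_bounds in simp)
  moreover have "run closureP s = (?f ^^ N) s0"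
    unfolding closureP_def run.simps(2) s0_def[symmetric] run_It[OF ok0] ..
  ultimately have fin: "I (run closureP s)" "Dn (run closureP s)" by simp_all
  have "?Cl \<subseteq> flagged (run closureP s) ''C''"
  proof
    fix x assume "x \<in> ?Cl"
    then obtain a where a: "a \<in> ?A" "(a, x) \<in> (G \<inter> (B - D) \<times> (B - D))\<^sup>*" by blast
    have "a \<in> flagged (run closureP s) ''C''" using fin(1) a(1) unfolding I_def by blast
    with a(2) show "x \<in> flagged (run closureP s) ''C''"
      by (induction) (use fin(2) in \<open>auto simp: Dn_def\<close>)
  qed
  moreover have "flagged (run closureP s) ''C'' \<subseteq> ?Cl" using fin(1) by (simp add: I_def)
  ultimately show ?thesis by (rule equalityI[rotated])
qed

text \<open>\<open>f\<close> and \<open>j\<close> mean something only if a suitable label exists, so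
  each is promised under that condition; \<open>free_slot_exists\<close> and
  \<open>cut_misses_touch\<close> supply it later.\<close>

lemma updateP_spec:
  assumes s: "ok s" and B: "flagged s ''B'' = B" "B \<subseteq> {..<n}" and D: "flagged s ''D'' = D" and Y: "flagged s ''Y'' = Y"
    and K: "flagged s ''K'' = K" and lab: "cell s ''l'' = lab"
  defines "A \<equiv> touch G B lab"
  assumes counts: "\<forall>i\<in>{1..5}. s (nm CHR ''a'' i) 0 = card (A i)"
    and times: "\<forall>i\<in>{1..5}. \<forall>v. cell s (nm CHR ''e'' i) v = 1 \<longleftrightarrow> v \<in> A i"
  defines "s' \<equiv> run updateP s"
  shows "\<exists>f j C. ((\<exists>i\<in>{1..5}. A i = {}) \<longrightarrow> f \<in> {1..5} \<and> A f = {}) \<and>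
     ((\<exists>i\<in>{1..5}. A i \<noteq> {} \<and> A i \<inter> D = {}) \<longrightarrow> j \<in> {1..5} \<and> A j \<noteq> {} \<and> A j \<inter> D = {} \<and>
        C = (G \<inter> (B - D) \<times> (B - D))\<^sup>* `` A j) \<and>
     flagged s' ''S'' = flagged s ''S'' \<union> (if s ''h'' 0 = 0 then Y \<union> {v \<in> K - B. \<exists>w\<in>B. (w, v) \<in> G} else {}) \<and>
     cell s' ''l'' = (if s ''g'' 0 < n then (\<lambda>v. if v \<in> Y then f else if lab v = f then 0 else lab v)
        else (\<lambda>v. if v \<in> C then j else lab v)) \<and>
     flagged s' ''B'' = (if s ''h'' 0 = 0 then {} else if s ''g'' 0 < n then D else B - C)"
proof -
  note a = counts[rule_format] and e = times[rule_format]
  define t1 where "t1 = run (Asg ''f'' (firstE (\<lambda>i. Neg (Sc (nm CHR ''a'' i))))) s"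
  define t2 where "t2 = run (Asg ''j'' (firstE (\<lambda>i. And (Sc (nm CHR ''a'' i)) (Neg (Sm 1 (And (At ''D'' 1) (Eq (At (nm CHR ''e'' i) 1) (Cn 1)))))))) t1"
  define t3 where "t3 = run closureP t2"
  define t4 where "t4 = run (Asg ''S'' (Or (At ''S'' 0) (And (Neg (Sc ''h'')) (Or (At ''Y'' 0)
         (And (And (At ''K'' 0) (Neg (At ''B'' 0))) (Sm 1 (And (At ''B'' 1) (Adj 1 0)))))))) t3"
  define t5 where "t5 = run (Asg ''l'' (If (Lt (Sc ''g'') (Sc ''n'')) (If (At ''Y'' 0) (Sc ''f'') (If (Eq (At ''l'' 0) (Sc ''f'')) (Cn 0) (At ''l'' 0)))
         (If (At ''C'' 0) (Sc ''j'') (At ''l'' 0)))) t4"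
  have s': "s' = run (Asg ''B'' (And (Sc ''h'') (If (Lt (Sc ''g'') (Sc ''n'')) (At ''D'' 0) (And (At ''B'' 0) (Neg (At ''C'' 0)))))) t5"
    unfolding s'_def updateP_def run.simps(2) t1_def t2_def t3_def t4_def t5_def ..
  have ok1: "ok t1" unfolding t1_def by (rule ok_run[OF s]) simp
  have ok2: "ok t2" unfolding t2_def by (rule ok_run[OF ok1]) simp
  have ok3: "ok t3" unfolding t3_def by (rule ok_run[OF ok2]) simp
  have ok4: "ok t4" unfolding t4_def by (rule ok_run[OF ok3]) simp
  have ok5: "ok t5" unfolding t5_def by (rule ok_run[OF ok4]) simp
  have finB: "finite B" using B(2) finite_subset by blast
  have finA: "finite (A i)" for i using finB by (simp add: A_def touch_def)
  have AB: "A i \<subseteq> B" for i by (auto simp: A_def touch_def)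
  have BN: "v < N" if "v \<in> B" for v using that B(2) N_bounds(1) by auto
  define f where "f = t1 ''f'' 0"
  have f: "f \<in> {1..5} \<and> A f = {}" if ex: "\<exists>i\<in>{1..5}. A i = {}"
  proof -
    have h: "holds (Neg (Sc (nm CHR ''a'' i))) ((\<lambda>_. 0)(0 := 0)) s \<longleftrightarrow> A i = {}" if "i \<in> {1..5}" for i
      using a[OF that] finA by simp
    have "f = ev (firstE (\<lambda>i. Neg (Sc (nm CHR ''a'' i)))) ((\<lambda>_. 0)(0 := 0)) s"
      unfolding f_def t1_def by (rule run_Asg[OF s]) (use N_bounds in simp)
    moreover have "\<exists>i\<in>{1..5}. holds (Neg (Sc (nm CHR ''a'' i))) ((\<lambda>_. 0)(0 := 0)) s" using ex h by blast
    ultimately have "f \<in> {1..5} \<and> holds (Neg (Sc (nm CHR ''a'' f))) ((\<lambda>_. 0)(0 := 0)) s"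
      using ev_firstE[of "\<lambda>i. Neg (Sc (nm CHR ''a'' i))"] by simp
    then show ?thesis using h by blast
  qed
  have fr1: "t1 ''D'' = s ''D''" "t1 (nm CHR ''a'' i) = s (nm CHR ''a'' i)" "t1 (nm CHR ''e'' i) = s (nm CHR ''e'' i)" for i
    unfolding t1_def by (simp_all add: run_frame)
  define j where "j = t2 ''j'' 0"
  have j: "j \<in> {1..5} \<and> A j \<noteq> {} \<and> A j \<inter> D = {}" if ex: "\<exists>i\<in>{1..5}. A i \<noteq> {} \<and> A i \<inter> D = {}"
  proof -
    let ?Q = "\<lambda>i. And (Sc (nm CHR ''a'' i)) (Neg (Sm 1 (And (At ''D'' 1) (Eq (At (nm CHR ''e'' i) 1) (Cn 1)))))"
    have h: "holds (?Q i) ((\<lambda>_. 0)(0 := 0)) t1 \<longleftrightarrow> A i \<noteq> {} \<and> A i \<inter> D = {}" if i: "i \<in> {1..5}" for i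
    proof -
      \<comment> \<open>Time \<open>1\<close> marks the contacts, so whether \<open>A i\<close>
        meets \<open>D\<close> is read off the ball.\<close>
      have eq: "v < N \<and> s ''D'' v \<noteq> 0 \<and> s (nm CHR ''e'' i) v = 1 \<longleftrightarrow> v \<in> A i \<inter> D" for v
        using e[OF i, of v] AB[of i] BN[of v] D by (auto simp: flagged_iff cell_def)
      have "holds (?Q i) ((\<lambda>_. 0)(0 := 0)) t1 \<longleftrightarrow> card (A i) \<noteq> 0 \<and> \<not> (\<exists>v. v < N \<and> s ''D'' v \<noteq> 0 \<and> s (nm CHR ''e'' i) v = 1)"
        using ok1 a[OF i] by (simp add: fr1)
      then show ?thesis unfolding eq using finA by auto
    qed
    have "j = ev (firstE ?Q) ((\<lambda>_. 0)(0 := 0)) t1"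
      unfolding j_def t2_def by (rule run_Asg[OF ok1]) (use N_bounds in simp)
    moreover have "\<exists>i\<in>{1..5}. holds (?Q i) ((\<lambda>_. 0)(0 := 0)) t1" using ex h by blast
    ultimately have "j \<in> {1..5} \<and> holds (?Q j) ((\<lambda>_. 0)(0 := 0)) t1"
      using ev_firstE[of ?Q] by simp
    then show ?thesis using h by blast
  qed
  define C where "C = flagged t3 ''C''"
  have fr2: "flagged t2 ''B'' = B" "flagged t2 ''D'' = D" "cell t2 ''l'' = lab"
    unfolding t2_def t1_def using B D lab by (simp_all add: flagged_frame cell_frame)
  have C: "C = (G \<inter> (B - D) \<times> (B - D))\<^sup>* `` A j" if ex: "\<exists>i\<in>{1..5}. A i \<noteq> {} \<and> A i \<inter> D = {}"
  proof -
    have jj: "j > 0" "A j \<inter> D = {}" using j[OF ex] by auto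
    have "A j \<inter> (B - D) = A j" using jj(2) AB[of j] by blast
    then show ?thesis
      using closureP_spec[OF ok2 fr2(1) B(2) fr2(2) j_def[symmetric] jj(1)] unfolding C_def t3_def fr2(3) A_def by simp
  qed
  have fr3: "t3 ''S'' = s ''S''" "t3 ''h'' = s ''h''" "t3 ''Y'' = s ''Y''" "t3 ''K'' = s ''K''" "t3 ''B'' = s ''B''"
    unfolding t3_def t2_def t1_def by (simp_all add: run_frame)
  have S: "flagged s' ''S'' = flagged s ''S'' \<union> (if s ''h'' 0 = 0 then Y \<union> {v \<in> K - B. \<exists>w\<in>B. (w, v) \<in> G} else {})"
  proof -
    have "flagged s' ''S'' = flagged t4 ''S''" unfolding s' t5_def by (simp add: flagged_frame)
    also have "\<dots> = {v. v < N \<and> (s ''S'' v \<noteq> 0 \<or> (s ''h'' 0 = 0 \<and> (s ''Y'' v \<noteq> 0 \<or>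
        (s ''K'' v \<noteq> 0 \<and> s ''B'' v = 0 \<and> (\<exists>w<N. s ''B'' w \<noteq> 0 \<and> (w, v) \<in> G)))))}"
      unfolding t4_def flagged_Asg[OF ok3] using ok3 by (simp add: fr3)
    also have "\<dots> = flagged s ''S'' \<union> (if s ''h'' 0 = 0 then flagged s ''Y'' \<union> {v \<in> flagged s ''K'' - flagged s ''B''. \<exists>w\<in>flagged s ''B''. (w, v) \<in> G} else {})"
      by (auto simp: flagged_iff)
    finally show ?thesis unfolding Y K B(1) .
  qed
  have fr4: "t4 ''g'' = s ''g''" "t4 ''Y'' = s ''Y''" "t4 ''f'' 0 = f" "t4 ''j'' 0 = j" "t4 ''l'' = s ''l''" "t4 ''C'' = t3 ''C''"
    unfolding t4_def t3_def f_def j_def t2_def t1_def by (simp_all add: run_frame)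
  have L: "cell s' ''l'' = (if s ''g'' 0 < n then (\<lambda>v. if v \<in> Y then f else if lab v = f then 0 else lab v)
        else (\<lambda>v. if v \<in> C then j else lab v))"
  proof
    fix v
    have "cell s' ''l'' v = cell t5 ''l'' v" unfolding s' by (simp add: cell_frame)
    also have "\<dots> = (if s ''g'' 0 < n then (\<lambda>v. if v \<in> Y then f else if lab v = f then 0 else lab v)
        else (\<lambda>v. if v \<in> C then j else lab v)) v"
    proof (cases "v < N")
      case False
      then have "v \<notin> Y" "v \<notin> C" "lab v = 0" "cell t5 ''l'' v = 0"
        using Y lab by (auto simp: C_def flagged_iff cell_def)
      then show ?thesis by simp
    next
      case True
      have "s ''Y'' v \<noteq> 0 \<longleftrightarrow> v \<in> Y" "t3 ''C'' v \<noteq> 0 \<longleftrightarrow> v \<in> C" "s ''l'' v = lab v"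
        using True Y lab by (auto simp: C_def flagged_iff cell_def)
      then show ?thesis unfolding cell_def t5_def using run_Asg[OF ok4 True] ok4 True by (simp add: fr4)
    qed
    finally show "cell s' ''l'' v = (if s ''g'' 0 < n then (\<lambda>v. if v \<in> Y then f else if lab v = f then 0 else lab v)
        else (\<lambda>v. if v \<in> C then j else lab v)) v" .
  qed
  have fr5: "t5 ''h'' = s ''h''" "t5 ''g'' = s ''g''" "t5 ''D'' = s ''D''" "t5 ''B'' = s ''B''" "t5 ''C'' = t3 ''C''"
    unfolding t5_def t4_def t3_def t2_def t1_def by (simp_all add: run_frame)
  have BB: "flagged s' ''B'' = (if s ''h'' 0 = 0 then {} else if s ''g'' 0 < n then D else B - C)"
  proof -
    have "flagged s' ''B'' = {v. v < N \<and> s ''h'' 0 \<noteq> 0 \<and> (if s ''g'' 0 < n then s ''D'' v \<noteq> 0 else s ''B'' v \<noteq> 0 \<and> t3 ''C'' v = 0)}"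
      unfolding s' flagged_Asg[OF ok5] using ok5 by (simp add: fr5)
    also have "\<dots> = (if s ''h'' 0 = 0 then {} else if s ''g'' 0 < n then flagged s ''D'' else flagged s ''B'' - flagged t3 ''C'')"
      by (auto simp: flagged_iff)
    finally show ?thesis unfolding D B(1) C_def .
  qed
  show ?thesis
  proof (rule exI[of _ f], rule exI[of _ j], rule exI[of _ C], intro conjI)
    show "(\<exists>i\<in>{1..5}. A i = {}) \<longrightarrow> f \<in> {1..5} \<and> A f = {}" by (rule impI) (rule f)
    show "(\<exists>i\<in>{1..5}. A i \<noteq> {} \<and> A i \<inter> D = {}) \<longrightarrow> j \<in> {1..5} \<and> A j \<noteq> {} \<and> A j \<inter> D = {} \<and>
        C = (G \<inter> (B - D) \<times> (B - D))\<^sup>* `` A j"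
    proof
      assume ex: "\<exists>i\<in>{1..5}. A i \<noteq> {} \<and> A i \<inter> D = {}"
      show "j \<in> {1..5} \<and> A j \<noteq> {} \<and> A j \<inter> D = {} \<and> C = (G \<inter> (B - D) \<times> (B - D))\<^sup>* `` A j"
        using j[OF ex] C[OF ex] by simp
    qed
  qed (rule S L BB)+
qed

end

section \<open>The complete program\<close>

definition outsideE :: ex where
  "outsideE = And (Lt (Ix 0) (Sc ''n'')) (Neg (At ''S'' 0))"

text \<open>A component of size \<open>q\<close> is large if \<open>n * n < q * (q * q)\<close>,
  that is \<open>q > n powr (2/3)\<close>, stated without roots. If there is none, \<open>K\<close>
  is empty and the search that follows idles.\<close>

definition pickP :: st where
  "pickP = Sq (Asg ''R'' outsideE) (Sq componentsP
    (Sq (Asg ''c'' (Cnt 1 (And (At ''R'' 1) (Eq (At ''r'' 0) (At ''r'' 1)))))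
    (Sq (Asg ''g'' (Mu 1 2 (And (At ''R'' 2) (Lt (Mul (Sc ''n'') (Sc ''n'')) (Mul (At ''c'' 2) (Mul (At ''c'' 2) (At ''c'' 2)))))))
    (Sq (Asg ''K'' (And (And (At ''R'' 0) (Lt (Sc ''g'') (Sc ''n''))) (Eq (At ''r'' 0) (Ar ''r'' (Sc ''g'')))))
    (Sq (Asg ''B'' (At ''K'' 0)) (Sq (Asg ''l'' (Cn 0)) (Asg ''k'' (Cnt 1 (At ''K'' 1)))))))))"

definition outerP :: st where
  "outerP = Sq pickP (It stepP)"

text \<open>Each productive round of \<open>outerP\<close> adds a vertex to \<open>S\<close>, so
  \<open>N\<close> rounds suffice. In the last assignment the cell number is an edge number, not a
  vertex.\<close>

definition mainP :: st where
  "mainP = Sq (It outerP) (Sq (Asg ''R'' outsideE) (Sq componentsP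
    (Asg ''color'' (If (Or (Ar ''S'' (At ''u'' 0)) (Ar ''S'' (At ''v'' 0))) (Cn 0) (Pl (Cn 1) (Ar ''r'' (At ''u'' 0)))))))"

lemma writes_pickP [simp]: "writes pickP = {''R'', ''r'', ''c'', ''g'', ''K'', ''B'', ''l'', ''k''}"
  by (auto simp: pickP_def)

lemma writes_outerP [simp]: "writes outerP = writes pickP \<union> writes stepP"
  by (simp add: outerP_def)

lemma well_formed_mainP: "well_formed mainP"
proof -
  have "reads searchP \<inter> reserved = {}" "reads updateP \<inter> reserved = {}" "reads pickP \<inter> reserved = {}"
    by (auto simp: reserved_def searchP_def updateP_def closureP_def pickP_def outsideE_def)
  moreover have "writes searchP \<inter> insert ''N'' reserved = {}" "writes updateP \<inter> insert ''N'' reserved = {}"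
    "writes pickP \<inter> insert ''N'' reserved = {}"
    by (auto simp: reserved_def)
  ultimately show ?thesis
    unfolding well_formed_def mainP_def outerP_def stepP_def outsideE_def
    by (simp add: Int_Un_distrib2) (auto simp: reserved_def)
qed

section \<open>Correctness on planar inputs\<close>

locale planar_input = input +
  assumes planar: "planar_graph {..<n} (edges_of es)"
begin

lemma search: "K \<subseteq> {..<n} \<Longrightarrow> separator_search G K {..<n}"
  using planar_imp_no_K33_minor[OF planar] symG
  by unfold_locales (auto simp: G_def intro: finite_subset)

definition separates :: "nat set \<Rightarrow> nat set \<Rightarrow> bool" where
  "separates K X \<longleftrightarrow> X \<subseteq> K \<and> real (card X) \<le> 66 * sqrt (card K) \<and>
     (\<forall>v\<in>K - X. 2 * card (component G (K - X) v) \<le> card K)"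

text \<open>An empty \<open>D\<close> leads to \<open>search_final\<close>, a common vertex of the
  balls to \<open>tree_step\<close>, and its absence to \<open>cut_step\<close>. The second claim is
  what idle rounds rely on: an empty \<open>B\<close> stays empty and leaves \<open>S\<close>
  alone.\<close>

lemma stepP_spec:
  assumes s: "ok s" and K: "flagged s ''K'' = K" "K \<subseteq> {..<n}" "s ''k'' 0 = card K"
    and B: "flagged s ''B'' = B" "B \<subseteq> K" and S: "flagged s ''S'' = S" and lab: "cell s ''l'' = lab"
  defines "s' \<equiv> run stepP s"
  shows "search_inv G K B lab \<Longrightarrow>
      (flagged s' ''S'' = S \<and> search_inv G K (flagged s' ''B'') (cell s' ''l'') \<and> card (flagged s' ''B'') < card B) \<or>
      (flagged s' ''B'' = {} \<and> (\<exists>X. flagged s' ''S'' = S \<union> X \<and> separates K X))"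
    and "B = {} \<Longrightarrow> flagged s' ''B'' = {} \<and> flagged s' ''S'' = S"
proof -
  interpret separator_search G K "{..<n}" by (rule search[OF K(2)])
  define s1 where "s1 = run searchP s"
  have s': "s' = run updateP s1" by (simp add: s'_def s1_def stepP_def run.simps(2))
  have ok1: "ok s1" unfolding s1_def by (rule ok_run[OF s]) auto
  have Bn: "B \<subseteq> {..<n}" using B(2) K(2) by blast
  have finB: "finite B" using Bn finite_subset by blast
  have cB: "card B \<le> card K" "card K \<le> n"
    using card_mono[OF finK B(2)] card_mono[OF finite_lessThan K(2)] by simp_all
  obtain Y U where
    Y: "flagged s1 ''Y'' = Y" "Y \<subseteq> B" "real (card Y) \<le> 11 * sqrt (card K)" and
    D: "flagged s1 ''D'' = big_part G (card K) (B - Y)" and h: "s1 ''h'' 0 = card (big_part G (card K) (B - Y))" and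
    a: "\<forall>i\<in>{1..5}. s1 (nm CHR ''a'' i) 0 = card (touch G B lab i)" and
    e: "\<forall>i\<in>{1..5}. \<forall>v. cell s1 (nm CHR ''e'' i) v = 1 \<longleftrightarrow> v \<in> touch G B lab i" and
    g: "if s1 ''g'' 0 < n then Y \<noteq> {} \<and> induces_connected G Y \<and> (\<forall>i\<in>{1..5}. touch G B lab i \<noteq> {} \<longrightarrow> Y \<inter> touch G B lab i \<noteq> {})
      else (\<forall>i\<in>{1..5}. touch G B lab i \<subseteq> U i) \<and> (\<forall>v\<in>B. \<exists>i\<in>{1..5}. touch G B lab i \<noteq> {} \<and> v \<notin> U i) \<and>
        Y = (\<Union>i\<in>{1..5}. ball_layer G B (U i))"
    using searchP_spec[OF s B(1) Bn K(3) cB] unfolding s1_def[symmetric] lab by (elim exE conjE) (rule that)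
  define D where "D = big_part G (card K) (B - Y)"
  have fr: "flagged s1 ''B'' = B" "flagged s1 ''K'' = K" "cell s1 ''l'' = lab" "flagged s1 ''S'' = S"
    unfolding s1_def using B(1) K(1) lab S by (simp_all add: flagged_frame cell_frame image_iff)
  obtain f j C where
    f: "(\<exists>i\<in>{1..5}. touch G B lab i = {}) \<longrightarrow> f \<in> {1..5} \<and> touch G B lab f = {}" and
    j: "(\<exists>i\<in>{1..5}. touch G B lab i \<noteq> {} \<and> touch G B lab i \<inter> D = {}) \<longrightarrow> j \<in> {1..5} \<and> touch G B lab j \<noteq> {} \<and>
        touch G B lab j \<inter> D = {} \<and> C = (G \<inter> (B - D) \<times> (B - D))\<^sup>* `` touch G B lab j" and
    S': "flagged s' ''S'' = S \<union> (if s1 ''h'' 0 = 0 then Y \<union> {v \<in> K - B. \<exists>w\<in>B. (w, v) \<in> G} else {})" and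
    l': "cell s' ''l'' = (if s1 ''g'' 0 < n then (\<lambda>v. if v \<in> Y then f else if lab v = f then 0 else lab v)
        else (\<lambda>v. if v \<in> C then j else lab v))" and
    B': "flagged s' ''B'' = (if s1 ''h'' 0 = 0 then {} else if s1 ''g'' 0 < n then D else B - C)"
    using updateP_spec[OF ok1 fr(1) Bn D[folded D_def] Y(1) fr(2,3) a e]
    unfolding s'[symmetric] fr(4) by (elim exE conjE) (rule that)
  have finD: "finite D" using finB by (simp add: D_def big_part_def)
  have h0: "s1 ''h'' 0 = 0 \<longleftrightarrow> D = {}" unfolding h D_def[symmetric] using finD by simp
  {
    assume inv: "search_inv G K B lab"
    show "(flagged s' ''S'' = S \<and> search_inv G K (flagged s' ''B'') (cell s' ''l'') \<and> card (flagged s' ''B'') < card B) \<or>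
      (flagged s' ''B'' = {} \<and> (\<exists>X. flagged s' ''S'' = S \<union> X \<and> separates K X))"
    proof (cases "D = {}")
      case True
      let ?X = "Y \<union> {v \<in> K - B. \<exists>w\<in>B. (w, v) \<in> G}"
      note fin = search_final[OF inv Y(2,3) True[unfolded D_def] refl]
      have "separates K ?X" unfolding separates_def using fin Y(2) B(2) by auto
      moreover have "flagged s' ''B'' = {}" "flagged s' ''S'' = S \<union> ?X" using B' S' h0 True by simp_all
      ultimately show ?thesis by blast
    next
      case False
      then have hn: "s1 ''h'' 0 \<noteq> 0" using h0 by simp
      have SS: "flagged s' ''S'' = S" using S' hn by simp
      show ?thesis
      proof (cases "s1 ''g'' 0 < n")
        case True
        then have BD: "flagged s' ''B'' = D" and LL: "cell s' ''l'' = (\<lambda>v. if v \<in> Y then f else if lab v = f then 0 else lab v)"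
          using B' l' hn by simp_all
        have gg: "Y \<noteq> {}" "induces_connected G Y" "\<And>i. i \<in> {1..5} \<Longrightarrow> touch G B lab i \<noteq> {} \<Longrightarrow> Y \<inter> touch G B lab i \<noteq> {}"
          using g unfolding if_P[OF True] by blast+
        have ff: "f \<in> {1..5}" "touch G B lab f = {}"
          using f free_slot_exists[OF inv Y(2) gg(2,3)] by blast+
        note ts = tree_step[OF inv Y(2) gg(2,1) Y(3) gg(3) ff D_def False]
        show ?thesis unfolding BD LL using SS ts by blast
      next
        case gF: False
        then have BD: "flagged s' ''B'' = B - C" and LL: "cell s' ''l'' = (\<lambda>v. if v \<in> C then j else lab v)"
          using B' l' hn by simp_all
        have gg: "\<And>i. i \<in> {1..5} \<Longrightarrow> touch G B lab i \<subseteq> U i" "\<And>v. v \<in> B \<Longrightarrow> \<exists>i\<in>{1..5}. touch G B lab i \<noteq> {} \<and> v \<notin> U i"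
          "Y = (\<Union>i\<in>{1..5}. ball_layer G B (U i))"
          using g unfolding if_not_P[OF gF] by blast+
        have "\<exists>i\<in>{1..5}. touch G B lab i \<noteq> {} \<and> touch G B lab i \<inter> D = {}"
          by (rule cut_misses_touch[OF B(2) gg D_def False])
        then have jj: "j \<in> {1..5}" "touch G B lab j \<noteq> {}" "touch G B lab j \<inter> D = {}"
          "C = (G \<inter> (B - D) \<times> (B - D))\<^sup>* `` touch G B lab j"
          using j by blast+
        note cs = cut_step[OF inv Y(2,3) D_def False jj]
        show ?thesis unfolding BD LL using SS cs by blast
      qed
    qed
  }
  assume BE: "B = {}"
  have "Y = {}" using Y(2) BE by simp
  moreover have "D = {}" unfolding D_def BE by (simp add: big_part_def)
  ultimately show "flagged s' ''B'' = {} \<and> flagged s' ''S'' = S" using B' S' h0 BE by simp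
qed

lemma stepP_frame:
  assumes "ok s"
  shows "ok (run stepP s)" "flagged (run stepP s) ''K'' = flagged s ''K''" "run stepP s ''k'' = s ''k''"
proof -
  show "ok (run stepP s)" by (rule ok_run[OF assms]) auto
  show "flagged (run stepP s) ''K'' = flagged s ''K''" by (rule flagged_frame) auto
  show "run stepP s ''k'' = s ''k''" by (rule run_frame) auto
qed

text \<open>\<open>card B\<close> falls in every round until the separator has been added to
  \<open>S\<close>, and it starts below \<open>N\<close>.\<close>

lemma inner_spec:
  assumes s: "ok s" and K: "flagged s ''K'' = K" "K \<subseteq> {..<n}" "s ''k'' 0 = card K"
    and B: "flagged s ''B'' = K" and S: "flagged s ''S'' = S" and lab: "cell s ''l'' = (\<lambda>_. 0)"
  shows "K \<noteq> {} \<Longrightarrow> induces_connected G K \<Longrightarrow> \<exists>X. flagged (run (It stepP) s) ''S'' = S \<union> X \<and> separates K X"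
    and "K = {} \<Longrightarrow> flagged (run (It stepP) s) ''S'' = S"
proof -
  interpret separator_search G K "{..<n}" by (rule search[OF K(2)])
  {
    assume ne: "K \<noteq> {}" and con: "induces_connected G K"
    define F where "F s2 \<longleftrightarrow> flagged s2 ''B'' = {} \<and> (\<exists>X. flagged s2 ''S'' = S \<union> X \<and> separates K X)" for s2
    define I where "I s2 \<longleftrightarrow> ok s2 \<and> flagged s2 ''K'' = K \<and> s2 ''k'' 0 = card K \<and>
      (flagged s2 ''S'' = S \<and> search_inv G K (flagged s2 ''B'') (cell s2 ''l'') \<or> F s2)" for s2
    have "I ((run stepP ^^ N) s) \<and> F ((run stepP ^^ N) s)"
    proof (rule iterate_until[where \<mu> = "\<lambda>s2. card (flagged s2 ''B'')"])
      show "I s" unfolding I_def using s K S search_inv_start[OF con ne] unfolding B lab by blast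
      fix s2 assume i2: "I s2"
      have o: "ok s2" "flagged s2 ''K'' = K" "s2 ''k'' 0 = card K" using i2 by (simp_all add: I_def)
      have o': "ok (run stepP s2)" "flagged (run stepP s2) ''K'' = K" "run stepP s2 ''k'' 0 = card K"
        using stepP_frame[OF o(1)] o(2,3) by simp_all
      have stay: "F (run stepP s2)" if f2: "F s2"
      proof -
        obtain X where X: "flagged s2 ''B'' = {}" "flagged s2 ''S'' = S \<union> X" "separates K X"
          using f2 unfolding F_def by blast
        have "flagged (run stepP s2) ''B'' = {} \<and> flagged (run stepP s2) ''S'' = S \<union> X"
          by (rule stepP_spec(2)[OF o(1,2) K(2) o(3) X(1) _ X(2) refl]) simp_all
        then show ?thesis unfolding F_def using X(3) by blast
      qed
      have go: "(flagged (run stepP s2) ''S'' = S \<and> search_inv G K (flagged (run stepP s2) ''B'') (cell (run stepP s2) ''l'') \<and>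
          card (flagged (run stepP s2) ''B'') < card (flagged s2 ''B'')) \<or> F (run stepP s2)"
        if nf: "\<not> F s2"
      proof -
        have i: "flagged s2 ''S'' = S" "search_inv G K (flagged s2 ''B'') (cell s2 ''l'')"
          using i2 nf by (simp_all add: I_def)
        show ?thesis unfolding F_def
          by (rule stepP_spec(1)[OF o(1,2) K(2) o(3) refl search_inv_subset[OF i(2)] i(1) refl i(2)])
      qed
      show "I (run stepP s2)" unfolding I_def using o' stay go by blast
      show "F (run stepP s2)" if "F s2" using stay that .
      show "card (flagged (run stepP s2) ''B'') < card (flagged s2 ''B'')" if nf: "\<not> F s2"
      proof -
        have i: "search_inv G K (flagged s2 ''B'') (cell s2 ''l'')" using i2 nf by (simp add: I_def)
        have "card (flagged s2 ''B'') > 0" using search_inv_big[OF i] by simp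
        then show ?thesis using go[OF nf] by (auto simp: F_def)
      qed
    next
      show "card (flagged s ''B'') \<le> N"
        unfolding B using card_mono[OF finite_lessThan K(2)] N_bounds(1) by simp
    qed
    then show "\<exists>X. flagged (run (It stepP) s) ''S'' = S \<union> X \<and> separates K X"
      unfolding run_It[OF s] F_def by blast
  }
  assume KE: "K = {}"
  have "ok ((run stepP ^^ m) s) \<and> flagged ((run stepP ^^ m) s) ''K'' = K \<and> (run stepP ^^ m) s ''k'' 0 = card K \<and>
    flagged ((run stepP ^^ m) s) ''B'' = {} \<and> flagged ((run stepP ^^ m) s) ''S'' = S" for m
  proof (induction m)
    case 0
    then show ?case using s K B S KE by simp
  next
    case (Suc m)
    let ?t = "(run stepP ^^ m) s"
    have o: "ok ?t" "flagged ?t ''K'' = K" "?t ''k'' 0 = card K" "flagged ?t ''B'' = {}" "flagged ?t ''S'' = S"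
      using Suc by simp_all
    have "flagged (run stepP ?t) ''B'' = {} \<and> flagged (run stepP ?t) ''S'' = S"
      by (rule stepP_spec(2)[OF o(1,2) K(2) o(3,4) _ o(5) refl]) simp_all
    then show ?case using stepP_frame[OF o(1)] o(2,3) by simp
  qed
  then show "flagged (run (It stepP) s) ''S'' = S" unfolding run_It[OF s] by blast
qed


lemma outside_spec:
  assumes s: "ok s" and S: "flagged s ''S'' = S"
  shows "flagged (run (Asg ''R'' outsideE) s) ''R'' = {..<n} - S"
  unfolding flagged_Asg[OF s] S[symmetric] outsideE_def using s N_bounds(1) by (auto simp: flagged_iff)

lemma pickP_spec:
  assumes s: "ok s" and S: "flagged s ''S'' = S"
  defines "s' \<equiv> run pickP s" and "R \<equiv> {..<n} - S"
  shows "\<exists>K. flagged s' ''K'' = K \<and> K \<subseteq> {..<n} \<and> s' ''k'' 0 = card K \<and> flagged s' ''B'' = K \<and>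
    flagged s' ''S'' = S \<and> cell s' ''l'' = (\<lambda>_. 0) \<and>
    ((\<exists>v0\<in>R. K = component G R v0 \<and> n * n < card K * (card K * card K)) \<or>
     (K = {} \<and> (\<forall>v\<in>R. \<not> n * n < card (component G R v) * (card (component G R v) * card (component G R v)))))"
proof -
  define s1 where "s1 = run (Asg ''R'' outsideE) s"
  define s2 where "s2 = run componentsP s1"
  define s3 where "s3 = run (Asg ''c'' (Cnt 1 (And (At ''R'' 1) (Eq (At ''r'' 0) (At ''r'' 1))))) s2"
  define s4 where "s4 = run (Asg ''g'' (Mu 1 2 (And (At ''R'' 2) (Lt (Mul (Sc ''n'') (Sc ''n'')) (Mul (At ''c'' 2) (Mul (At ''c'' 2) (At ''c'' 2))))))) s3"
  define s5 where "s5 = run (Asg ''K'' (And (And (At ''R'' 0) (Lt (Sc ''g'') (Sc ''n''))) (Eq (At ''r'' 0) (Ar ''r'' (Sc ''g''))))) s4"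
  define s6 where "s6 = run (Asg ''B'' (At ''K'' 0)) s5"
  define s7 where "s7 = run (Asg ''l'' (Cn 0)) s6"
  have s': "s' = run (Asg ''k'' (Cnt 1 (At ''K'' 1))) s7"
    unfolding s'_def pickP_def run.simps(2) s1_def s2_def s3_def s4_def s5_def s6_def s7_def ..
  have ok1: "ok s1" unfolding s1_def by (rule ok_run[OF s]) simp
  have ok2: "ok s2" unfolding s2_def by (rule ok_run[OF ok1]) simp
  have ok3: "ok s3" unfolding s3_def by (rule ok_run[OF ok2]) simp
  have ok4: "ok s4" unfolding s4_def by (rule ok_run[OF ok3]) simp
  have ok5: "ok s5" unfolding s5_def by (rule ok_run[OF ok4]) simp
  have ok6: "ok s6" unfolding s6_def by (rule ok_run[OF ok5]) simp
  have ok7: "ok s7" unfolding s7_def by (rule ok_run[OF ok6]) simp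
  have Rn: "R \<subseteq> {..<n}" by (auto simp: R_def)
  have RN: "v < N" if "v \<in> R" for v using that Rn N_bounds(1) by auto
  have finR: "finite R" by (simp add: R_def)
  have R1: "flagged s1 ''R'' = R" unfolding s1_def R_def by (rule outside_spec[OF s S])
  have R2: "flagged s2 ''R'' = R" unfolding s2_def by (subst flagged_frame) (simp_all add: R1)
  have r: "s2 ''r'' v = s2 ''r'' w \<longleftrightarrow> w \<in> component G R v" if "v \<in> R" "w \<in> R" for v w
    unfolding s2_def by (rule componentsP_spec[OF ok1 R1 Rn that])
  let ?q = "\<lambda>v. card (component G R v)"
  have c3: "s3 ''c'' v = ?q v" if v: "v \<in> R" for v
  proof -
    have "s3 ''c'' v = card {w. w < N \<and> s2 ''R'' w \<noteq> 0 \<and> s2 ''r'' v = s2 ''r'' w}"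
      unfolding s3_def using run_Asg[OF ok2 RN[OF v]] ok2 by simp
    also have "{w. w < N \<and> s2 ''R'' w \<noteq> 0 \<and> s2 ''r'' v = s2 ''r'' w} = component G R v"
    proof (rule set_eqI)
      fix w
      have "w < N \<and> s2 ''R'' w \<noteq> 0 \<longleftrightarrow> w \<in> R" unfolding R2[symmetric] by (simp add: flagged_iff)
      then show "w \<in> {w. w < N \<and> s2 ''R'' w \<noteq> 0 \<and> s2 ''r'' v = s2 ''r'' w} \<longleftrightarrow> w \<in> component G R v"
        using r[OF v] component_subset[OF v, of G] by blast
    qed
    finally show ?thesis .
  qed
  have qn: "?q v \<le> n" if v: "v \<in> R" for v
    using card_mono[OF finite_lessThan order_trans[OF component_subset[OF v] Rn]] by simp
  have R3: "s3 ''R'' = s2 ''R''" unfolding s3_def by (simp add: run_frame)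
  define P where "P v \<longleftrightarrow> s2 ''R'' v \<noteq> 0 \<and> ev (Mul (Sc ''n'') (Sc ''n'')) ((\<lambda>_. 0)(2 := v)) s3 <
     ev (Mul (At ''c'' 2) (Mul (At ''c'' 2) (At ''c'' 2))) ((\<lambda>_. 0)(2 := v)) s3" for v
  define Gd where "Gd v \<longleftrightarrow> v \<in> R \<and> n * n < ?q v * (?q v * ?q v)" for v
  have PGd: "P v \<longleftrightarrow> Gd v" if v: "v < N" for v
  proof -
    have Rv: "s2 ''R'' v \<noteq> 0 \<longleftrightarrow> v \<in> R" using R2 v by (auto simp: flagged_iff)
    show ?thesis
    proof (cases "v \<in> R")
      case True
      have nn: "ev (Mul (Sc ''n'') (Sc ''n'')) ((\<lambda>_. 0)(2 := v)) s3 = n * n"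
        by (rule ev_Mul) (use ok3 N_bounds(1) in simp_all)
      \<comment> \<open>\<open>ev_Mul\<close> asks that the first factor be at most
        \<open>N\<close>. Component sizes meet this by \<open>qn\<close>, so the cube is nested in
        the second factor.\<close>
      have cc: "ev (Mul (At ''c'' 2) (At ''c'' 2)) ((\<lambda>_. 0)(2 := v, 8 := i)) s3 = ?q v * ?q v" for i
        by (rule ev_Mul) (use ok3 c3[OF True] qn[OF True] N_bounds(1) in simp_all)
      have "ev (Mul (At ''c'' 2) (Mul (At ''c'' 2) (At ''c'' 2))) ((\<lambda>_. 0)(2 := v)) s3 = ?q v * (?q v * ?q v)"
        by (rule ev_Mul) (use ok3 c3[OF True] qn[OF True] N_bounds(1) cc in simp_all)
      then show ?thesis unfolding P_def Gd_def nn using Rv True by simp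
    next
      case False
      then show ?thesis unfolding P_def Gd_def using Rv by simp
    qed
  qed
  define g where "g = s4 ''g'' 0"
  have g: "g = (if \<exists>v<N. P v then LEAST v. P v else N)"
  proof -
    have "g = ev (Mu 1 2 (And (At ''R'' 2) (Lt (Mul (Sc ''n'') (Sc ''n'')) (Mul (At ''c'' 2) (Mul (At ''c'' 2) (At ''c'' 2)))))) ((\<lambda>_. 0)(0 := 0)) s3"
      unfolding g_def s4_def by (rule run_Asg[OF ok3]) (use N_bounds in simp)
    also have "\<dots> = (if \<exists>v<s3 ''N'' 0. P v then LEAST v. P v else s3 ''N'' 0)"
    proof (rule ev_Mu)
      fix i j :: nat
      have "ev (Mul (Sc ''n'') (Sc ''n'')) \<rho> s3 = n * n" for \<rho>
        by (rule ev_Mul) (use ok3 N_bounds(1) in simp_all)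
      moreover have "ev (Mul (At ''c'' 2) (Mul (At ''c'' 2) (At ''c'' 2))) (((\<lambda>_. 0)(0 := 0))(1 := j, 2 := i)) s3 =
        ev (Mul (At ''c'' 2) (Mul (At ''c'' 2) (At ''c'' 2))) ((\<lambda>_. 0)(2 := i)) s3"
        by (simp add: Mul_def cong: if_cong)
      ultimately show "holds (And (At ''R'' 2) (Lt (Mul (Sc ''n'') (Sc ''n'')) (Mul (At ''c'' 2) (Mul (At ''c'' 2) (At ''c'' 2)))))
        (((\<lambda>_. 0)(0 := 0))(1 := j, 2 := i)) s3 \<longleftrightarrow> P i"
        unfolding P_def by (simp add: R3)
    qed simp
    finally show ?thesis unfolding ok_simps(2)[OF ok3] .
  qed
  have gyes: "Gd g" if gn: "g < n"
  proof -
    have ex: "\<exists>v<N. P v"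
    proof (rule ccontr)
      assume "\<not> ?thesis"
      then have "g = N" using g by (simp only: if_False)
      then show False using gn N_bounds(1) by simp
    qed
    then have "P (LEAST v. P v)" by (meson LeastI)
    moreover have "g = (LEAST v. P v)" using g unfolding if_P[OF ex] .
    ultimately have "P g" by simp
    then show ?thesis using PGd[of g] gn N_bounds(1) by simp
  qed
  have gno: "\<not> Gd v" if gn: "\<not> g < n" for v
  proof
    assume v: "Gd v"
    then have vR: "v \<in> R" by (simp add: Gd_def)
    have "P v" using PGd[OF RN[OF vR]] v by simp
    moreover from this have ex: "\<exists>v<N. P v" using RN[OF vR] by blast
    have "g = (LEAST v. P v)" using g unfolding if_P[OF ex] .
    ultimately have "g \<le> v" by (simp add: Least_le)
    then show False using gn vR Rn by auto
  qed
  have fr4: "s4 ''R'' = s2 ''R''" "s4 ''r'' = s2 ''r''" unfolding s4_def s3_def by (simp_all add: run_frame)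
  define K where "K = flagged s5 ''K''"
  have K5: "K = {v \<in> R. g < n \<and> s2 ''r'' v = s2 ''r'' g}"
  proof -
    have "K = {v. v < N \<and> s2 ''R'' v \<noteq> 0 \<and> g < n \<and> s2 ''r'' v = s2 ''r'' g}"
      unfolding K_def s5_def flagged_Asg[OF ok4] using ok4 by (simp add: fr4 g_def)
    then show ?thesis unfolding R2[symmetric] by (simp add: flagged_iff conj_assoc)
  qed
  have Kn: "K \<subseteq> {..<n}" using K5 Rn by blast
  have B6: "flagged s6 ''B'' = K" unfolding s6_def flagged_Asg[OF ok5] K_def by (simp add: flagged_def)
  have l7: "cell s7 ''l'' = (\<lambda>_. 0)"
    unfolding s7_def by (rule ext) (use run_Asg[OF ok6] in \<open>simp add: cell_def\<close>)
  have K7: "flagged s7 ''K'' = K" unfolding s7_def s6_def K_def by (simp add: flagged_frame)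
  have k: "s' ''k'' 0 = card K"
  proof -
    have "s' ''k'' 0 = card {j. j < N \<and> s7 ''K'' j \<noteq> 0}"
      unfolding s' using run_Asg[OF ok7, of 0] ok7 N_bounds by simp
    also have "{j. j < N \<and> s7 ''K'' j \<noteq> 0} = flagged s7 ''K''" by (simp add: flagged_def)
    finally show ?thesis unfolding K7 .
  qed
  have fr: "flagged s' ''K'' = K" "flagged s' ''B'' = K" "cell s' ''l'' = (\<lambda>_. 0)"
    unfolding s' using K7 B6 l7 by (simp_all add: flagged_frame cell_frame s7_def)
  have S': "flagged s' ''S'' = S" unfolding s'_def by (subst flagged_frame) (simp_all add: S)
  have "(\<exists>v0\<in>R. K = component G R v0 \<and> n * n < card K * (card K * card K)) \<or>
     (K = {} \<and> (\<forall>v\<in>R. \<not> n * n < ?q v * (?q v * ?q v)))"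
  proof (cases "g < n")
    case True
    have gR: "g \<in> R" "n * n < ?q g * (?q g * ?q g)" using gyes[OF True] by (simp_all add: Gd_def)
    have "K = component G R g"
    proof (rule set_eqI)
      fix v
      show "v \<in> K \<longleftrightarrow> v \<in> component G R g"
        using r[OF gR(1), of v] component_subset[OF gR(1), of G] True unfolding K5 by auto
    qed
    then show ?thesis using gR by blast
  next
    case False
    then have "K = {}" using K5 by blast
    then show ?thesis using gno[OF False] unfolding Gd_def by blast
  qed
  then show ?thesis using fr k S' Kn by blast
qed

end

text \<open>The cube of \<open>n powr (2/3)\<close> is \<open>n * n\<close>, so the integer test of
  \<open>pickP\<close> compares with the real threshold exactly.\<close>

lemma cube_less_imp:
  assumes "n * n < k * (k * k)" "n > 0"
  shows "real n powr (2 / 3) < real k"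
proof -
  have k0: "k > 0" using assms by (cases k) auto
  have "(real n powr (2 / 3)) powr 3 = real n powr 2" by (simp add: powr_powr)
  also have "\<dots> = real (n * n)" using assms(2) by (simp add: powr_numeral power2_eq_square)
  also have "\<dots> < real (k * (k * k))" using assms(1) by (simp only: of_nat_less_iff)
  also have "\<dots> = real k powr 3" using k0 by (simp add: powr_numeral power3_eq_cube)
  finally show ?thesis by (rule powr_less_cancel2[rotated 3]) (use assms k0 in simp_all)
qed

lemma cube_le_imp:
  assumes "k * (k * k) \<le> n * n" "n > 0"
  shows "real k \<le> real n powr (2 / 3)"
proof (cases "k = 0")
  case False
  have "real k powr 3 = real (k * (k * k))" using False by (simp add: powr_numeral power3_eq_cube)
  also have "\<dots> \<le> real (n * n)" using assms(1) by (simp only: of_nat_le_iff)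
  also have "\<dots> = real n powr 2" using assms(2) by (simp add: powr_numeral power2_eq_square)
  also have "\<dots> = (real n powr (2 / 3)) powr 3" by (simp add: powr_powr)
  finally show ?thesis
    by (metis powr_less_cancel_iff linorder_not_less powr_less_mono2 of_nat_0_le_iff powr_ge_zero zero_less_numeral)
qed simp

context planar_input
begin

lemma run_outerP: "run outerP s = run (It stepP) (run pickP s)"
  by (simp add: outerP_def run.simps(2))

lemma component_nonempty_connected: "v0 \<in> R \<Longrightarrow> K = component G R v0 \<Longrightarrow> K \<noteq> {} \<and> induces_connected G K"
  using component_self[of v0 G R] component_connected[OF symG, of v0 R] by auto

text \<open>Termination and size are argued separately: every round with a large component adds a
  vertex to \<open>S\<close>, while the bound on \<open>card S\<close> comes from the weights
  \<open>potential\<close> and not from the number of rounds.\<close>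

lemma outer_spec:
  assumes s: "ok s" and S: "flagged s ''S'' = {}"
  defines "s' \<equiv> run (It outerP) s" and "V \<equiv> {..<n}"
  shows "ok s' \<and> flagged s' ''S'' \<subseteq> V \<and> real (card (flagged s' ''S'')) \<le> 231 * real n powr (2 / 3) \<and>
    (\<forall>v\<in>V - flagged s' ''S''. real (card (component G (V - flagged s' ''S'') v)) \<le> 231 * real n powr (2 / 3))"
proof -
  let ?r = "real n powr (2 / 3)"
  let ?q = "\<lambda>S v. card (component G (V - S) v)"
  define I where "I s2 \<longleftrightarrow> ok s2 \<and> flagged s2 ''S'' \<subseteq> V \<and>
    real (card (flagged s2 ''S'')) \<le> 66 * (sqrt 2 + 1) * (\<Sum>v\<in>V. potential G V ?r (flagged s2 ''S'') v)" for s2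
  define Dn where "Dn s2 \<longleftrightarrow> (\<forall>v\<in>V - flagged s2 ''S''. \<not> n * n < ?q (flagged s2 ''S'') v * (?q (flagged s2 ''S'') v * ?q (flagged s2 ''S'') v))" for s2
  have finV: "finite V" by (simp add: V_def)
  have pot0: "potential G V ?r S v \<ge> 0" for S v by (simp add: potential_def le_max_iff_disj)
  have main: "ok (run outerP s2) \<and>
      ((Dn s2 \<and> flagged (run outerP s2) ''S'' = flagged s2 ''S'') \<or>
       (\<exists>v0 X. v0 \<in> V - flagged s2 ''S'' \<and> n * n < ?q (flagged s2 ''S'') v0 * (?q (flagged s2 ''S'') v0 * ?q (flagged s2 ''S'') v0) \<and>
          separates (component G (V - flagged s2 ''S'') v0) X \<and> flagged (run outerP s2) ''S'' = flagged s2 ''S'' \<union> X))"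
    if o2: "ok s2" for s2
  proof -
    let ?S = "flagged s2 ''S''" and ?p = "run pickP s2"
    have okp: "ok ?p" by (rule ok_run[OF o2]) simp
    have oko: "ok (run outerP s2)" by (rule ok_run[OF o2]) auto
    obtain K where K: "flagged ?p ''K'' = K" "K \<subseteq> V" "?p ''k'' 0 = card K" "flagged ?p ''B'' = K"
      "flagged ?p ''S'' = ?S" "cell ?p ''l'' = (\<lambda>_. 0)"
      and alt: "(\<exists>v0\<in>V - ?S. K = component G (V - ?S) v0 \<and> n * n < card K * (card K * card K)) \<or>
       (K = {} \<and> (\<forall>v\<in>V - ?S. \<not> n * n < ?q ?S v * (?q ?S v * ?q ?S v)))"
      using pickP_spec[OF o2 refl, folded V_def] by (elim exE conjE) (rule that)
    note inn = inner_spec[OF okp K(1) K(2)[unfolded V_def] K(3-6), folded run_outerP]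
    from alt show ?thesis
    proof
      assume "\<exists>v0\<in>V - ?S. K = component G (V - ?S) v0 \<and> n * n < card K * (card K * card K)"
      then obtain v0 where v0: "v0 \<in> V - ?S" "K = component G (V - ?S) v0" "n * n < card K * (card K * card K)" by blast
      obtain X where X: "flagged (run outerP s2) ''S'' = ?S \<union> X" "separates K X"
        using inn(1) component_nonempty_connected[OF v0(1,2)] by blast
      show ?thesis using oko v0 X by blast
    next
      assume "K = {} \<and> (\<forall>v\<in>V - ?S. \<not> n * n < ?q ?S v * (?q ?S v * ?q ?S v))"
      then have "Dn s2" "flagged (run outerP s2) ''S'' = ?S" using inn(2) by (simp_all add: Dn_def)
      then show ?thesis using oko by blast
    qed
  qed
  have "I ((run outerP ^^ N) s) \<and> Dn ((run outerP ^^ N) s)"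
  proof (rule iterate_until[where \<mu> = "\<lambda>s2. n - card (flagged s2 ''S'')"])
    show "I s" unfolding I_def using s S pot0 by (simp add: sum_nonneg)
    fix s2 assume i2: "I s2"
    let ?S = "flagged s2 ''S''"
    have o2: "ok s2" and SV: "?S \<subseteq> V" using i2 by (simp_all add: I_def)
    have pos: "n > 0" if "v0 \<in> V" for v0 using that by (auto simp: V_def)
    show "I (run outerP s2)"
    proof (cases "Dn s2 \<and> flagged (run outerP s2) ''S'' = ?S")
      case True
      then show ?thesis using i2 main[OF o2] unfolding I_def by simp
    next
      case False
      then obtain v0 X where v0: "v0 \<in> V - ?S" "n * n < ?q ?S v0 * (?q ?S v0 * ?q ?S v0)"
        and X: "separates (component G (V - ?S) v0) X" "flagged (run outerP s2) ''S'' = ?S \<union> X"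
        using main[OF o2] by blast
      have XK: "X \<subseteq> component G (V - ?S) v0" using X(1) by (simp add: separates_def)
      have n0: "n > 0" using pos v0(1) by blast
      have "real (card (?S \<union> X)) \<le> 66 * (sqrt 2 + 1) * (\<Sum>v\<in>V. potential G V ?r (?S \<union> X) v)"
      proof (rule separation_step[OF symG finV SV _ v0(1) refl _ XK])
        show "?r > 0" using n0 by simp
        show "?r < real (card (component G (V - ?S) v0))" by (rule cube_less_imp[OF v0(2) n0])
        show "real (card ?S) \<le> 66 * (sqrt 2 + 1) * (\<Sum>v\<in>V. potential G V ?r ?S v)" using i2 by (simp add: I_def)
      qed (use X(1) in \<open>simp_all add: separates_def\<close>)
      moreover have "?S \<union> X \<subseteq> V" using SV XK component_subset[OF v0(1), of G] by blast
      ultimately show ?thesis using main[OF o2] unfolding I_def X(2) by simp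
    qed
    show "n - card (flagged (run outerP s2) ''S'') < n - card ?S" if nd: "\<not> Dn s2"
    proof -
      obtain v0 X where v0: "v0 \<in> V - ?S"
        and X: "separates (component G (V - ?S) v0) X" "flagged (run outerP s2) ''S'' = ?S \<union> X"
        using main[OF o2] nd by blast
      let ?K = "component G (V - ?S) v0"
      have XK: "X \<subseteq> ?K" using X(1) by (simp add: separates_def)
      have KV: "?K \<subseteq> V - ?S" by (rule component_subset[OF v0])
      have finK: "finite ?K" by (rule finite_subset[OF KV]) (use finV in simp)
      \<comment> \<open>The component is connected, so without separator vertices it would be at
        most half as large as itself.\<close>
      have "X \<noteq> {}"
      proof
        assume XE: "X = {}"
        have "component G ?K v0 = ?K"
          by (rule connected_component_eq_self[OF component_connected[OF symG v0] component_self])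
        moreover have "card ?K > 0" using finK component_self[of v0 G] by (auto simp: card_gt_0_iff)
        moreover have "2 * card (component G (?K - X) v0) \<le> card ?K"
          using X(1) component_self[of v0 G] XE unfolding separates_def by simp
        ultimately show False using XE by simp
      qed
      then have "?S \<subset> ?S \<union> X" using XK KV by blast
      then have "card ?S < card (?S \<union> X)" using finite_subset[OF XK finK] by (intro psubset_card_mono) simp_all
      moreover have "card (?S \<union> X) \<le> card V" using SV XK KV by (intro card_mono finV) blast
      ultimately show ?thesis unfolding X(2) by (simp add: V_def)
    qed
    show "Dn (run outerP s2)" if d: "Dn s2"
    proof -
      have "flagged (run outerP s2) ''S'' = ?S" using main[OF o2] d unfolding Dn_def by blast
      then show ?thesis using d unfolding Dn_def by simp
    qed
  qed (use N_bounds in simp)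
  then have fin: "I s'" "Dn s'" unfolding s'_def run_It[OF s] by simp_all
  show ?thesis
  \<comment> \<open>The bounds for the threshold need \<open>n > 0\<close>; for \<open>n = 0\<close>
    there are no vertices.\<close>
  proof (cases "n = 0")
    case True
    then show ?thesis using fin(1) unfolding I_def V_def by simp
  next
    case False
    have small: "real (?q (flagged s' ''S'') v) \<le> 231 * ?r" if "v \<in> V - flagged s' ''S''" for v
    proof -
      have "real (?q (flagged s' ''S'') v) \<le> ?r"
        by (rule cube_le_imp) (use fin(2) that False in \<open>simp_all add: Dn_def not_less\<close>)
      also have "?r \<le> 231 * ?r" by simp
      finally show ?thesis .
    qed
    moreover have "real (card (flagged s' ''S'')) \<le> 231 * ?r"
      by (rule separator_card_bound[where V = V and G = G]) (use fin(1) False in \<open>simp_all add: I_def V_def\<close>)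
    ultimately show ?thesis using fin(1) unfolding I_def by blast
  qed
qed

lemma mainP_spec:
  assumes s: "ok s" and S: "flagged s ''S'' = {}"
  shows "\<exists>c. outputs_coloring es (run mainP s) c \<and> edge_2_coloring {..<n} (edges_of es) c \<and>
    real (largest_group_size (edges_of es) c) \<le> 462 * real n powr (2 / 3) * real (OPT2 {..<n} (edges_of es))"
proof -
  let ?V = "{..<n}"
  define s1 where "s1 = run (It outerP) s"
  define S1 where "S1 = flagged s1 ''S''"
  define s2 where "s2 = run (Asg ''R'' outsideE) s1"
  define s3 where "s3 = run componentsP s2"
  have run: "run mainP s = run (Asg ''color'' (If (Or (Ar ''S'' (At ''u'' 0)) (Ar ''S'' (At ''v'' 0))) (Cn 0) (Pl (Cn 1) (Ar ''r'' (At ''u'' 0))))) s3"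
    unfolding mainP_def run.simps(2) s1_def s2_def s3_def ..
  have o: "ok s1" "S1 \<subseteq> ?V" "real (card S1) \<le> 231 * real n powr (2 / 3)"
    "\<And>v. v \<in> ?V - S1 \<Longrightarrow> real (card (component G (?V - S1) v)) \<le> 231 * real n powr (2 / 3)"
    using outer_spec[OF s S] unfolding s1_def[symmetric] S1_def[symmetric] by blast+
  have ok2: "ok s2" unfolding s2_def by (rule ok_run[OF o(1)]) simp
  have ok3: "ok s3" unfolding s3_def by (rule ok_run[OF ok2]) simp
  have R2: "flagged s2 ''R'' = ?V - S1" unfolding s2_def by (rule outside_spec[OF o(1) S1_def[symmetric]])
  define rep where "rep = s3 ''r''"
  have rep: "rep v = rep w \<longleftrightarrow> w \<in> component G (?V - S1) v" if "v \<in> ?V - S1" "w \<in> ?V - S1" for v w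
    unfolding rep_def s3_def by (rule componentsP_spec[OF ok2 R2 _ that]) blast
  have S3: "s3 ''S'' = s1 ''S''" unfolding s3_def s2_def by (simp add: run_frame)
  \<comment> \<open>\<open>Min e\<close> merely picks an end of \<open>e\<close>. Both ends of an
    edge off \<open>S1\<close> have the same \<open>rep\<close>, so this agrees with the program,
    which takes the first listed end.\<close>
  define c where "c e = (if e \<inter> S1 \<noteq> {} then 0 else Suc (rep (Min e)))" for e
  have inE: "\<exists>i<length es. e = {fst (es ! i), snd (es ! i)}" if eE: "e \<in> edges_of es" for e
  proof -
    obtain p where "p \<in> set es" "e = endpoints p" using eE unfolding edges_of_def by blast
    then show ?thesis unfolding in_set_conv_nth endpoints_def by blast
  qed
  have repc: "rep (fst (es ! i)) = rep (snd (es ! i))"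
    if i: "i < length es" and dis: "{fst (es ! i), snd (es ! i)} \<inter> S1 = {}" for i
  proof -
    have V: "fst (es ! i) \<in> ?V - S1" "snd (es ! i) \<in> ?V - S1" using edge_range[OF i] dis by auto
    have "(fst (es ! i), snd (es ! i)) \<in> G" unfolding G_iff using i by blast
    then show ?thesis using rep[OF V] component_step[OF component_self V] by blast
  qed
  have c_eq: "c {fst (es ! i), snd (es ! i)} = Suc (rep w)"
    if i: "i < length es" and dis: "{fst (es ! i), snd (es ! i)} \<inter> S1 = {}" and w: "w \<in> {fst (es ! i), snd (es ! i)}" for i w
  proof -
    have "Min {fst (es ! i), snd (es ! i)} \<in> {fst (es ! i), snd (es ! i)}" by (rule Min_in) simp_all
    then have "rep (Min {fst (es ! i), snd (es ! i)}) = rep w" using repc[OF i dis] w by auto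
    then show ?thesis using dis by (simp add: c_def)
  qed
  have out: "outputs_coloring es (run mainP s) c"
    unfolding outputs_coloring_def
  proof (intro allI impI)
    fix i assume i: "i < length es"
    have uv: "fst (es ! i) < N" "snd (es ! i) < N" using edge_range[OF i] N_bounds(1) by auto
    have mem: "s3 ''S'' x \<noteq> 0 \<longleftrightarrow> x \<in> S1" if "x < N" for x
      unfolding S3 S1_def using that by (simp add: flagged_iff)
    have "i < N" using i N_bounds(2) by simp
    then have "run mainP s ''color'' i = (if s3 ''S'' (fst (es ! i)) \<noteq> 0 \<or> s3 ''S'' (snd (es ! i)) \<noteq> 0 then 0 else 1 + rep (fst (es ! i)))"
      unfolding run using run_Asg[OF ok3] ok3 i by (simp add: rep_def)
    also have "\<dots> = c (endpoints (es ! i))"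
    proof (cases "{fst (es ! i), snd (es ! i)} \<inter> S1 = {}")
      case True
      then have "s3 ''S'' (fst (es ! i)) = 0" "s3 ''S'' (snd (es ! i)) = 0" using mem uv by auto
      then show ?thesis using c_eq[OF i True, of "fst (es ! i)"] by (simp add: endpoints_def)
    next
      case False
      then have "s3 ''S'' (fst (es ! i)) \<noteq> 0 \<or> s3 ''S'' (snd (es ! i)) \<noteq> 0" using mem uv by auto
      then show ?thesis using False by (simp add: endpoints_def c_def)
    qed
    finally show "c (endpoints (es ! i)) = run mainP s ''color'' i" ..
  qed
  have sc: "edge_2_coloring ?V (edges_of es) c \<and>
    real (largest_group_size (edges_of es) c) \<le> 2 * (231 * real n powr (2 / 3)) * real (OPT2 ?V (edges_of es))"
  proof (intro conjI)
    have fE: "finite (edges_of es)" by (simp add: edges_of_def)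
    have sub: "e \<subseteq> ?V \<and> e \<noteq> {}" if "e \<in> edges_of es" for e
      using inE[OF that] edge_range by fastforce
    have c0: "c e = 0" if "e \<in> edges_of es" "e \<inter> S1 \<noteq> {}" for e using that(2) by (simp add: c_def)
    have c1: "c e = Suc (rep w)" if "e \<in> edges_of es" "e \<inter> S1 = {}" "w \<in> e" for e w
      using inE[OF that(1)] c_eq that(2,3) by blast
    have rp: "w \<in> component G (?V - S1) u" if "u \<in> ?V - S1" "w \<in> ?V - S1" "rep u = rep w" for u w
      using rep[OF that(1,2)] that(3) by simp
    note sep = separator_coloring[OF finite_lessThan o(2) fE sub c0 c1 rp o(3,4)]
    show "edge_2_coloring ?V (edges_of es) c" by (rule sep(1))
    show "real (largest_group_size (edges_of es) c) \<le> 2 * (231 * real n powr (2 / 3)) * real (OPT2 ?V (edges_of es))"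
      by (rule sep(2))
  qed
  then have "real (largest_group_size (edges_of es) c) \<le> 462 * real n powr (2 / 3) * real (OPT2 ?V (edges_of es))" by simp
  with out sc show ?thesis by blast
qed

end

theorem theorem11:
  "\<exists>(P :: prog) (p :: nat poly) (C :: real).
     \<forall>(n :: nat) (es :: (nat \<times> nat) list).
       graph_input n es \<and> planar_graph {..<n} (edges_of es) \<longrightarrow>
       (\<exists>t s c.
          exec P (input_store n es) t s \<and>
          t \<le> poly p (n + length es) \<and>
          outputs_coloring es s c \<and>
          edge_2_coloring {..<n} (edges_of es) c \<and>
          real (largest_group_size (edges_of es) c)
            \<le> C * real n powr (2 / 3) * real (OPT2 {..<n} (edges_of es)))"
proof -
  let ?P = "Seq (Assign ''N'' (Lit 0) (Add (Read ''n'' (Lit 0)) (Add (Read ''m'' (Lit 0)) (Add (Read ''m'' (Lit 0)) (Lit 6)))))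
    (compile mainP 0)"
  \<comment> \<open>\<open>N = n + 2 * length es + 6\<close> is at most the value of
    \<open>[:6, 2:]\<close> at \<open>n + length es\<close>; the leading \<open>1\<close> pays for
    computing \<open>N\<close>.\<close>
  let ?p = "1 + pcompose (cost mainP) [:6, 2:]"
  \<comment> \<open>The constant is \<open>2 * 231\<close>: a degree is at most
    \<open>2 * OPT2\<close>, and \<open>231\<close> bounds both the separator and the remaining
    components.\<close>
  have "\<exists>t s c. exec ?P (input_store n es) t s \<and> t \<le> poly ?p (n + length es) \<and> outputs_coloring es s c \<and>
      edge_2_coloring {..<n} (edges_of es) c \<and>
      real (largest_group_size (edges_of es) c) \<le> 462 * real n powr (2 / 3) * real (OPT2 {..<n} (edges_of es))"
    if gi: "graph_input n es" and pl: "planar_graph {..<n} (edges_of es)" for n es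
  proof -
    interpret planar_input n es by unfold_locales (fact gi pl)+
    define s0 where "s0 = (input_store n es)(''N'' := (input_store n es ''N'')(0 := N))"
    have ok0: "ok s0" unfolding ok_def by (simp add: s0_def input_store_def)
    have sim0: "simulates s0 s0" by (simp add: simulates_def s0_def input_store_def)
    have S0: "flagged s0 ''S'' = {}" by (simp add: flagged_def s0_def input_store_def)
    have "runs ?P (input_store n es) (1 + poly (cost mainP) (s0 ''N'' 0)) (\<lambda>s'. simulates s' (run mainP s0) \<and> (\<forall>j<0. s' ''_c'' j = s0 ''_c'' j))"
    proof (rule runs_Assign_Seq)
      have v: "val (Add (Read ''n'' (Lit 0)) (Add (Read ''m'' (Lit 0)) (Add (Read ''m'' (Lit 0)) (Lit 6)))) (input_store n es) = N"
        by (simp add: input_store_def N_def)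
      show "runs (compile mainP 0)
        ((input_store n es)(''N'' := (input_store n es ''N'')(val (Lit 0) (input_store n es) :=
          val (Add (Read ''n'' (Lit 0)) (Add (Read ''m'' (Lit 0)) (Add (Read ''m'' (Lit 0)) (Lit 6)))) (input_store n es))))
        (poly (cost mainP) (s0 ''N'' 0)) (\<lambda>s'. simulates s' (run mainP s0) \<and> (\<forall>j<0. s' ''_c'' j = s0 ''_c'' j))"
        unfolding v val.simps(1) s0_def[symmetric] by (rule runs_compile[OF well_formed_mainP sim0])
    qed
    then obtain t s where t: "exec ?P (input_store n es) t s" "t \<le> 1 + poly (cost mainP) N" "simulates s (run mainP s0)"
      unfolding runs_def ok_simps(2)[OF ok0] by blast
    have "poly (cost mainP) N \<le> poly (cost mainP) (6 + (n + length es) * 2)"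
      by (rule poly_nat_mono) (simp add: N_def)
    then have "t \<le> poly ?p (n + length es)" using t(2) by (simp add: poly_pcompose)
    moreover obtain c where c: "outputs_coloring es (run mainP s0) c" "edge_2_coloring {..<n} (edges_of es) c"
      "real (largest_group_size (edges_of es) c) \<le> 462 * real n powr (2 / 3) * real (OPT2 {..<n} (edges_of es))"
      using mainP_spec[OF ok0 S0] by blast
    moreover have "s ''color'' = run mainP s0 ''color''"
      using t(3) unfolding simulates_def by (simp add: reserved_def)
    then have "outputs_coloring es s c" using c(1) by (simp add: outputs_coloring_def)
    ultimately show ?thesis using t(1) by blast
  qed
  then show ?thesis by blast
qed

end
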